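(* Let $\mathcal H=\bigoplus_{n\ge0}\mathcal H_n$, where $\mathcal H_0=K\mathbf 1$ and $\mathcal H_n$ ($n\ge1$) is the vector space spanned by homeomorphism classes of topologies on $n$-element sets, endowed with the commutative product $\cdot$, the external coproduct $\Delta$ and the internal coproduct $\Gamma$ induced from the species-level operations. Then: (1) $(\mathcal H,\cdot,\Delta)$ is a commutative graded connected Hopf algebra; (2) $(\mathcal H,\cdot,\Gamma)$ is a commutative bialgebra, graded by the degree $d$; (3) $(\mathcal H,\cdot,\Delta)$ is a comodule-coalgebra over $(\mathcal H,\cdot,\Gamma)$; more precisely, the maps below are unital algebra morphisms and $(I\otimes\Delta)\circ\Gamma=m^{1,3}\circ(\Gamma\otimes\Gamma)\circ\Delta$ as maps $\mathcal H\to\mathcal H\otimes\mathcal H\otimes\mathcal H$, where $m^{1,3}(a\otimes b\otimes c\otimes d)=ac\otimes b\otimes d$.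
   Context: All vector spaces are over a field $K$. For a topology $\mathcal T$ on a finite set $X$: $x\le_{\mathcal T}y$ iff every open set containing $x$ contains $y$ (topologies correspond to quasi-orders, open sets being final segments); $x\sim_{\mathcal T}y$ iff $x\le_{\mathcal T}y\le_{\mathcal T}x$; $\mathcal T|_Y=\{Z\cap Y:Z\in\mathcal T\}$; $Y$ is $\mathcal T$-connected if $(Y,\mathcal T|_Y)$ is connected. Species-level operations: product of $\mathcal T_1$ on $X_1$ and $\mathcal T_2$ on $X_2$ (disjoint) is $\mathcal T_1\mathcal T_2$ on $X_1\sqcup X_2$ with $Y$ open iff $Y\cap X_i\in\mathcal T_i$; external coproduct $\Delta(\mathcal T)=\sum_{Y\in\mathcal T}\mathcal T|_{X\setminus Y}\otimes\mathcal T|_Y$; internal coproduct $\Gamma(\mathcal T)=\sum_{\mathcal T'}\mathcal T'\otimes\mathcal T/\mathcal T'$ over $\mathcal T$-admissible $\mathcal T'$, where: $\mathcal T'\prec\mathcal T$ means every $\mathcal T$-open is $\mathcal T'$-open; for $\mathcal T'\prec\mathcal T$, $\mathcal T/\mathcal T'$ is the topology on $X$ whose quasi-order is the transitive closure of $x\,\mathcal R\,y\iff(x\le_{\mathcal T}y\text{ or }y\le_{\mathcal T'}x)$; $\mathcal T'$ is $\mathcal T$-admissible if $\mathcal T'\prec\mathcal T$, $\mathcal T'|_Y=\mathcal T|_Y$ for all $\mathcal T'$-connected $Y$, and $x\sim_{\mathcal T/\mathcal T'}y\iff x\sim_{\mathcal T'/\mathcal T'}y$. These operations are compatible with homeomorphism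 and descend to $\mathcal H$; the unit $\mathbf 1$ is the topology on the empty set, $\Gamma$ preserves each $\mathcal H_n$. The counit of $\Gamma$ sends $\mathcal T$ to $1$ if $\le_{\mathcal T}$ is an equivalence relation and to $0$ otherwise. The degree $d(\mathcal T)$ is the number of $\sim_{\mathcal T}$-equivalence classes minus the number of connected components of $\mathcal T$. The grading of $(\mathcal H,\cdot,\Delta)$ is by $n$. *)

theory Defs
  imports "HOL-Analysis.Analysis" "HOL-Library.Poly_Mapping"
begin

section \<open>Free vector spaces and their tensor products\<close>

text \<open>
  The vector space with basis \<open>'b\<close> over the field \<open>'k\<close> is \<open>'b \<Rightarrow>\<^sub>0 'k\<close>.  The tensor product of the
  spaces with bases \<open>'b\<close> and \<open>'c\<close> is the space with basis \<open>'b \<times> 'c\<close>, with \<open>tens\<close> as the canonical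
  bilinear map; its universal property is \<open>tens_universal\<close> below.
\<close>

definition smul :: "'k::field \<Rightarrow> ('b \<Rightarrow>\<^sub>0 'k) \<Rightarrow> ('b \<Rightarrow>\<^sub>0 'k)" where
  "smul c x = Poly_Mapping.map ((*) c) x"

definition bas :: "'b \<Rightarrow> ('b \<Rightarrow>\<^sub>0 'k::field)" where
  "bas b = Poly_Mapping.single b 1"

lemma lookup_smul [simp]: "Poly_Mapping.lookup (smul c x) b = c * Poly_Mapping.lookup x b"
  by (simp add: smul_def Poly_Mapping.map.rep_eq when_def)

interpretation free_vs: vector_space "smul :: 'k::field \<Rightarrow> ('b \<Rightarrow>\<^sub>0 'k) \<Rightarrow> ('b \<Rightarrow>\<^sub>0 'k)"
  by unfold_locales (auto intro!: poly_mapping_eqI simp: lookup_add algebra_simps)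

abbreviation lin :: "(('b \<Rightarrow>\<^sub>0 'k::field) \<Rightarrow> ('c \<Rightarrow>\<^sub>0 'k)) \<Rightarrow> bool" where
  "lin f \<equiv> Vector_Spaces.linear smul smul f"

abbreviation lin_form :: "(('b \<Rightarrow>\<^sub>0 'k::field) \<Rightarrow> 'k) \<Rightarrow> bool" where
  "lin_form f \<equiv> Vector_Spaces.linear smul (*) f"

definition lin_ext :: "('b \<Rightarrow> ('c \<Rightarrow>\<^sub>0 'k)) \<Rightarrow> ('b \<Rightarrow>\<^sub>0 'k::field) \<Rightarrow> ('c \<Rightarrow>\<^sub>0 'k)" where
  "lin_ext f x = (\<Sum>b\<in>Poly_Mapping.keys x. smul (Poly_Mapping.lookup x b) (f b))"

definition form_ext :: "('b \<Rightarrow> 'k) \<Rightarrow> ('b \<Rightarrow>\<^sub>0 'k::field) \<Rightarrow> 'k" where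
  "form_ext f x = (\<Sum>b\<in>Poly_Mapping.keys x. Poly_Mapping.lookup x b * f b)"

definition tens :: "('b \<Rightarrow>\<^sub>0 'k::field) \<Rightarrow> ('c \<Rightarrow>\<^sub>0 'k) \<Rightarrow> ('b \<times> 'c \<Rightarrow>\<^sub>0 'k)" where
  "tens x y = (\<Sum>b\<in>Poly_Mapping.keys x. \<Sum>c\<in>Poly_Mapping.keys y.
     Poly_Mapping.single (b, c) (Poly_Mapping.lookup x b * Poly_Mapping.lookup y c))"

definition tmap :: "(('a \<Rightarrow>\<^sub>0 'k::field) \<Rightarrow> ('c \<Rightarrow>\<^sub>0 'k)) \<Rightarrow> (('b \<Rightarrow>\<^sub>0 'k) \<Rightarrow> ('d \<Rightarrow>\<^sub>0 'k))
    \<Rightarrow> ('a \<times> 'b \<Rightarrow>\<^sub>0 'k) \<Rightarrow> ('c \<times> 'd \<Rightarrow>\<^sub>0 'k)" where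
  "tmap f g = lin_ext (\<lambda>(a, b). tens (f (bas a)) (g (bas b)))"

text \<open>\<open>form_left e\<close> and \<open>form_right e\<close> are \<open>e \<otimes> I\<close> and \<open>I \<otimes> e\<close>, under \<open>K \<otimes> V = V = V \<otimes> K\<close>.\<close>

definition form_left :: "(('a \<Rightarrow>\<^sub>0 'k::field) \<Rightarrow> 'k) \<Rightarrow> ('a \<times> 'b \<Rightarrow>\<^sub>0 'k) \<Rightarrow> ('b \<Rightarrow>\<^sub>0 'k)" where
  "form_left e = lin_ext (\<lambda>(a, b). smul (e (bas a)) (bas b))"

definition form_right :: "(('b \<Rightarrow>\<^sub>0 'k::field) \<Rightarrow> 'k) \<Rightarrow> ('a \<times> 'b \<Rightarrow>\<^sub>0 'k) \<Rightarrow> ('a \<Rightarrow>\<^sub>0 'k)" where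
  "form_right e = lin_ext (\<lambda>(a, b). smul (e (bas b)) (bas a))"

definition tassoc :: "(('a \<times> 'b) \<times> 'c \<Rightarrow>\<^sub>0 'k::field) \<Rightarrow> ('a \<times> 'b \<times> 'c \<Rightarrow>\<^sub>0 'k)" where
  "tassoc = lin_ext (\<lambda>((a, b), c). bas (a, b, c))"

definition tswap :: "('a \<times> 'b \<Rightarrow>\<^sub>0 'k::field) \<Rightarrow> ('b \<times> 'a \<Rightarrow>\<^sub>0 'k)" where
  "tswap = lin_ext (\<lambda>(a, b). bas (b, a))"

definition tswap_mid :: "(('a \<times> 'b) \<times> ('c \<times> 'd) \<Rightarrow>\<^sub>0 'k::field) \<Rightarrow> (('a \<times> 'c) \<times> ('b \<times> 'd) \<Rightarrow>\<^sub>0 'k)" where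
  "tswap_mid = lin_ext (\<lambda>((a, b), (c, d)). bas ((a, c), (b, d)))"

lemma lin_ext_superset:
  assumes "finite A" "Poly_Mapping.keys x \<subseteq> A"
  shows "lin_ext f x = (\<Sum>b\<in>A. smul (Poly_Mapping.lookup x b) (f b))"
  unfolding lin_ext_def
  by (rule sum.mono_neutral_left) (use assms in \<open>auto simp: in_keys_iff\<close>)

lemma lin_lin_ext:
  fixes f :: "'b \<Rightarrow> ('c \<Rightarrow>\<^sub>0 'k::field)"
  shows "lin (lin_ext f)"
proof unfold_locales
  fix x y :: "'b \<Rightarrow>\<^sub>0 'k" and c :: 'k
  let ?A = "Poly_Mapping.keys x \<union> Poly_Mapping.keys y"
  have "lin_ext f (x + y) = (\<Sum>b\<in>?A. smul (Poly_Mapping.lookup (x + y) b) (f b))"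
    by (rule lin_ext_superset) (auto dest: subsetD[OF Poly_Mapping.keys_add])
  also have "\<dots> = (\<Sum>b\<in>?A. smul (Poly_Mapping.lookup x b) (f b)) +
      (\<Sum>b\<in>?A. smul (Poly_Mapping.lookup y b) (f b))"
    by (simp add: lookup_add free_vs.scale_left_distrib sum.distrib)
  also have "\<dots> = lin_ext f x + lin_ext f y"
    by (simp add: lin_ext_superset[of ?A])
  finally show "lin_ext f (x + y) = lin_ext f x + lin_ext f y" .
  have "lin_ext f (smul c x) =
      (\<Sum>b\<in>Poly_Mapping.keys x. smul (Poly_Mapping.lookup (smul c x) b) (f b))"
    by (rule lin_ext_superset) (auto simp: in_keys_iff)
  also have "\<dots> = smul c (lin_ext f x)"
    by (simp add: lin_ext_def free_vs.scale_sum_right)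
  finally show "lin_ext f (smul c x) = smul c (lin_ext f x)" .
qed

lemma lin_ext_bas [simp]: "lin_ext f (bas b) = f b"
  by (simp add: lin_ext_def bas_def)

lemma bas_expansion: "x = (\<Sum>b\<in>Poly_Mapping.keys x. smul (Poly_Mapping.lookup x b) (bas b))"
  by (rule poly_mapping_eqI)
     (auto simp: lookup_sum bas_def lookup_single when_def in_keys_iff if_distrib cong: if_cong)

lemma lin_eq_lin_ext:
  assumes "lin f"
  shows "f = lin_ext (\<lambda>b. f (bas b))"
proof
  fix x
  interpret f: Vector_Spaces.linear smul smul f by fact
  have "f x = f (\<Sum>b\<in>Poly_Mapping.keys x. smul (Poly_Mapping.lookup x b) (bas b))"
    by (subst bas_expansion[of x]) simp
  then show "f x = lin_ext (\<lambda>b. f (bas b)) x"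
    by (simp add: f.sum f.scale lin_ext_def)
qed

lemma tens_bas [simp]: "tens (bas b) (bas c) = bas (b, c)"
  by (simp add: tens_def bas_def)

lemma tens_alt:
  fixes x :: "'b \<Rightarrow>\<^sub>0 'k::field" and y :: "'c \<Rightarrow>\<^sub>0 'k"
  shows "tens x y = (\<Sum>b\<in>Poly_Mapping.keys x. \<Sum>c\<in>Poly_Mapping.keys y.
    smul (Poly_Mapping.lookup x b * Poly_Mapping.lookup y c) (bas (b, c)))"
proof -
  have "smul k (bas p) = Poly_Mapping.single p k" for k :: 'k and p :: "'b \<times> 'c"
    by (rule poly_mapping_eqI) (simp add: bas_def lookup_single when_def)
  then show ?thesis by (simp add: tens_def)
qed

lemma lookup_tens: "Poly_Mapping.lookup (tens x y) (b, c) = Poly_Mapping.lookup x b * Poly_Mapping.lookup y c"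
proof -
  have "Poly_Mapping.lookup (tens x y) (b, c) =
    (\<Sum>b'\<in>Poly_Mapping.keys x. \<Sum>c'\<in>Poly_Mapping.keys y.
      if b' = b then (if c' = c then Poly_Mapping.lookup x b * Poly_Mapping.lookup y c else 0) else 0)"
    by (simp add: tens_def lookup_sum lookup_single when_def) (intro sum.cong refl, auto)
  also have "\<dots> = (\<Sum>b'\<in>Poly_Mapping.keys x. if b' = b then Poly_Mapping.lookup x b * Poly_Mapping.lookup y c else 0)"
    by (intro sum.cong refl) (auto simp: in_keys_iff)
  also have "\<dots> = Poly_Mapping.lookup x b * Poly_Mapping.lookup y c"
    by (auto simp: in_keys_iff)
  finally show ?thesis .
qed

lemma tens_bilinear: "lin (\<lambda>x. tens x y)" "lin (tens x)"
  by (unfold_locales; rule poly_mapping_eqI; force simp: lookup_tens lookup_add algebra_simps)+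

lemma tens_universal:
  fixes h :: "('b \<Rightarrow>\<^sub>0 'k::field) \<Rightarrow> ('c \<Rightarrow>\<^sub>0 'k) \<Rightarrow> ('d \<Rightarrow>\<^sub>0 'k)"
  assumes l: "\<And>y. lin (\<lambda>x. h x y)" and r: "\<And>x. lin (h x)"
  shows "\<exists>!f. lin f \<and> (\<forall>x y. f (tens x y) = h x y)"
proof
  let ?f = "lin_ext (\<lambda>(b, c). h (bas b) (bas c))"
  interpret f: Vector_Spaces.linear smul smul ?f by (rule lin_lin_ext)
  have "?f (tens x y) = h x y" for x y
  proof -
    interpret l: Vector_Spaces.linear smul smul "\<lambda>x. h x y" by (rule l)
    have 1: "h x y = (\<Sum>b\<in>Poly_Mapping.keys x. smul (Poly_Mapping.lookup x b) (h (bas b) y))"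
      using fun_cong[OF lin_eq_lin_ext[OF l[of y]], of x] by (simp add: lin_ext_def)
    have 2: "h z y = (\<Sum>c\<in>Poly_Mapping.keys y. smul (Poly_Mapping.lookup y c) (h z (bas c)))" for z
      using fun_cong[OF lin_eq_lin_ext[OF r[of z]], of y] by (simp add: lin_ext_def)
    have "h x y = (\<Sum>b\<in>Poly_Mapping.keys x. smul (Poly_Mapping.lookup x b)
        (\<Sum>c\<in>Poly_Mapping.keys y. smul (Poly_Mapping.lookup y c) (h (bas b) (bas c))))"
      by (subst 1, intro sum.cong refl arg_cong[where f = "smul _"] 2)
    then show ?thesis
      by (simp add: tens_alt f.sum f.scale free_vs.scale_sum_right)
  qed
  then show "lin ?f \<and> (\<forall>x y. ?f (tens x y) = h x y)" by (simp add: lin_lin_ext)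
next
  fix g assume g: "lin g \<and> (\<forall>x y. g (tens x y) = h x y)"
  then have "g (bas p) = (case p of (b, c) \<Rightarrow> h (bas b) (bas c))" for p
    by (metis (no_types, lifting) case_prod_conv surj_pair tens_bas)
  then show "g = lin_ext (\<lambda>(b, c). h (bas b) (bas c))"
    using lin_eq_lin_ext[of g] g by simp
qed


section \<open>Bialgebras, Hopf algebras, comodule-coalgebras\<close>

definition is_algebra :: "(('b \<times> 'b \<Rightarrow>\<^sub>0 'k::field) \<Rightarrow> ('b \<Rightarrow>\<^sub>0 'k)) \<Rightarrow> ('b \<Rightarrow>\<^sub>0 'k) \<Rightarrow> bool" where
  "is_algebra m u \<longleftrightarrow> lin m \<and>
     m \<circ> tmap m id = m \<circ> tmap id m \<circ> tassoc \<and>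
     (\<forall>x. m (tens u x) = x) \<and> (\<forall>x. m (tens x u) = x)"

definition is_commutative :: "(('b \<times> 'b \<Rightarrow>\<^sub>0 'k::field) \<Rightarrow> ('b \<Rightarrow>\<^sub>0 'k)) \<Rightarrow> bool" where
  "is_commutative m \<longleftrightarrow> m \<circ> tswap = m"

definition is_coalgebra :: "(('b \<Rightarrow>\<^sub>0 'k::field) \<Rightarrow> ('b \<times> 'b \<Rightarrow>\<^sub>0 'k)) \<Rightarrow> (('b \<Rightarrow>\<^sub>0 'k) \<Rightarrow> 'k) \<Rightarrow> bool" where
  "is_coalgebra D e \<longleftrightarrow> lin D \<and> lin_form e \<and>
     tassoc \<circ> tmap D id \<circ> D = tmap id D \<circ> D \<and>
     form_left e \<circ> D = id \<and> form_right e \<circ> D = id"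

definition tmult :: "(('a \<times> 'a \<Rightarrow>\<^sub>0 'k::field) \<Rightarrow> ('a \<Rightarrow>\<^sub>0 'k)) \<Rightarrow> (('b \<times> 'b \<Rightarrow>\<^sub>0 'k) \<Rightarrow> ('b \<Rightarrow>\<^sub>0 'k))
    \<Rightarrow> (('a \<times> 'b) \<times> ('a \<times> 'b) \<Rightarrow>\<^sub>0 'k) \<Rightarrow> ('a \<times> 'b \<Rightarrow>\<^sub>0 'k)" where
  "tmult m m' = tmap m m' \<circ> tswap_mid"

definition is_algebra_hom :: "(('a \<times> 'a \<Rightarrow>\<^sub>0 'k::field) \<Rightarrow> ('a \<Rightarrow>\<^sub>0 'k)) \<Rightarrow> ('a \<Rightarrow>\<^sub>0 'k)
    \<Rightarrow> (('b \<times> 'b \<Rightarrow>\<^sub>0 'k) \<Rightarrow> ('b \<Rightarrow>\<^sub>0 'k)) \<Rightarrow> ('b \<Rightarrow>\<^sub>0 'k) \<Rightarrow> (('a \<Rightarrow>\<^sub>0 'k) \<Rightarrow> ('b \<Rightarrow>\<^sub>0 'k)) \<Rightarrow> bool" where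
  "is_algebra_hom m u m' u' f \<longleftrightarrow> lin f \<and> f \<circ> m = m' \<circ> tmap f f \<and> f u = u'"

definition is_bialgebra :: "(('b \<times> 'b \<Rightarrow>\<^sub>0 'k::field) \<Rightarrow> ('b \<Rightarrow>\<^sub>0 'k)) \<Rightarrow> ('b \<Rightarrow>\<^sub>0 'k)
    \<Rightarrow> (('b \<Rightarrow>\<^sub>0 'k) \<Rightarrow> ('b \<times> 'b \<Rightarrow>\<^sub>0 'k)) \<Rightarrow> (('b \<Rightarrow>\<^sub>0 'k) \<Rightarrow> 'k) \<Rightarrow> bool" where
  "is_bialgebra m u D e \<longleftrightarrow> is_algebra m u \<and> is_coalgebra D e \<and>
     is_algebra_hom m u (tmult m m) (tens u u) D \<and>
     (\<forall>x y. e (m (tens x y)) = e x * e y) \<and> e u = 1"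

definition is_antipode :: "(('b \<times> 'b \<Rightarrow>\<^sub>0 'k::field) \<Rightarrow> ('b \<Rightarrow>\<^sub>0 'k)) \<Rightarrow> ('b \<Rightarrow>\<^sub>0 'k)
    \<Rightarrow> (('b \<Rightarrow>\<^sub>0 'k) \<Rightarrow> ('b \<times> 'b \<Rightarrow>\<^sub>0 'k)) \<Rightarrow> (('b \<Rightarrow>\<^sub>0 'k) \<Rightarrow> 'k) \<Rightarrow> (('b \<Rightarrow>\<^sub>0 'k) \<Rightarrow> ('b \<Rightarrow>\<^sub>0 'k)) \<Rightarrow> bool" where
  "is_antipode m u D e S \<longleftrightarrow> lin S \<and>
     (\<forall>x. m (tmap S id (D x)) = smul (e x) u) \<and> (\<forall>x. m (tmap id S (D x)) = smul (e x) u)"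

definition is_grading :: "(nat \<Rightarrow> ('b \<Rightarrow>\<^sub>0 'k::field) set) \<Rightarrow> bool" where
  "is_grading G \<longleftrightarrow> (\<forall>n. free_vs.subspace (G n)) \<and>
     (\<forall>x. \<exists>!c. finite {n. c n \<noteq> 0} \<and> (\<forall>n. c n \<in> G n) \<and> x = (\<Sum>n | c n \<noteq> 0. c n))"

definition tgrade :: "(nat \<Rightarrow> ('b \<Rightarrow>\<^sub>0 'k::field) set) \<Rightarrow> nat \<Rightarrow> ('b \<times> 'b \<Rightarrow>\<^sub>0 'k) set" where
  "tgrade G n = free_vs.span {tens x y | x y i j. x \<in> G i \<and> y \<in> G j \<and> i + j = n}"

text \<open>All four structure maps are homogeneous of degree 0, the field \<open>K\<close> being in degree 0.\<close>

definition is_graded_bialgebra :: "(nat \<Rightarrow> ('b \<Rightarrow>\<^sub>0 'k::field) set)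
    \<Rightarrow> (('b \<times> 'b \<Rightarrow>\<^sub>0 'k) \<Rightarrow> ('b \<Rightarrow>\<^sub>0 'k)) \<Rightarrow> ('b \<Rightarrow>\<^sub>0 'k)
    \<Rightarrow> (('b \<Rightarrow>\<^sub>0 'k) \<Rightarrow> ('b \<times> 'b \<Rightarrow>\<^sub>0 'k)) \<Rightarrow> (('b \<Rightarrow>\<^sub>0 'k) \<Rightarrow> 'k) \<Rightarrow> bool" where
  "is_graded_bialgebra G m u D e \<longleftrightarrow> is_bialgebra m u D e \<and> is_grading G \<and>
     (\<forall>i j. \<forall>x\<in>G i. \<forall>y\<in>G j. m (tens x y) \<in> G (i + j)) \<and> u \<in> G 0 \<and>
     (\<forall>n. \<forall>x\<in>G n. D x \<in> tgrade G n) \<and> (\<forall>n>0. \<forall>x\<in>G n. e x = 0)"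

definition is_graded_hopf_algebra :: "(nat \<Rightarrow> ('b \<Rightarrow>\<^sub>0 'k::field) set)
    \<Rightarrow> (('b \<times> 'b \<Rightarrow>\<^sub>0 'k) \<Rightarrow> ('b \<Rightarrow>\<^sub>0 'k)) \<Rightarrow> ('b \<Rightarrow>\<^sub>0 'k)
    \<Rightarrow> (('b \<Rightarrow>\<^sub>0 'k) \<Rightarrow> ('b \<times> 'b \<Rightarrow>\<^sub>0 'k)) \<Rightarrow> (('b \<Rightarrow>\<^sub>0 'k) \<Rightarrow> 'k) \<Rightarrow> bool" where
  "is_graded_hopf_algebra G m u D e \<longleftrightarrow> is_graded_bialgebra G m u D e \<and>
     (\<exists>S. is_antipode m u D e S \<and> (\<forall>n. S ` G n \<subseteq> G n))"

definition is_connected_grading :: "(nat \<Rightarrow> ('b \<Rightarrow>\<^sub>0 'k::field) set) \<Rightarrow> ('b \<Rightarrow>\<^sub>0 'k) \<Rightarrow> bool" where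
  "is_connected_grading G u \<longleftrightarrow> u \<noteq> 0 \<and> G 0 = free_vs.span {u}"

definition m13 :: "(('a \<times> 'a \<Rightarrow>\<^sub>0 'k::field) \<Rightarrow> ('a \<Rightarrow>\<^sub>0 'k))
    \<Rightarrow> (('a \<times> 'b) \<times> ('a \<times> 'c) \<Rightarrow>\<^sub>0 'k) \<Rightarrow> ('a \<times> 'b \<times> 'c \<Rightarrow>\<^sub>0 'k)" where
  "m13 m = lin_ext (\<lambda>((a, b), (c, d)). tens (m (tens (bas a) (bas c))) (tens (bas b) (bas d)))"

definition is_comodule :: "(('a \<Rightarrow>\<^sub>0 'k::field) \<Rightarrow> ('a \<times> 'a \<Rightarrow>\<^sub>0 'k)) \<Rightarrow> (('a \<Rightarrow>\<^sub>0 'k) \<Rightarrow> 'k)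
    \<Rightarrow> (('b \<Rightarrow>\<^sub>0 'k) \<Rightarrow> ('a \<times> 'b \<Rightarrow>\<^sub>0 'k)) \<Rightarrow> bool" where
  "is_comodule D e \<rho> \<longleftrightarrow> lin \<rho> \<and>
     tassoc \<circ> tmap D id \<circ> \<rho> = tmap id \<rho> \<circ> \<rho> \<and> form_left e \<circ> \<rho> = id"

text \<open>
  A coalgebra \<open>(C, D', e')\<close> in the category of left comodules over the bialgebra \<open>(B, m, u, D, e)\<close>:
  \<open>D'\<close> and \<open>e'\<close> are comodule morphisms, \<open>C \<otimes> C\<close> having the coaction \<open>m13 \<circ> (\<rho> \<otimes> \<rho>)\<close> and \<open>K\<close> the
  trivial one.
\<close>

definition is_comodule_coalgebra :: "(('a \<times> 'a \<Rightarrow>\<^sub>0 'k::field) \<Rightarrow> ('a \<Rightarrow>\<^sub>0 'k)) \<Rightarrow> ('a \<Rightarrow>\<^sub>0 'k)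
    \<Rightarrow> (('a \<Rightarrow>\<^sub>0 'k) \<Rightarrow> ('a \<times> 'a \<Rightarrow>\<^sub>0 'k)) \<Rightarrow> (('a \<Rightarrow>\<^sub>0 'k) \<Rightarrow> 'k)
    \<Rightarrow> (('b \<Rightarrow>\<^sub>0 'k) \<Rightarrow> ('a \<times> 'b \<Rightarrow>\<^sub>0 'k))
    \<Rightarrow> (('b \<Rightarrow>\<^sub>0 'k) \<Rightarrow> ('b \<times> 'b \<Rightarrow>\<^sub>0 'k)) \<Rightarrow> (('b \<Rightarrow>\<^sub>0 'k) \<Rightarrow> 'k) \<Rightarrow> bool" where
  "is_comodule_coalgebra m u D e \<rho> D' e' \<longleftrightarrow>
     is_bialgebra m u D e \<and> is_coalgebra D' e' \<and> is_comodule D e \<rho> \<and>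
     tmap id D' \<circ> \<rho> = m13 m \<circ> tmap \<rho> \<rho> \<circ> D' \<and>
     (\<forall>x. form_right e' (\<rho> x) = smul (e' x) u)"


section \<open>Finite topologies\<close>

definition spec_le :: "'a topology \<Rightarrow> 'a \<Rightarrow> 'a \<Rightarrow> bool" where
  "spec_le T x y \<longleftrightarrow> x \<in> topspace T \<and> y \<in> topspace T \<and> (\<forall>U. openin T U \<and> x \<in> U \<longrightarrow> y \<in> U)"

definition spec_eq :: "'a topology \<Rightarrow> 'a \<Rightarrow> 'a \<Rightarrow> bool" where
  "spec_eq T x y \<longleftrightarrow> spec_le T x y \<and> spec_le T y x"

definition final_topology :: "'a set \<Rightarrow> ('a \<Rightarrow> 'a \<Rightarrow> bool) \<Rightarrow> 'a topology" where
  "final_topology X r = topology (\<lambda>U. U \<subseteq> X \<and> (\<forall>x\<in>U. \<forall>y\<in>X. r x y \<longrightarrow> y \<in> U))"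

lemma openin_final_topology:
  "openin (final_topology X r) U \<longleftrightarrow> U \<subseteq> X \<and> (\<forall>x\<in>U. \<forall>y\<in>X. r x y \<longrightarrow> y \<in> U)"
proof -
  have "istopology (\<lambda>U. U \<subseteq> X \<and> (\<forall>x\<in>U. \<forall>y\<in>X. r x y \<longrightarrow> y \<in> U))"
    unfolding istopology_def by blast
  then show ?thesis by (simp add: final_topology_def)
qed

lemma topspace_final_topology [simp]: "topspace (final_topology X r) = X"
  unfolding topspace_def by (auto simp: openin_final_topology)

lemma spec_le_final_topology:
  assumes "\<And>x. x \<in> X \<Longrightarrow> r x x" "\<And>x y z. r x y \<Longrightarrow> r y z \<Longrightarrow> r x z"
  shows "spec_le (final_topology X r) x y \<longleftrightarrow> x \<in> X \<and> y \<in> X \<and> r x y"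
proof
  assume le: "spec_le (final_topology X r) x y"
  have "openin (final_topology X r) {z \<in> X. r x z}"
    using assms(2) by (auto simp: openin_final_topology)
  with le assms(1) show "x \<in> X \<and> y \<in> X \<and> r x y"
    by (auto simp: spec_le_def)
qed (auto simp: spec_le_def openin_final_topology)

text \<open>The quotient \<open>T / T'\<close>.\<close>

definition quot_top :: "'a topology \<Rightarrow> 'a topology \<Rightarrow> 'a topology" where
  "quot_top T T' = final_topology (topspace T) (\<lambda>x y. spec_le T x y \<or> spec_le T' y x)\<^sup>+\<^sup>+"

definition finer_top :: "'a topology \<Rightarrow> 'a topology \<Rightarrow> bool" where
  "finer_top T' T \<longleftrightarrow> topspace T' = topspace T \<and> (\<forall>U. openin T U \<longrightarrow> openin T' U)"

definition admissible_top :: "'a topology \<Rightarrow> 'a topology \<Rightarrow> bool" where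
  "admissible_top T T' \<longleftrightarrow> finer_top T' T \<and>
     (\<forall>Y. connectedin T' Y \<longrightarrow> subtopology T' Y = subtopology T Y) \<and>
     (\<forall>x y. spec_eq (quot_top T T') x y \<longleftrightarrow> spec_eq (quot_top T' T') x y)"

lemma spec_le_quot_top:
  assumes "finer_top T' T"
  shows "spec_le (quot_top T T') = (\<lambda>x y. spec_le T x y \<or> spec_le T' y x)\<^sup>+\<^sup>+"
proof -
  let ?r = "\<lambda>x y. spec_le T x y \<or> spec_le T' y x"
  have X: "x \<in> topspace T \<and> y \<in> topspace T" if "?r\<^sup>+\<^sup>+ x y" for x y
    using that assms by (induction rule: tranclp.induct) (auto simp: spec_le_def finer_top_def)
  have "spec_le (quot_top T T') x y \<longleftrightarrow> x \<in> topspace T \<and> y \<in> topspace T \<and> ?r\<^sup>+\<^sup>+ x y" for x y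
    unfolding quot_top_def
    by (rule spec_le_final_topology) (auto simp: spec_le_def intro: tranclp_trans)
  then show ?thesis using X by (intro ext) blast
qed

lemma finite_admissible_top:
  assumes "finite (topspace T)"
  shows "finite {T'. admissible_top T T'}"
proof (rule finite_imageD)
  show "inj_on (\<lambda>T'. {U. openin T' U}) {T'. admissible_top T T'}"
    by (auto simp: inj_on_def topology_eq set_eq_iff)
  show "finite ((\<lambda>T'. {U. openin T' U}) ` {T'. admissible_top T T'})"
    by (rule finite_subset[of _ "Pow (Pow (topspace T))"])
       (use assms in \<open>auto simp: admissible_top_def finer_top_def dest: openin_subset\<close>)
qed

text \<open>The product of topologies on disjoint sets.\<close>

definition prod_top :: "'a topology \<Rightarrow> 'a topology \<Rightarrow> 'a topology" where
  "prod_top T1 T2 = topology (\<lambda>U. U \<subseteq> topspace T1 \<union> topspace T2 \<and>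
     openin T1 (U \<inter> topspace T1) \<and> openin T2 (U \<inter> topspace T2))"

lemma openin_prod_top:
  "openin (prod_top T1 T2) U \<longleftrightarrow> U \<subseteq> topspace T1 \<union> topspace T2 \<and>
     openin T1 (U \<inter> topspace T1) \<and> openin T2 (U \<inter> topspace T2)"
proof -
  let ?P = "\<lambda>U. U \<subseteq> topspace T1 \<union> topspace T2 \<and>
     openin T1 (U \<inter> topspace T1) \<and> openin T2 (U \<inter> topspace T2)"
  have Int: "openin T ((A \<inter> B) \<inter> topspace T)"
    if "openin T (A \<inter> topspace T)" "openin T (B \<inter> topspace T)" for T :: "'a topology" and A B
  proof -
    have "(A \<inter> B) \<inter> topspace T = (A \<inter> topspace T) \<inter> (B \<inter> topspace T)" by blast
    then show ?thesis using openin_Int[OF that] by (simp only:)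
  qed
  have Un: "openin T (\<Union>\<K> \<inter> topspace T)"
    if "\<And>K. K \<in> \<K> \<Longrightarrow> openin T (K \<inter> topspace T)" for T :: "'a topology" and \<K>
  proof -
    have "\<Union>\<K> \<inter> topspace T = (\<Union>K\<in>\<K>. K \<inter> topspace T)" by blast
    moreover have "openin T (\<Union>K\<in>\<K>. K \<inter> topspace T)"
      by (rule openin_Union) (use that in blast)
    ultimately show ?thesis by (simp only:)
  qed
  have "istopology ?P"
    unfolding istopology_def
  proof (intro conjI allI impI)
    fix A B assume "?P A" "?P B"
    then show "A \<inter> B \<subseteq> topspace T1 \<union> topspace T2"
      "openin T1 ((A \<inter> B) \<inter> topspace T1)" "openin T2 ((A \<inter> B) \<inter> topspace T2)"
      using Int[of T1 A B] Int[of T2 A B] by blast+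
  next
    fix \<K> assume K: "\<forall>K\<in>\<K>. ?P K"
    then show "\<Union>\<K> \<subseteq> topspace T1 \<union> topspace T2" by blast
    show "openin T1 (\<Union>\<K> \<inter> topspace T1)" "openin T2 (\<Union>\<K> \<inter> topspace T2)"
      using K by (intro Un; blast)+
  qed
  then show ?thesis by (simp add: prod_top_def)
qed

definition top_degree :: "'a topology \<Rightarrow> nat" where
  "top_degree T = card (topspace T // {(x, y). spec_eq T x y}) - card (connected_components_of T)"

text \<open>The subtraction in \<open>top_degree\<close> is never truncated.\<close>

lemma card_components_le_card_classes:
  assumes "finite (topspace T)"
  shows "card (connected_components_of T) \<le> card (topspace T // {(x, y). spec_eq T x y})"
proof (rule surj_card_le)
  let ?E = "{(x, y). spec_eq T x y}"
  show "finite (topspace T // ?E)"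
    using assms by (simp add: quotient_def)
  have same: "connected_component_of_set T z = connected_component_of_set T x"
    if z: "spec_eq T x z" for x z
  proof -
    have "connectedin T {x, z}"
      using z unfolding connectedin_def connected_space_def spec_eq_def spec_le_def
      by (auto simp: openin_subtopology)
    then have "connected_component_of T x z"
      unfolding connected_component_of_def by blast
    then show ?thesis by (simp add: connected_component_of_equiv)
  qed
  let ?f = "\<lambda>C. connected_component_of_set T (SOME x. x \<in> C)"
  show "connected_components_of T \<subseteq> ?f ` (topspace T // ?E)"
  proof
    fix D assume "D \<in> connected_components_of T"
    then obtain x where x: "x \<in> topspace T" "D = connected_component_of_set T x"
      by (auto simp: connected_components_of_def)
    have "x \<in> ?E `` {x}" using x by (auto simp: spec_eq_def spec_le_def)
    then have "(SOME z. z \<in> ?E `` {x}) \<in> ?E `` {x}" by (rule someI)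
    then have "D = ?f (?E `` {x})" using same x by auto
    moreover have "?E `` {x} \<in> topspace T // ?E" using x(1) by (rule quotientI)
    ultimately show "D \<in> ?f ` (topspace T // ?E)" by blast
  qed
qed


section \<open>The space spanned by homeomorphism classes\<close>

text \<open>Every finite space is homeomorphic to one whose points are natural numbers.\<close>

quotient_type htop = "nat topology" /
  partial: "\<lambda>T U. finite (topspace T) \<and> finite (topspace U) \<and> T homeomorphic_space U"
proof (rule part_equivpI)
  show "\<exists>T :: nat topology. finite (topspace T) \<and> finite (topspace T) \<and> T homeomorphic_space T"
    by (rule exI[of _ "discrete_topology {}"]) simp
next
  show "symp (\<lambda>T U :: nat topology. finite (topspace T) \<and> finite (topspace U) \<and> T homeomorphic_space U)"
    by (rule sympI) (metis homeomorphic_space_sym)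
  show "transp (\<lambda>T U :: nat topology. finite (topspace T) \<and> finite (topspace U) \<and> T homeomorphic_space U)"
    by (rule transpI) (metis homeomorphic_space_trans)
qed

text \<open>Disjoint copies of two spaces, on even and on odd numbers.\<close>

definition even_copy :: "nat topology \<Rightarrow> nat topology" where
  "even_copy T = pullback_topology ((\<lambda>n. 2 * n) ` topspace T) (\<lambda>n. n div 2) T"

definition odd_copy :: "nat topology \<Rightarrow> nat topology" where
  "odd_copy T = pullback_topology ((\<lambda>n. 2 * n + 1) ` topspace T) (\<lambda>n. n div 2) T"

definition htop_mult :: "htop \<Rightarrow> htop \<Rightarrow> htop" where
  "htop_mult a b = abs_htop (prod_top (even_copy (rep_htop a)) (odd_copy (rep_htop b)))"

type_synonym 'k HT = "htop \<Rightarrow>\<^sub>0 'k"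
type_synonym 'k HT2 = "htop \<times> htop \<Rightarrow>\<^sub>0 'k"

definition H_mult :: "'k::field HT2 \<Rightarrow> 'k HT" where
  "H_mult = lin_ext (\<lambda>(a, b). bas (htop_mult a b))"

definition H_one :: "'k::field HT" where
  "H_one = bas (abs_htop (discrete_topology {}))"

definition H_Delta :: "'k::field HT \<Rightarrow> 'k HT2" where
  "H_Delta = lin_ext (\<lambda>c. let T = rep_htop c in
     \<Sum>Y | openin T Y. bas (abs_htop (subtopology T (topspace T - Y)), abs_htop (subtopology T Y)))"

definition H_Delta_counit :: "'k::field HT \<Rightarrow> 'k" where
  "H_Delta_counit = form_ext (\<lambda>c. if topspace (rep_htop c) = {} then 1 else 0)"

definition H_Gamma :: "'k::field HT \<Rightarrow> 'k HT2" where
  "H_Gamma = lin_ext (\<lambda>c. let T = rep_htop c in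
     \<Sum>T' | admissible_top T T'. bas (abs_htop T', abs_htop (quot_top T T')))"

definition H_Gamma_counit :: "'k::field HT \<Rightarrow> 'k" where
  "H_Gamma_counit = form_ext (\<lambda>c. let T = rep_htop c in
     if equiv (topspace T) {(x, y). spec_le T x y} then 1 else 0)"

definition H_size :: "nat \<Rightarrow> 'k::field HT set" where
  "H_size n = free_vs.span (bas ` {c. card (topspace (rep_htop c)) = n})"

definition H_degree :: "nat \<Rightarrow> 'k::field HT set" where
  "H_degree n = free_vs.span (bas ` {c. top_degree (rep_htop c) = n})"

end

theory Submission
  imports Defs
begin

text \<open>
  A finite topology is a finite quasi-order \<open>r\<close>.  An admissible \<open>T'\<close> is determined by the partition
  \<open>E\<close> of the points into its connected components: \<open>T'\<close> is \<open>r \<inter> E\<close>, the quotient \<open>T / T'\<close> is the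
  transitive closure of \<open>r \<union> E\<close>, and \<open>E\<close> is admissible iff its classes are connected for \<open>r\<close> and
  are the equivalence classes of that quotient.  Coassociativity of \<open>\<Gamma>\<close> then says that for \<open>F \<subseteq> E\<close>
  the partition \<open>E\<close> is admissible for \<open>r\<close> and \<open>F\<close> for \<open>r \<inter> E\<close> iff \<open>F\<close> is admissible for \<open>r\<close> and \<open>E\<close>
  for \<open>r / F\<close>.  For the compatibility with \<open>\<Delta>\<close>, an open set \<open>Y\<close> of the quotient is an \<open>E\<close>-saturated
  open set, and cutting \<open>E\<close> along \<open>Y\<close> matches such pairs \<open>(E, Y)\<close> with an open set \<open>Y\<close> of \<open>T\<close> and a pair
  of admissible partitions of \<open>Y\<close> and of its complement.  The antipode exists because the bialgebra
  is graded and connected.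
\<close>

section \<open>Linear maps between free vector spaces\<close>

text \<open>Two obstacles shape the proof. Nothing is known about the representative
  \<open>rep_htop\<close> of a class, and the product is built on even and odd copies. So every
  structure map is first rewritten on \<open>cls r\<close> for an arbitrary quasi-order
  \<open>r\<close> on natural numbers, with disjoint carriers in the case of products. Isomorphisms
  are taken to be permutations of all of \<open>nat\<close>: a bijection between finite sets extends
  to one, and transport along a permutation commutes with intersection, converse and transitive
  closure without any condition on carriers. Then the two sides of each identity are linear, hence
  compared on basis elements, where they are sums over index sets matched by explicit bijections.
  Only \<Delta> gets an antipode: the one-point space has degree 0 and is not the unit, so the
  grading by d is not connected and the geometric series argument does not apply to
  \<Gamma>.\<close>

lemma lin_add: "lin f \<Longrightarrow> f (x + y) = f x + f y"
  by (simp add: Vector_Spaces.linear_iff)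

lemma lin_smul: "lin f \<Longrightarrow> f (smul c x) = smul c (f x)"
  by (simp add: Vector_Spaces.linear_iff)

lemma lin_zero: "lin f \<Longrightarrow> f 0 = 0"
  using lin_smul[of f 0 0] by simp

lemma lin_sum: "lin f \<Longrightarrow> f (\<Sum>i\<in>I. g i) = (\<Sum>i\<in>I. f (g i))"
  by (induction I rule: infinite_finite_induct) (simp_all add: lin_zero lin_add)

lemma linI:
  assumes "\<And>x y. f (x + y) = f x + f y" "\<And>c x. f (smul c x) = smul c (f x)"
  shows "lin f"
  using assms by unfold_locales

lemma lin_comp: "lin f \<Longrightarrow> lin g \<Longrightarrow> lin (f \<circ> g)"
  by (rule linI) (simp_all add: lin_add lin_smul)

lemma lin_id: "lin id" "lin (\<lambda>x. x)"
  by (rule linI; simp)+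

lemma lin_diff_fun: "lin f \<Longrightarrow> lin g \<Longrightarrow> lin (\<lambda>x. f x - g x)"
  by (rule linI) (simp_all add: lin_add lin_smul free_vs.scale_right_diff_distrib)

lemma lin_eqI:
  assumes "lin f" "lin g" "\<And>b. f (bas b) = g (bas b)"
  shows "f = g"
  using lin_eq_lin_ext[OF assms(1)] lin_eq_lin_ext[OF assms(2)] assms(3) by simp

lemma lin_tmap: "lin (tmap f g)"
  unfolding tmap_def by (rule lin_lin_ext)

lemma lin_tassoc: "lin tassoc"
  unfolding tassoc_def by (rule lin_lin_ext)

lemma lin_tswap: "lin tswap"
  unfolding tswap_def by (rule lin_lin_ext)

lemma lin_tswap_mid: "lin tswap_mid"
  unfolding tswap_mid_def by (rule lin_lin_ext)

lemma lin_form_left: "lin (form_left e)"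
  unfolding form_left_def by (rule lin_lin_ext)

lemma lin_form_right: "lin (form_right e)"
  unfolding form_right_def by (rule lin_lin_ext)

lemma lin_m13: "lin (m13 m)"
  unfolding m13_def by (rule lin_lin_ext)

lemma lin_tmult: "lin (tmult m m')"
  unfolding tmult_def by (intro lin_comp lin_tmap lin_tswap_mid)

lemmas lin_intros = lin_comp lin_id lin_tmap lin_tassoc lin_tswap lin_tswap_mid lin_form_left
  lin_form_right lin_m13 lin_tmult lin_lin_ext tens_bilinear

lemma tmap_bas [simp]: "tmap f g (bas (a, b)) = tens (f (bas a)) (g (bas b))"
  by (simp add: tmap_def)

lemma tassoc_bas [simp]: "tassoc (bas ((a, b), c)) = bas (a, b, c)"
  by (simp add: tassoc_def)

lemma tswap_bas [simp]: "tswap (bas (a, b)) = bas (b, a)"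
  by (simp add: tswap_def)

lemma tswap_mid_bas [simp]: "tswap_mid (bas ((a, b), (c, d))) = bas ((a, c), (b, d))"
  by (simp add: tswap_mid_def)

lemma form_left_bas [simp]: "form_left e (bas (a, b)) = smul (e (bas a)) (bas b)"
  by (simp add: form_left_def)

lemma form_right_bas [simp]: "form_right e (bas (a, b)) = smul (e (bas b)) (bas a)"
  by (simp add: form_right_def)

lemma m13_bas [simp]: "m13 m (bas ((a, b), (c, d))) = tens (m (bas (a, c))) (bas (b, d))"
  by (simp add: m13_def)

lemma tmult_bas [simp]: "tmult m m' (bas ((a, b), (c, d))) = tens (m (bas (a, c))) (m' (bas (b, d)))"
  by (simp add: tmult_def)

text \<open>For identities in \<open>tens x y\<close> with arbitrary arguments:
  \<open>lin_eqI\<close> is applied in one slot and then in the other.\<close>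

lemma bilinear_eqI:
  assumes "\<And>y. lin (\<lambda>x. F x y)" "\<And>x. lin (F x)" "\<And>y. lin (\<lambda>x. G x y)" "\<And>x. lin (G x)"
    and "\<And>a b. F (bas a) (bas b) = G (bas a) (bas b)"
  shows "F x y = G x y"
proof -
  have "F (bas a) = G (bas a)" for a
    by (rule lin_eqI) (use assms in auto)
  then have "(\<lambda>x. F x y) = (\<lambda>x. G x y)"
    by (intro lin_eqI) (use assms in auto)
  then show ?thesis by (rule fun_cong)
qed

lemma lin_compose: "lin f \<Longrightarrow> lin g \<Longrightarrow> lin (\<lambda>x. f (g x))"
  using lin_comp[of f g] by (simp add: comp_def)

lemma tmap_tens:
  assumes "lin f" "lin g"
  shows "tmap f g (tens x y) = tens (f x) (g y)"
proof (rule bilinear_eqI[of "\<lambda>x y. tmap f g (tens x y)" "\<lambda>x y. tens (f x) (g y)"])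
  show "lin (\<lambda>x. tmap f g (tens x y))" "lin (\<lambda>y. tmap f g (tens x y))" for x y
    by (rule lin_compose[OF lin_tmap]; rule tens_bilinear)+
  show "lin (\<lambda>x. tens (f x) (g y))" for y
    by (rule lin_compose[OF tens_bilinear(1) assms(1)])
  show "lin (\<lambda>y. tens (f x) (g y))" for x
    by (rule lin_compose[OF tens_bilinear(2) assms(2)])
qed simp

lemma tens_sum_left: "tens (\<Sum>i\<in>I. f i) y = (\<Sum>i\<in>I. tens (f i) y)"
  by (rule lin_sum[OF tens_bilinear(1)])

lemma tens_sum_right: "tens x (\<Sum>i\<in>I. f i) = (\<Sum>i\<in>I. tens x (f i))"
  by (rule lin_sum[OF tens_bilinear(2)])

lemma tens_zero [simp]: "tens 0 y = 0" "tens x 0 = 0"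
  by (rule lin_zero[OF tens_bilinear(1)], rule lin_zero[OF tens_bilinear(2)])

lemma tens_smul: "tens (smul c x) y = smul c (tens x y)" "tens x (smul c y) = smul c (tens x y)"
  by (rule lin_smul[OF tens_bilinear(1)], rule lin_smul[OF tens_bilinear(2)])

lemma tens_diff: "tens (x - y) z = tens x z - tens y z" "tens x (y - z) = tens x y - tens x z"
  by (rule poly_mapping_eqI, force simp: lookup_tens lookup_minus algebra_simps)+

lemma tmult_tens:
  assumes "lin m" "lin m'"
  shows "tmult m m' (tens (tens x y) (tens z w)) = tens (m (tens x z)) (m' (tens y w))"
proof -
  have L: "lin (\<lambda>x. tmult m m' (tens (tens x y) v))" "lin (\<lambda>x. tmult m m' (tens (tens y' x) v))"
    "lin (\<lambda>x. tmult m m' (tens v (tens x y)))" "lin (\<lambda>x. tmult m m' (tens v (tens y' x)))"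
    "lin (\<lambda>x. tens (m (tens x v')) p)" "lin (\<lambda>x. tens p' (m' (tens x v'')))"
    "lin (\<lambda>x. tens (m (tens v' x)) p)" "lin (\<lambda>x. tens p' (m' (tens v'' x)))" for y y' v v' v'' p p'
    by (intro linI; simp add: lin_add[OF tens_bilinear(1)] lin_add[OF tens_bilinear(2)]
        tens_smul lin_add lin_smul assms lin_tmult)+
  have 1: "tmult m m' (tens (tens (bas a) (bas b)) (tens z w)) = tens (m (tens (bas a) z)) (m' (tens (bas b) w))"
    for a b
    by (rule bilinear_eqI[of "\<lambda>z w. tmult m m' (tens (tens (bas a) (bas b)) (tens z w))"
          "\<lambda>z w. tens (m (tens (bas a) z)) (m' (tens (bas b) w))", OF L(3) L(4) L(7) L(8)]) simp
  show ?thesis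
    by (rule bilinear_eqI[of "\<lambda>x y. tmult m m' (tens (tens x y) (tens z w))"
          "\<lambda>x y. tens (m (tens x z)) (m' (tens y w))", OF L(1) L(2) L(5) L(6) 1])
qed

lemma algebra_hom_tmap:
  assumes lins: "lin m1" "lin m2" "lin m1'" "lin m2'"
    and f: "is_algebra_hom m1 u1 m1' u1' f" and g: "is_algebra_hom m2 u2 m2' u2' g"
  shows "is_algebra_hom (tmult m1 m2) (tens u1 u2) (tmult m1' m2') (tens u1' u2') (tmap f g)"
proof -
  have fl: "lin f" and fm: "f (m1 (bas (a, b))) = m1' (tens (f (bas a)) (f (bas b)))"
    and gl: "lin g" and gm: "g (m2 (bas (c, d))) = m2' (tens (g (bas c)) (g (bas d)))" for a b c d
    using f g comp_eq_dest[of f m1 m1' "tmap f f" "bas (a, b)"]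
      comp_eq_dest[of g m2 m2' "tmap g g" "bas (c, d)"]
    by (auto simp: is_algebra_hom_def)
  have "tmap f g \<circ> tmult m1 m2 = tmult m1' m2' \<circ> tmap (tmap f g) (tmap f g)"
  proof (rule lin_eqI)
    fix p :: "('b \<times> 'c) \<times> ('b \<times> 'c)"
    obtain a b c d where p: "p = ((a, b), (c, d))" by (metis surj_pair)
    show "(tmap f g \<circ> tmult m1 m2) (bas p) = (tmult m1' m2' \<circ> tmap (tmap f g) (tmap f g)) (bas p)"
      by (simp add: p tmap_tens fl gl fm gm tmult_tens lins)
  qed (intro lin_intros)+
  then show ?thesis
    using f g by (simp add: is_algebra_hom_def lin_tmap tmap_tens)
qed

lemma algebra_hom_id:
  fixes m :: "('a \<times> 'a \<Rightarrow>\<^sub>0 'k::field) \<Rightarrow> ('a \<Rightarrow>\<^sub>0 'k)"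
  shows "is_algebra_hom m u m u id"
proof -
  have "tmap id id = (id :: ('a \<times> 'a \<Rightarrow>\<^sub>0 'k) \<Rightarrow> _)"
    by (rule lin_eqI) (auto intro: lin_tmap lin_id)
  then show ?thesis by (simp add: is_algebra_hom_def lin_id)
qed

lemma lin_form_form_ext:
  fixes f :: "'b \<Rightarrow> 'k::field"
  shows "lin_form (form_ext f)"
proof -
  \<comment> \<open>The field is viewed as the free space on the one-point basis \<open>()\<close>,
    so that linearity of \<open>lin_ext\<close> carries over to forms.\<close>
  have alt: "form_ext f x = Poly_Mapping.lookup (lin_ext (\<lambda>b. smul (f b) (bas ())) x) ()" for x
    by (simp add: form_ext_def lin_ext_def lookup_sum bas_def)
  show ?thesis
    by (rule Vector_Spaces.linear.intro)
       (unfold_locales, auto simp: alt lin_add[OF lin_lin_ext] lin_smul[OF lin_lin_ext] lookup_add algebra_simps)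
qed

lemma form_ext_bas [simp]: "form_ext f (bas b) = f b"
  by (simp add: form_ext_def bas_def)

lemma lin_form_smul:
  assumes "lin_form e"
  shows "lin (\<lambda>x. smul (e x) u)"
  using assms by (intro linI) (auto simp: Vector_Spaces.linear_iff free_vs.scale_left_distrib)

text \<open>Turns membership in a homogeneous component into a condition on the support, which is
  how both gradings are handled.\<close>

lemma span_bas: "free_vs.span (bas ` A) = {x. Poly_Mapping.keys x \<subseteq> A}" (is "?L = ?R")
proof
  show "?L \<subseteq> ?R"
  proof (rule free_vs.span_minimal)
    show "free_vs.subspace ?R"
      by (auto simp: free_vs.subspace_def in_keys_iff subset_iff lookup_add)
         (metis add_0)
  qed (auto simp: bas_def)
  show "?R \<subseteq> ?L"
  proof
    fix x :: "'a \<Rightarrow>\<^sub>0 'b" assume "x \<in> ?R"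
    then have "(\<Sum>b\<in>Poly_Mapping.keys x. smul (Poly_Mapping.lookup x b) (bas b)) \<in> ?L"
      by (intro free_vs.span_sum free_vs.span_scale free_vs.span_base) auto
    then show "x \<in> ?L" using bas_expansion[of x] by simp
  qed
qed

section \<open>Gradings given by a size function on the basis\<close>

text \<open>\<open>H_size\<close> and \<open>H_degree\<close> are both of this form, so gradings and
  the antipode can be treated for an arbitrary weight \<open>s\<close> on the basis.\<close>

definition basis_grade :: "('b \<Rightarrow> nat) \<Rightarrow> nat \<Rightarrow> ('b \<Rightarrow>\<^sub>0 'k::field) set" where
  "basis_grade s n = free_vs.span (bas ` {b. s b = n})"

lemma basis_grade_iff: "x \<in> basis_grade s n \<longleftrightarrow> (\<forall>b\<in>Poly_Mapping.keys x. s b = n)"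
  by (auto simp: basis_grade_def span_bas)

lemma bas_in_basis_grade: "s b = n \<Longrightarrow> bas b \<in> basis_grade s n"
  by (auto simp: basis_grade_def intro: free_vs.span_base)

lemma is_grading_basis_grade:
  fixes s :: "'b \<Rightarrow> nat"
  shows "is_grading (basis_grade s :: nat \<Rightarrow> ('b \<Rightarrow>\<^sub>0 'k::field) set)"
  unfolding is_grading_def
proof (intro conjI allI)
  show "free_vs.subspace (basis_grade s n :: ('b \<Rightarrow>\<^sub>0 'k) set)" for n
    by (simp add: basis_grade_def free_vs.subspace_span)
  fix x :: "'b \<Rightarrow>\<^sub>0 'k"
  let ?P = "\<lambda>c. finite {n. c n \<noteq> 0} \<and> (\<forall>n. c n \<in> basis_grade s n) \<and> x = (\<Sum>n | c n \<noteq> 0. c n)"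
  \<comment> \<open>The part of \<open>x\<close> supported on basis elements of weight
    \<open>n\<close>.\<close>
  define d where "d n = (\<Sum>b | b \<in> Poly_Mapping.keys x \<and> s b = n. smul (Poly_Mapping.lookup x b) (bas b))" for n
  have ld: "Poly_Mapping.lookup (d n) b = (if s b = n then Poly_Mapping.lookup x b else 0)" for n b
    by (auto simp: d_def lookup_sum bas_def lookup_single when_def in_keys_iff if_distrib cong: if_cong)
  have nz: "{n. d n \<noteq> 0} \<subseteq> s ` Poly_Mapping.keys x"
    by (auto simp: d_def image_iff) (metis (mono_tags, lifting) sum.neutral mem_Collect_eq)
  then have fin: "finite {n. d n \<noteq> 0}" using finite_surj[OF finite_keys] by blast
  show "\<exists>!c. ?P c"
  proof
    have "x = (\<Sum>n\<in>s ` Poly_Mapping.keys x. d n)"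
      by (rule poly_mapping_eqI) (auto simp: lookup_sum ld in_keys_iff)
    also have "\<dots> = (\<Sum>n | d n \<noteq> 0. d n)"
      by (rule sum.mono_neutral_right) (use nz in auto)
    finally show "?P d"
      using fin by (auto simp: basis_grade_iff in_keys_iff ld split: if_splits)
  next
    fix c assume c: "?P c"
    show "c = d"
    proof (intro ext poly_mapping_eqI)
      fix n b
      \<comment> \<open>Uniqueness is read off one coefficient at a time: the coefficient of
        \<open>b\<close> can only come from the component of index \<open>s b\<close>.\<close>
      have z: "Poly_Mapping.lookup (c k) b = 0" if "s b \<noteq> k" for k
        using c that by (metis basis_grade_iff in_keys_iff)
      have "Poly_Mapping.lookup x b = (\<Sum>k | c k \<noteq> 0. Poly_Mapping.lookup (c k) b)"
        using c lookup_sum[of c "{k. c k \<noteq> 0}" b] by (simp only:)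
      also have "\<dots> = (\<Sum>k | c k \<noteq> 0. if k = s b then Poly_Mapping.lookup (c (s b)) b else 0)"
      proof (rule sum.cong[OF refl])
        fix k show "Poly_Mapping.lookup (c k) b = (if k = s b then Poly_Mapping.lookup (c (s b)) b else 0)"
          by (cases "k = s b") (simp_all add: z[of k, OF not_sym])
      qed
      also have "\<dots> = Poly_Mapping.lookup (c (s b)) b"
        using c by auto
      finally show "Poly_Mapping.lookup (c n) b = Poly_Mapping.lookup (d n) b"
        using z[of n] by (auto simp: ld)
    qed
  qed
qed

lemma tgrade_basis_grade_iff:
  "x \<in> tgrade (basis_grade s) n \<longleftrightarrow> (\<forall>(a, b)\<in>Poly_Mapping.keys x. s a + s b = n)"
proof
  assume x: "x \<in> tgrade (basis_grade s) n"
  have "tgrade (basis_grade s) n \<subseteq> {x. Poly_Mapping.keys x \<subseteq> {(a, b). s a + s b = n}}"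
    unfolding tgrade_def span_bas[symmetric]
  proof (rule free_vs.span_minimal[OF _ free_vs.subspace_span], rule subsetI)
    fix z assume "z \<in> {tens x y |x y i j. x \<in> basis_grade s i \<and> y \<in> basis_grade s j \<and> i + j = n}"
    then show "z \<in> free_vs.span (bas ` {(a, b). s a + s b = n})"
      by (force simp: span_bas basis_grade_iff in_keys_iff lookup_tens)
  qed
  then show "\<forall>(a, b)\<in>Poly_Mapping.keys x. s a + s b = n" using x by auto
next
  assume x: "\<forall>(a, b)\<in>Poly_Mapping.keys x. s a + s b = n"
  have "bas (a, b) \<in> tgrade (basis_grade s) n" if "(a, b) \<in> Poly_Mapping.keys x" for a b
    unfolding tgrade_def
    by (rule free_vs.span_base, rule CollectI, rule exI[of _ "bas a"], rule exI[of _ "bas b"],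
        rule exI[of _ "s a"], rule exI[of _ "s b"]) (use x that in \<open>auto intro: bas_in_basis_grade\<close>)
  then have "(\<Sum>p\<in>Poly_Mapping.keys x. smul (Poly_Mapping.lookup x p) (bas p)) \<in> tgrade (basis_grade s) n"
    unfolding tgrade_def by (auto intro!: free_vs.span_sum free_vs.span_scale)
  then show "x \<in> tgrade (basis_grade s) n"
    using bas_expansion[of x] by simp
qed

lemma lin_maps_basis_grade:
  assumes "lin f" "free_vs.subspace W" "\<And>b. s b = n \<Longrightarrow> f (bas b) \<in> W" "x \<in> basis_grade s n"
  shows "f x \<in> W"
proof -
  have "f x = (\<Sum>b\<in>Poly_Mapping.keys x. smul (Poly_Mapping.lookup x b) (f (bas b)))"
    using lin_eq_lin_ext[OF assms(1)] by (metis lin_ext_def)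
  also have "\<dots> \<in> W"
    using assms by (auto intro!: free_vs.subspace_sum free_vs.subspace_scale simp: basis_grade_iff)
  finally show ?thesis .
qed

section \<open>The antipode of a connected graded bialgebra\<close>

lemma tmap_comp:
  assumes "lin f" "lin g" "lin f'" "lin g'"
  shows "tmap f g \<circ> tmap f' g' = tmap (f \<circ> f') (g \<circ> g')"
proof (rule lin_eqI)
  fix p show "(tmap f g \<circ> tmap f' g') (bas p) = tmap (f \<circ> f') (g \<circ> g') (bas p)"
    by (cases p) (simp add: tmap_tens assms)
qed (intro lin_intros)+

lemma tassoc_tens: "tassoc (tens (bas (a, b)) y) = tens (bas a) (tens (bas b) y)"
proof -
  have "(\<lambda>y. tassoc (tens (bas (a, b)) y)) = (\<lambda>y. tens (bas a) (tens (bas b) y))"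
    by (rule lin_eqI) (simp_all add: lin_compose lin_tassoc tens_bilinear)
  then show ?thesis by (rule fun_cong)
qed

lemma tassoc_tens_tens: "tassoc (tens (tens x y) z) = tens x (tens y z)"
  by (rule bilinear_eqI[of "\<lambda>x y. tassoc (tens (tens x y) z)" "\<lambda>x y. tens x (tens y z)"])
     (simp_all add: linI lin_add[OF tens_bilinear(1)] lin_add[OF tens_bilinear(2)]
        tens_smul lin_add lin_smul lin_tassoc tassoc_tens)

lemma tassoc_natural:
  assumes "lin f" "lin g" "lin h"
  shows "tassoc \<circ> tmap (tmap f g) h = tmap f (tmap g h) \<circ> tassoc"
proof (rule lin_eqI)
  fix p :: "('b \<times> 'd) \<times> 'f"
  obtain a b c where "p = ((a, b), c)" by (metis surj_pair)
  then show "(tassoc \<circ> tmap (tmap f g) h) (bas p) = (tmap f (tmap g h) \<circ> tassoc) (bas p)"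
    by (simp add: tmap_tens assms tassoc_tens_tens)
qed (intro lin_intros)+

text \<open>Connectedness is put on the basis: a basis element of weight 0 is the unit. This is what
  makes \<open>J\<close> below vanish in weight 0.\<close>

locale graded_connected_bialgebra =
  fixes s :: "'b \<Rightarrow> nat" and m :: "('b \<times> 'b \<Rightarrow>\<^sub>0 'k::field) \<Rightarrow> ('b \<Rightarrow>\<^sub>0 'k)" and u D e
  assumes graded: "is_graded_bialgebra (basis_grade s) m u D e"
    and connected: "s b = 0 \<Longrightarrow> bas b = u"
begin

lemma lin_m: "lin m" and lin_D: "lin D" and lin_e: "lin_form e"
  and assoc: "m \<circ> tmap m id = m \<circ> tmap id m \<circ> tassoc"
  and coassoc: "tassoc \<circ> tmap D id \<circ> D = tmap id D \<circ> D"
  and unit: "m (tens u x) = x" "m (tens x u) = x"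
  and counit: "form_left e (D x) = x" "form_right e (D x) = x"
  and e_u: "e u = 1"
  using graded
  by (auto simp: is_graded_bialgebra_def is_bialgebra_def is_algebra_def is_coalgebra_def
      dest: fun_cong[where x = x])

text \<open>The convolution product of endomorphisms, with unit \<open>conv_one\<close>; an antipode
  is a two-sided inverse of the identity for it.\<close>

definition conv :: "(('b \<Rightarrow>\<^sub>0 'k) \<Rightarrow> ('b \<Rightarrow>\<^sub>0 'k)) \<Rightarrow> (('b \<Rightarrow>\<^sub>0 'k) \<Rightarrow> ('b \<Rightarrow>\<^sub>0 'k)) \<Rightarrow> ('b \<Rightarrow>\<^sub>0 'k) \<Rightarrow> ('b \<Rightarrow>\<^sub>0 'k)"
  where "conv f g = m \<circ> tmap f g \<circ> D"

definition conv_one :: "('b \<Rightarrow>\<^sub>0 'k) \<Rightarrow> ('b \<Rightarrow>\<^sub>0 'k)" where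
  "conv_one x = smul (e x) u"

lemma lin_conv: "lin (conv f g)"
  unfolding conv_def by (intro lin_comp lin_m lin_tmap lin_D)

lemma lin_conv_one: "lin conv_one"
  unfolding conv_one_def by (rule lin_form_smul[OF lin_e])

text \<open>Associativity of \<open>m\<close> acts on the outside, coassociativity of
  \<open>D\<close> on the inside, and naturality of \<open>tassoc\<close> lets the two meet.\<close>

lemma conv_assoc:
  assumes "lin f" "lin g" "lin h"
  shows "conv (conv f g) h = conv f (conv g h)"
proof -
  have "tmap (conv f g) h = tmap m id \<circ> (tmap (tmap f g) h \<circ> tmap D id)"
    by (simp add: tmap_comp assms lin_tmap lin_D lin_id lin_m lin_comp conv_def comp_assoc)
  then have "conv (conv f g) h = (m \<circ> tmap m id) \<circ> tmap (tmap f g) h \<circ> tmap D id \<circ> D"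
    by (simp add: conv_def comp_assoc)
  also have "\<dots> = m \<circ> tmap id m \<circ> (tassoc \<circ> tmap (tmap f g) h) \<circ> tmap D id \<circ> D"
    by (simp only: assoc comp_assoc)
  also have "\<dots> = m \<circ> tmap id m \<circ> tmap f (tmap g h) \<circ> (tassoc \<circ> tmap D id \<circ> D)"
    by (simp only: tassoc_natural[OF assms] comp_assoc)
  also have "\<dots> = m \<circ> (tmap id m \<circ> (tmap f (tmap g h) \<circ> tmap id D)) \<circ> D"
    unfolding coassoc by (simp only: comp_assoc)
  also have "tmap id m \<circ> (tmap f (tmap g h) \<circ> tmap id D) = tmap f (conv g h)"
    by (simp add: tmap_comp assms lin_tmap lin_D lin_id lin_m lin_comp conv_def comp_assoc)
  finally show ?thesis unfolding conv_def[of f "conv g h"] .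
qed

lemma conv_one_left:
  assumes "lin f"
  shows "conv conv_one f = f"
proof -
  have "m \<circ> tmap conv_one f = f \<circ> form_left e"
  proof (rule lin_eqI)
    fix p show "(m \<circ> tmap conv_one f) (bas p) = (f \<circ> form_left e) (bas p)"
      by (cases p) (simp add: conv_one_def tens_smul lin_smul[OF lin_m] unit lin_smul[OF assms])
  qed (intro lin_intros lin_m assms)+
  then show ?thesis by (auto simp: conv_def fun_eq_iff counit)
qed

lemma conv_one_right:
  assumes "lin f"
  shows "conv f conv_one = f"
proof -
  have "m \<circ> tmap f conv_one = f \<circ> form_right e"
  proof (rule lin_eqI)
    fix p show "(m \<circ> tmap f conv_one) (bas p) = (f \<circ> form_right e) (bas p)"
      by (cases p) (simp add: conv_one_def tens_smul lin_smul[OF lin_m] unit lin_smul[OF assms])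
  qed (intro lin_intros lin_m assms)+
  then show ?thesis by (auto simp: conv_def fun_eq_iff counit)
qed

lemma conv_expand:
  "conv f g x = (\<Sum>p\<in>Poly_Mapping.keys (D x). smul (Poly_Mapping.lookup (D x) p)
      (m (tens (f (bas (fst p))) (g (bas (snd p))))))"
  by (simp add: conv_def tmap_def lin_ext_def lin_sum[OF lin_m] lin_smul[OF lin_m] case_prod_beta)

lemma keys_D: "(a, b) \<in> Poly_Mapping.keys (D (bas c)) \<Longrightarrow> s a + s b = s c"
proof -
  have "D (bas c) \<in> tgrade (basis_grade s) (s c)"
    using graded bas_in_basis_grade[of s c "s c"] by (auto simp: is_graded_bialgebra_def)
  then show "(a, b) \<in> Poly_Mapping.keys (D (bas c)) \<Longrightarrow> s a + s b = s c"
    by (auto simp: tgrade_basis_grade_iff)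
qed

text \<open>\<open>D\<close> preserves weight, so a convolution at \<open>bas c\<close> sees its
  arguments only on basis elements of weight at most \<open>s c\<close>. This allows an infinite
  series to be replaced by a partial sum.\<close>

lemma conv_cong:
  assumes "\<And>a b. s a + s b = s c \<Longrightarrow> tens (f (bas a)) (g (bas b)) = tens (f' (bas a)) (g' (bas b))"
  shows "conv f g (bas c) = conv f' g' (bas c)"
  unfolding conv_expand by (intro sum.cong refl) (use assms keys_D in auto)

lemma conv_zero:
  assumes "\<And>a b. s a + s b = s c \<Longrightarrow> f (bas a) = 0 \<or> g (bas b) = 0"
  shows "conv f g (bas c) = 0"
proof -
  have "conv f g (bas c) = conv (\<lambda>_. 0) (\<lambda>_. 0) (bas c)"
    by (rule conv_cong) (use assms in fastforce)
  then show ?thesis by (simp add: conv_expand lin_zero[OF lin_m])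
qed

lemma conv_diff:
  "conv (\<lambda>x. f x - f' x) g x = conv f g x - conv f' g x"
  "conv f (\<lambda>x. g x - g' x) x = conv f g x - conv f g' x"
proof -
  have "m (x - y) = m x - m y" for x y
    using lin_add[OF lin_m, of "x - y" y] by simp
  then show "conv (\<lambda>x. f x - f' x) g x = conv f g x - conv f' g x"
    "conv f (\<lambda>x. g x - g' x) x = conv f g x - conv f g' x"
    by (simp_all add: conv_expand tens_diff free_vs.scale_right_diff_distrib sum_subtractf)
qed

lemma conv_sum:
  "conv (\<lambda>x. \<Sum>i\<in>I. f i x) g x = (\<Sum>i\<in>I. conv (f i) g x)"
  "conv g (\<lambda>x. \<Sum>i\<in>I. f i x) x = (\<Sum>i\<in>I. conv g (f i) x)"
  by (simp_all add: conv_expand tens_sum_left tens_sum_right lin_sum[OF lin_m] free_vs.scale_sum_right)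
     (rule sum.swap)+

text \<open>The identity is \<open>conv_one\<close> minus \<open>J\<close>, so its convolution
  inverse is the geometric series in \<open>J\<close>. The series makes sense because
  \<open>J\<close> kills weight 0.\<close>

definition J :: "('b \<Rightarrow>\<^sub>0 'k) \<Rightarrow> ('b \<Rightarrow>\<^sub>0 'k)" where
  "J x = conv_one x - x"

definition J_pow :: "nat \<Rightarrow> ('b \<Rightarrow>\<^sub>0 'k) \<Rightarrow> ('b \<Rightarrow>\<^sub>0 'k)" where
  "J_pow k = (conv J ^^ k) conv_one"

lemma J_pow_0: "J_pow 0 = conv_one" and J_pow_Suc: "J_pow (Suc k) = conv J (J_pow k)"
  by (simp_all add: J_pow_def)

lemma lin_J: "lin J"
  unfolding J_def by (intro lin_diff_fun lin_conv_one lin_id)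

lemma lin_J_pow: "lin (J_pow k)"
  by (cases k) (simp_all add: J_pow_0 J_pow_Suc lin_conv_one lin_conv)

text \<open>Peeling a factor off on the right as well makes the series an inverse on both
  sides.\<close>

lemma J_pow_Suc': "J_pow (Suc k) = conv (J_pow k) J"
proof (induction k)
  case 0
  then show ?case by (simp add: J_pow_0 J_pow_Suc conv_one_left conv_one_right lin_J)
next
  case (Suc k)
  have "J_pow (Suc (Suc k)) = conv J (conv (J_pow k) J)"
    by (metis J_pow_Suc Suc)
  then show ?case
    by (simp add: conv_assoc[symmetric] lin_J lin_J_pow J_pow_Suc)
qed

lemma J_eq_0: "s b = 0 \<Longrightarrow> J (bas b) = 0"
  using connected[of b] e_u by (simp add: J_def conv_one_def)

text \<open>Each of the \<open>k\<close> factors \<open>J\<close> must receive weight at least 1,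
  and the total weight is \<open>s c\<close>.\<close>

lemma J_pow_eq_0: "s c < k \<Longrightarrow> J_pow k (bas c) = 0"
proof (induction k arbitrary: c)
  case (Suc k)
  show ?case
    unfolding J_pow_Suc
  proof (rule conv_zero)
    fix a b assume "s a + s b = s c"
    then show "J (bas a) = 0 \<or> J_pow k (bas b) = 0"
      using J_eq_0[of a] Suc by (cases "s a = 0") auto
  qed
qed simp

lemma conv_one_grade: "conv_one (bas c) \<in> basis_grade s (s c)"
  using graded
  by (cases "s c = 0")
     (auto simp: conv_one_def is_graded_bialgebra_def is_grading_def bas_in_basis_grade
       intro: free_vs.subspace_scale free_vs.subspace_0)

lemma J_pow_grade: "J_pow k (bas c) \<in> basis_grade s (s c)"
proof (induction k arbitrary: c)
  case (Suc k)
  have sub: "free_vs.subspace (basis_grade s n :: ('b \<Rightarrow>\<^sub>0 'k) set)" for n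
    by (simp add: basis_grade_def free_vs.subspace_span)
  have mult: "m (tens x y) \<in> basis_grade s (i + j)" if "x \<in> basis_grade s i" "y \<in> basis_grade s j" for x y i j
    using that graded by (auto simp: is_graded_bialgebra_def)
  have "J (bas c) \<in> basis_grade s (s c)" for c
    unfolding J_def by (intro free_vs.subspace_diff sub conv_one_grade bas_in_basis_grade refl)
  then have "m (tens (J (bas a)) (J_pow k (bas b))) \<in> basis_grade s (s c)" if "s a + s b = s c" for a b
    using mult Suc that by metis
  then show ?case
    unfolding J_pow_Suc conv_expand
    by (intro free_vs.subspace_sum free_vs.subspace_scale sub) (use keys_D in auto)
qed (simp add: J_pow_0 conv_one_grade)

text \<open>The geometric series of \<open>\<eta> \<circ> \<epsilon> - id\<close> for the convolution product; it is finite on each basis element.\<close>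

definition S :: "('b \<Rightarrow>\<^sub>0 'k) \<Rightarrow> ('b \<Rightarrow>\<^sub>0 'k)" where
  "S = lin_ext (\<lambda>c. \<Sum>k\<le>s c. J_pow k (bas c))"

text \<open>The cutoff may be enlarged, so one bound serves all tensor factors occurring in
  \<open>D (bas c)\<close>.\<close>

lemma S_bas: "s c \<le> n \<Longrightarrow> S (bas c) = (\<Sum>k\<le>n. J_pow k (bas c))"
  unfolding S_def lin_ext_bas
  by (rule sum.mono_neutral_left) (auto intro: J_pow_eq_0)

lemma conv_J_S:
  "conv J S (bas c) = S (bas c) - conv_one (bas c)" "conv S J (bas c) = S (bas c) - conv_one (bas c)"
proof -
  \<comment> \<open>Shifting the index costs the term of exponent \<open>s c + 1\<close>, which
    vanishes.\<close>
  have "S (bas c) + J_pow (Suc (s c)) (bas c) = conv_one (bas c) + (\<Sum>k\<le>s c. J_pow (Suc k) (bas c))"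
    using sum.atMost_Suc_shift[of "\<lambda>k. J_pow k (bas c)" "s c"] by (simp add: S_bas[of c "s c"] J_pow_0)
  then have *: "S (bas c) - conv_one (bas c) = (\<Sum>k\<le>s c. J_pow (Suc k) (bas c))"
    by (simp add: J_pow_eq_0 algebra_simps)
  have "conv J S (bas c) = conv J (\<lambda>x. \<Sum>k\<le>s c. J_pow k x) (bas c)"
    by (rule conv_cong) (simp add: S_bas[of _ "s c"])
  then show "conv J S (bas c) = S (bas c) - conv_one (bas c)"
    by (simp add: conv_sum * J_pow_Suc)
  have "conv S J (bas c) = conv (\<lambda>x. \<Sum>k\<le>s c. J_pow k x) J (bas c)"
    by (rule conv_cong) (simp add: S_bas[of _ "s c"])
  then show "conv S J (bas c) = S (bas c) - conv_one (bas c)"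
    by (simp add: conv_sum * J_pow_Suc')
qed

lemma antipode_exists:
  "\<exists>S. is_antipode m u D e S \<and> (\<forall>n. S ` basis_grade s n \<subseteq> basis_grade s n)"
proof (intro exI conjI)
  have lS: "lin S" unfolding S_def by (rule lin_lin_ext)
  \<comment> \<open>By bilinearity \<open>S\<close> convolved with the identity is \<open>S\<close>
    minus \<open>S\<close> convolved with \<open>J\<close>, and \<open>conv_J_S\<close> leaves
    \<open>conv_one\<close>; likewise on the other side.\<close>
  have id: "id = (\<lambda>x. conv_one x - J x)" by (auto simp: J_def)
  have "conv S id = conv_one"
  proof (rule lin_eqI[OF lin_conv lin_conv_one])
    show "conv S id (bas c) = conv_one (bas c)" for c
      unfolding id conv_diff conv_J_S conv_one_right[OF lS] by simp
  qed
  moreover have "conv id S = conv_one"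
  proof (rule lin_eqI[OF lin_conv lin_conv_one])
    show "conv id S (bas c) = conv_one (bas c)" for c
      unfolding id conv_diff conv_J_S conv_one_left[OF lS] by simp
  qed
  ultimately show "is_antipode m u D e S"
    using lS by (simp add: is_antipode_def conv_def fun_eq_iff conv_one_def)
  show "\<forall>n. S ` basis_grade s n \<subseteq> basis_grade s n"
  proof (intro allI image_subsetI)
    fix n and x :: "'b \<Rightarrow>\<^sub>0 'k" assume "x \<in> basis_grade s n"
    then show "S x \<in> basis_grade s n"
    proof (rule lin_maps_basis_grade[OF lS, rotated 2])
      show sub: "free_vs.subspace (basis_grade s n :: ('b \<Rightarrow>\<^sub>0 'k) set)"
        by (simp add: basis_grade_def free_vs.subspace_span)
      show "S (bas b) \<in> basis_grade s n" if "s b = n" for b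
        using that J_pow_grade[of _ b] by (simp add: S_bas[of b n] free_vs.subspace_sum[OF sub])
    qed
  qed
qed

end

section \<open>Finite quasi-orders\<close>

text \<open>The carrier is not stored: by reflexivity it is \<open>Field r\<close>, so that a finite
  topology is encoded by the relation alone.\<close>

definition qo :: "'a rel \<Rightarrow> bool" where
  "qo r \<longleftrightarrow> finite r \<and> trans r \<and> (\<forall>x\<in>Field r. (x, x) \<in> r)"

definition upset :: "'a rel \<Rightarrow> 'a set \<Rightarrow> bool" where
  "upset r Y \<longleftrightarrow> Y \<subseteq> Field r \<and> r `` Y \<subseteq> Y"

text \<open>For a quasi-order its classes are the connected components of the corresponding
  topology, see \<open>connected_components_of_top_of\<close>.\<close>

definition symcl :: "'a rel \<Rightarrow> 'a rel" where
  "symcl r = (r \<union> r\<inverse>)\<^sup>+"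

text \<open>All of \<open>E\<close> is adjoined, whereas \<open>quot_top\<close> adjoins only the
  reversed edges of \<open>T'\<close>; \<open>quo_alt\<close> shows that the results agree for
  admissible \<open>E\<close>.\<close>

definition quo :: "'a rel \<Rightarrow> 'a rel \<Rightarrow> 'a rel" where
  "quo r E = (r \<union> E)\<^sup>+"

text \<open>
  An admissible \<open>T'\<close> is determined by the partition \<open>E\<close> into its connected components: its
  quasi-order is \<open>r \<inter> E\<close> and that of \<open>T / T'\<close> is \<open>quo r E\<close>.
\<close>

definition adm :: "'a rel \<Rightarrow> 'a rel \<Rightarrow> bool" where
  "adm r E \<longleftrightarrow> E = symcl (r \<inter> E) \<and> E = quo r E \<inter> (quo r E)\<inverse>"

section \<open>Transitive closures, restriction to closed sets, and basic rules for
  \<open>symcl\<close> and \<open>quo\<close>\<close>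

lemma trancl_least: "r \<subseteq> s \<Longrightarrow> trans s \<Longrightarrow> r\<^sup>+ \<subseteq> s"
  by (metis trancl_id trancl_mono_subset)

lemma Field_trancl_eq [simp]: "Field (r\<^sup>+) = Field r"
  by (simp add: Field_def trancl_domain trancl_range)

lemma trancl_image_subset:
  assumes "R `` Y \<subseteq> Y"
  shows "R\<^sup>+ `` Y \<subseteq> Y"
proof -
  have "y \<in> Y" if "(x, y) \<in> R\<^sup>+" "x \<in> Y" for x y
    using that by induction (use assms in auto)
  then show ?thesis by blast
qed

text \<open>No path can change from \<open>A\<close> to \<open>B\<close>, since it would pass
  through a common point.\<close>

lemma trancl_Un_disjoint:
  assumes "Field A \<inter> Field B = {}"
  shows "(A \<union> B)\<^sup>+ = A\<^sup>+ \<union> B\<^sup>+"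
proof
  have d: "y \<in> Field (A\<^sup>+) \<Longrightarrow> y \<in> Field (B\<^sup>+) \<Longrightarrow> False" for y using assms by auto
  have "trans (A\<^sup>+ \<union> B\<^sup>+)"
    by (auto simp: trans_def intro: trancl_trans dest: d[OF FieldI2 FieldI1] d[OF FieldI1 FieldI2])
  then show "(A \<union> B)\<^sup>+ \<subseteq> A\<^sup>+ \<union> B\<^sup>+"
    by (intro trancl_least) auto
qed (auto intro: trancl_mono)

text \<open>A path that starts in a set closed under successors never leaves it.\<close>

lemma trancl_Restr_up:
  assumes "R `` Y \<subseteq> Y"
  shows "Restr (R\<^sup>+) Y = (Restr R Y)\<^sup>+"
proof
  have "(x, y) \<in> (Restr R Y)\<^sup>+ \<and> y \<in> Y" if "(x, y) \<in> R\<^sup>+" "x \<in> Y" for x y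
    using that
  proof (induction rule: trancl_induct)
    case (step y z)
    then have "(y, z) \<in> Restr R Y" using assms by auto
    then show ?case using step by (auto intro: trancl_into_trancl)
  qed (use assms in auto)
  then show "Restr (R\<^sup>+) Y \<subseteq> (Restr R Y)\<^sup>+" by auto
  show "(Restr R Y)\<^sup>+ \<subseteq> Restr (R\<^sup>+) Y"
    by (intro trancl_least) (auto simp: trans_def intro: trancl_trans)
qed

text \<open>Reversing all edges reduces this to \<open>trancl_Restr_up\<close>. It serves
  complements of open sets, which are closed under predecessors.\<close>

lemma trancl_Restr_down:
  assumes "R\<inverse> `` Z \<subseteq> Z"
  shows "Restr (R\<^sup>+) Z = (Restr R Z)\<^sup>+"
proof -
  have c: "(Restr S Z)\<inverse> = Restr (S\<inverse>) Z" for S by auto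
  show ?thesis
    using trancl_Restr_up[OF assms] by (metis c trancl_converse converse_converse)
qed

lemma symcl_equiv: "sym (symcl r)" "trans (symcl r)"
  unfolding symcl_def by (auto intro: sym_trancl sym_Un_converse)

lemma symcl_mono: "r \<subseteq> s \<Longrightarrow> symcl r \<subseteq> symcl s"
  unfolding symcl_def by (intro trancl_mono_subset) auto

lemma symcl_least: "r \<subseteq> E \<Longrightarrow> sym E \<Longrightarrow> trans E \<Longrightarrow> symcl r \<subseteq> E"
  unfolding symcl_def by (intro trancl_least) (auto dest: symD)

lemma subset_symcl: "r \<subseteq> symcl r"
  unfolding symcl_def by auto

lemma Field_symcl [simp]: "Field (symcl r) = Field r"
  unfolding symcl_def by simp

lemma subset_quo: "r \<subseteq> quo r E" "E \<subseteq> quo r E"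
  unfolding quo_def by auto

lemma trans_quo: "trans (quo r E)"
  unfolding quo_def by simp

lemma quo_mono: "E \<subseteq> F \<Longrightarrow> quo r E \<subseteq> quo r F"
  unfolding quo_def by (intro trancl_mono_subset) auto

text \<open>The analogue of the third isomorphism theorem: a quotient by a smaller relation is
  absorbed by a later, larger one.\<close>

lemma quo_quo:
  assumes "F \<subseteq> E"
  shows "quo (quo r F) E = quo r E"
proof
  have "quo r F \<union> E \<subseteq> quo r E" using quo_mono[OF assms] subset_quo by blast
  then show "quo (quo r F) E \<subseteq> quo r E"
    unfolding quo_def[of "quo r F"] by (intro trancl_least trans_quo)
  show "quo r E \<subseteq> quo (quo r F) E"
    unfolding quo_def by (intro trancl_mono_subset) auto
qed

lemma qoD:
  assumes "qo r"
  shows "finite r" "trans r" "x \<in> Field r \<Longrightarrow> (x, x) \<in> r" "finite (Field r)"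
  using assms by (auto simp: qo_def finite_Field)

lemma qo_Restr: "qo r \<Longrightarrow> qo (Restr r Y)"
  unfolding qo_def by (auto simp: trans_def Field_def; blast)

lemma Field_Restr_qo: "qo r \<Longrightarrow> Field (Restr r Y) = Field r \<inter> Y"
  unfolding qo_def by (auto simp: Field_def)

lemma qo_Un:
  assumes "qo r" "qo s" "Field r \<inter> Field s = {}"
  shows "qo (r \<union> s)"
proof -
  have "trans (r \<union> s)"
    using assms unfolding trans_def qo_def Field_def by blast
  then show ?thesis using assms by (auto simp: qo_def)
qed

section \<open>Admissible partitions: carriers, reflexivity, finiteness\<close>

lemma adm_equiv:
  assumes "adm r E"
  shows "sym E" "trans E"
  using assms symcl_equiv unfolding adm_def by metis+

lemma adm_D:
  assumes "adm r E"
  shows "E = symcl (r \<inter> E)" "quo r E \<inter> (quo r E)\<inverse> = E"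
  using assms unfolding adm_def by auto

lemma adm_Field:
  assumes "adm r E"
  shows "Field E \<subseteq> Field r"
proof -
  have "Field E = Field (r \<inter> E)" using adm_D(1)[OF assms] Field_symcl by metis
  then show ?thesis by (auto simp: Field_def)
qed

lemma adm_refl:
  assumes "adm r E" "qo r" "x \<in> Field r"
  shows "(x, x) \<in> E"
  using adm_D(2)[OF assms(1)] subset_quo(1)[of r E] qoD(3)[OF assms(2,3)] by blast

lemma Field_Int_adm:
  assumes "adm r E" "qo r"
  shows "Field (r \<inter> E) = Field r"
  using adm_refl[OF assms] qoD(3)[OF assms(2)] by (auto simp: Field_def) blast+

lemma qo_Int_adm:
  assumes "adm r E" "qo r"
  shows "qo (r \<inter> E)"
proof -
  have "trans (r \<inter> E)" using adm_equiv(2)[OF assms(1)] qoD(2)[OF assms(2)] by (rule trans_Int[rotated])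
  then show ?thesis
    using Field_Int_adm[OF assms] adm_refl[OF assms] assms(2) by (auto simp: qo_def)
qed

lemma Field_quo_adm:
  assumes "adm r E" "qo r"
  shows "Field (quo r E) = Field r"
  using adm_Field[OF assms(1)] by (auto simp: quo_def)

lemma qo_quo_adm:
  assumes "adm r E" "qo r"
  shows "qo (quo r E)"
proof -
  have "quo r E \<subseteq> Field r \<times> Field r"
    using Field_quo_adm[OF assms] by (auto simp: Field_def)
  then have "finite (quo r E)" using qoD(4)[OF assms(2)] finite_subset by blast
  then show ?thesis
    using Field_quo_adm[OF assms] qoD(3)[OF assms(2)] subset_quo(1)[of r E] trans_quo[of r E]
    by (auto simp: qo_def)
qed

lemma finite_adm:
  assumes "qo r"
  shows "finite {E. adm r E}"
proof (rule finite_subset)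
  show "{E. adm r E} \<subseteq> Pow (Field r \<times> Field r)"
  proof (intro subsetI PowI)
    fix E p assume "E \<in> {E. adm r E}" "p \<in> E"
    then show "p \<in> Field r \<times> Field r"
      using adm_Field[of r E] by (cases p) (auto intro: FieldI1 FieldI2)
  qed
  show "finite (Pow (Field r \<times> Field r))" using qoD(4)[OF assms] by simp
qed

lemma finite_upset: "qo r \<Longrightarrow> finite {Y. upset r Y}"
  by (rule finite_subset[of _ "Pow (Field r)"]) (auto simp: upset_def dest: qoD(4))

text \<open>Restricting to \<open>E\<close> and dividing by \<open>F\<close> commute. A path of
  \<open>r \<union> F\<close> between two points of one class of \<open>E\<close> cannot leave that
  class: from each of its points one can return to the start in \<open>quo r E\<close>, and mutual
  reachability there is \<open>E\<close>.\<close>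

lemma quo_Int:
  assumes E: "E = quo r E \<inter> (quo r E)\<inverse>" and "F \<subseteq> E"
  shows "quo (r \<inter> E) F = quo r F \<inter> E"
proof
  have "trans (quo r E \<inter> (quo r E)\<inverse>)" using trans_quo[of r E] unfolding trans_def by blast
  then have tE: "trans E" by (subst E)
  show "quo (r \<inter> E) F \<subseteq> quo r F \<inter> E"
    unfolding quo_def
    by (intro trancl_least trans_Int trans_trancl tE) (use assms(2) in auto)
  \<comment> \<open>An edge that can be travelled back in \<open>quo r E\<close> lies in
    \<open>E\<close>.\<close>
  have edge: "(x, y) \<in> (r \<inter> E \<union> F)" if "(x, y) \<in> r \<union> F" "(y, x) \<in> quo r E" for x y
  proof -
    have "(x, y) \<in> quo r E" using that assms(2) subset_quo by blast
    then show ?thesis using that E by blast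
  qed
  \<comment> \<open>The return condition passes to the last but one point, since its edge to
    \<open>z\<close> can be followed by the way back from \<open>z\<close> to \<open>x\<close>. The
    initial path closes the loop for that last edge.\<close>
  have "(x, y) \<in> (r \<inter> E \<union> F)\<^sup>+" if "(x, y) \<in> (r \<union> F)\<^sup>+" "(y, x) \<in> quo r E" for x y
    using that
  proof (induction rule: trancl_induct)
    case (base y)
    then show ?case using edge by blast
  next
    case (step y z)
    have "(y, z) \<in> quo r E" using step(2) assms(2) subset_quo by blast
    then have yx: "(y, x) \<in> quo r E" using step(4) transD[OF trans_quo] by metis
    have "(x, y) \<in> quo r E" using step(1) quo_mono[OF assms(2), of r] unfolding quo_def by blast
    then have "(z, y) \<in> quo r E" using step(4) transD[OF trans_quo] by metis
    then have "(y, z) \<in> r \<inter> E \<union> F" using edge step(2) by blast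
    then show ?case using step(3)[OF yx] by (rule trancl_into_trancl[rotated])
  qed
  then show "quo r F \<inter> E \<subseteq> quo (r \<inter> E) F"
    using equalityD1[OF E] unfolding quo_def[of r F] quo_def[of "r \<inter> E"] by blast
qed

text \<open>The combinatorial content of the coassociativity of \<open>\<Gamma>\<close>.\<close>

lemma adm_nested_subset:
  assumes "adm r E \<and> adm (r \<inter> E) F \<or> adm r F \<and> adm (quo r F) E"
  shows "F \<subseteq> E"
  using assms
proof (elim disjE conjE)
  assume a: "adm r E" "adm (r \<inter> E) F"
  have "F = symcl (r \<inter> E \<inter> F)" using a(2) by (rule adm_D)
  also have "\<dots> \<subseteq> symcl (r \<inter> E)" by (rule symcl_mono) blast
  also have "\<dots> = E" using adm_D(1)[OF a(1)] by simp
  finally show ?thesis .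
next
  assume a: "adm r F" "adm (quo r F) E"
  have "F \<subseteq> quo r F \<inter> (quo r F)\<inverse>" using adm_D(2)[OF a(1)] by simp
  also have "\<dots> \<subseteq> quo (quo r F) E \<inter> (quo (quo r F) E)\<inverse>" using subset_quo(1)[of "quo r F" E] by blast
  also have "\<dots> = E" using a(2) by (rule adm_D)
  finally show ?thesis .
qed

text \<open>Either side forces \<open>F \<subseteq> E\<close>. Then \<open>quo_Int\<close>,
  \<open>quo_quo\<close> and \<open>r \<inter> E \<inter> F = r \<inter> F\<close> translate the
  conditions into each other, except for the few inclusions checked below.\<close>

lemma adm_nested_iff: "adm r E \<and> adm (r \<inter> E) F \<longleftrightarrow> adm r F \<and> adm (quo r F) E"
proof
  assume a: "adm r E \<and> adm (r \<inter> E) F"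
  then have FE: "F \<subseteq> E" using adm_nested_subset by blast
  have q: "quo (r \<inter> E) F = quo r F \<inter> E"
    using a FE by (intro quo_Int) (auto simp: adm_def)
  have rF: "r \<inter> E \<inter> F = r \<inter> F" using FE by blast
  have symF: "F = symcl (r \<inter> F)" using a rF by (metis adm_D(1))
  \<comment> \<open>Mutual reachability modulo \<open>F\<close> implies mutual reachability modulo
    \<open>E\<close>, so cutting \<open>quo r F\<close> down to \<open>E\<close> does not change its
    classes.\<close>
  have "quo r F \<inter> (quo r F)\<inverse> \<subseteq> quo r E \<inter> (quo r E)\<inverse>" using quo_mono[OF FE, of r] by blast
  then have "quo r F \<inter> (quo r F)\<inverse> \<subseteq> E" using a adm_D(2) by blast
  moreover have "sym E" using a adm_equiv by blast
  ultimately have "quo r F \<inter> (quo r F)\<inverse> = (quo r F \<inter> E) \<inter> (quo r F \<inter> E)\<inverse>"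
    by (auto dest: symD)
  also have "\<dots> = F" using a q adm_D(2) by metis
  finally have 1: "adm r F" using symF by (simp add: adm_def)
  have "E = symcl (r \<inter> E)" using a adm_D by blast
  also have "\<dots> \<subseteq> symcl (quo r F \<inter> E)" using subset_quo(1)[of r F] by (intro symcl_mono) blast
  finally have "E \<subseteq> symcl (quo r F \<inter> E)" .
  moreover have "symcl (quo r F \<inter> E) \<subseteq> E" using a adm_equiv by (intro symcl_least) blast+
  ultimately have "adm (quo r F) E"
    using a by (simp add: adm_def quo_quo[OF FE])
  with 1 show "adm r F \<and> adm (quo r F) E" ..
next
  assume a: "adm r F \<and> adm (quo r F) E"
  then have FE: "F \<subseteq> E" using adm_nested_subset by blast
  have E2: "E = quo r E \<inter> (quo r E)\<inverse>" using a quo_quo[OF FE] by (metis adm_D(2))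
  have q: "quo (r \<inter> E) F = quo r F \<inter> E" by (rule quo_Int[OF E2 FE])
  have eq: "sym E" "trans E" using a adm_equiv by blast+
  have rF: "r \<inter> E \<inter> F = r \<inter> F" using FE by blast
  have F: "F = symcl (r \<inter> F)" using a adm_D by blast
  \<comment> \<open>\<open>F\<close> is itself generated by edges of \<open>r \<inter> E\<close>, so
    dividing \<open>r \<inter> E\<close> by \<open>F\<close> does not enlarge its connected
    components.\<close>
  have "F \<subseteq> symcl (r \<inter> E)" by (subst F) (rule symcl_mono, use FE in blast)
  then have "quo (r \<inter> E) F \<subseteq> symcl (r \<inter> E)"
    unfolding quo_def using subset_symcl[of "r \<inter> E"] symcl_equiv by (intro trancl_least) auto
  then have "symcl (quo r F \<inter> E) \<subseteq> symcl (r \<inter> E)"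
    unfolding q by (intro symcl_least symcl_equiv)
  then have "E \<subseteq> symcl (r \<inter> E)" using a adm_D(1) by blast
  moreover have "symcl (r \<inter> E) \<subseteq> E" using eq by (intro symcl_least) auto
  ultimately have 1: "adm r E" using E2 by (simp add: adm_def)
  have "F \<subseteq> quo (r \<inter> E) F \<inter> (quo (r \<inter> E) F)\<inverse>"
    using subset_quo(2)[of F "r \<inter> E"] adm_equiv(1)[of r F] a by (auto dest: symD)
  moreover have "quo (r \<inter> E) F \<inter> (quo (r \<inter> E) F)\<inverse> \<subseteq> F"
    unfolding q using a adm_D(2) by blast
  ultimately have "adm (r \<inter> E) F"
    using F rF unfolding adm_def by (metis subset_antisym)
  with 1 show "adm r E \<and> adm (r \<inter> E) F" ..
qed

text \<open>The combinatorial content of the compatibility of \<open>\<Delta>\<close> and \<open>\<Gamma>\<close>.\<close>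

lemma adm_restrict:
  assumes "qo r" "adm r E" "upset (quo r E) Y"
  defines "Z \<equiv> Field r - Y"
  shows "upset r Y" "adm (Restr r Y) (Restr E Y)" "adm (Restr r Z) (Restr E Z)"
    "E = Restr E Z \<union> Restr E Y"
    "quo (Restr r Y) (Restr E Y) = Restr (quo r E) Y"
    "quo (Restr r Z) (Restr E Z) = Restr (quo r E) Z"
proof -
  have F: "Field (r \<union> E) = Field r" using adm_Field[OF assms(2)] by auto
  have YX: "Y \<subseteq> Field r"
    using assms(3) Field_quo_adm[OF assms(2,1)] by (simp add: upset_def)
  have up: "(r \<union> E) `` Y \<subseteq> Y"
    using assms(3) subset_quo[of r E] subset_quo(2)[of E r] unfolding upset_def by blast
  then show "upset r Y" using YX by (auto simp: upset_def)
  \<comment> \<open>\<open>Y\<close> is closed under successors for \<open>r \<union> E\<close>, so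
    its complement is closed under predecessors.\<close>
  have down: "(r \<union> E)\<inverse> `` Z \<subseteq> Z"
    using up F unfolding Z_def Field_def by blast
  have Un: "Restr (r \<union> E) A = Restr r A \<union> Restr E A" for A by blast
  show qY: "quo (Restr r Y) (Restr E Y) = Restr (quo r E) Y"
    using trancl_Restr_up[OF up] by (simp add: quo_def Un)
  show qZ: "quo (Restr r Z) (Restr E Z) = Restr (quo r E) Z"
    using trancl_Restr_down[OF down] by (simp add: quo_def Un)
  have s: "sym E" using assms(2) adm_equiv by blast
  have "E \<subseteq> Field r \<times> Field r" using adm_Field[OF assms(2)] by (auto simp: Field_def)
  \<comment> \<open>\<open>E\<close> is symmetric and maps \<open>Y\<close> into itself, so no class
    meets both parts.\<close>
  then show "E = Restr E Z \<union> Restr E Y"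
    using up s unfolding Z_def sym_def by blast
  \<comment> \<open>The generators of \<open>E\<close> lie in \<open>E\<close>, so they do not cross
    the boundary of \<open>Y\<close> and closure commutes with restriction to each part.\<close>
  let ?S = "r \<inter> E \<union> (r \<inter> E)\<inverse>"
  have SE: "?S \<subseteq> E" using s by (auto dest: symD)
  have E: "E = ?S\<^sup>+" using adm_D(1)[OF assms(2)] by (simp add: symcl_def)
  have RS: "Restr ?S A = Restr r A \<inter> Restr E A \<union> (Restr r A \<inter> Restr E A)\<inverse>" for A by blast
  have "?S `` Y \<subseteq> Y" using up SE by blast
  then have "Restr (?S\<^sup>+) Y = (Restr ?S Y)\<^sup>+" by (rule trancl_Restr_up)
  then have EY: "Restr E Y = symcl (Restr r Y \<inter> Restr E Y)"
    unfolding symcl_def RS using E by simp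
  have "?S\<inverse> `` Z \<subseteq> Z" using down SE by blast
  then have "Restr (?S\<^sup>+) Z = (Restr ?S Z)\<^sup>+" by (rule trancl_Restr_down)
  then have EZ: "Restr E Z = symcl (Restr r Z \<inter> Restr E Z)"
    unfolding symcl_def RS using E by simp
  have "Restr E A = Restr (quo r E) A \<inter> (Restr (quo r E) A)\<inverse>" for A
    using adm_D(2)[OF assms(2)] by blast
  then show "adm (Restr r Y) (Restr E Y)" "adm (Restr r Z) (Restr E Z)"
    unfolding adm_def qY qZ using EY EZ by auto
qed

text \<open>The inverse of the cutting in \<open>adm_restrict\<close>. The two partitions can be
  chosen independently: edges of \<open>r\<close> between the parts all lead into \<open>Y\<close>
  and lie outside \<open>E1 \<union> E2\<close>, so they neither join components of
  \<open>r \<inter> (E1 \<union> E2)\<close> nor create cycles in the quotient.\<close>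

lemma adm_glue:
  assumes "qo r" "upset r Y" "adm (Restr r (Field r - Y)) E1" "adm (Restr r Y) E2"
  shows "adm r (E1 \<union> E2)" "upset (quo r (E1 \<union> E2)) Y"
    "Restr (E1 \<union> E2) (Field r - Y) = E1" "Restr (E1 \<union> E2) Y = E2"
proof -
  let ?Z = "Field r - Y" and ?E = "E1 \<union> E2"
  have F1: "Field E1 \<subseteq> ?Z" and F2: "Field E2 \<subseteq> Y"
    using adm_Field[OF assms(3)] adm_Field[OF assms(4)] unfolding Field_Restr_qo[OF assms(1)] by auto
  then have s1: "E1 \<subseteq> ?Z \<times> ?Z" and s2: "E2 \<subseteq> Y \<times> Y" by (auto simp: Field_def)
  show R1: "Restr ?E ?Z = E1" and R2: "Restr ?E Y = E2" using s1 s2 by auto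
  have YX: "Y \<subseteq> Field r" using assms(2) by (simp add: upset_def)
  have F: "Field (r \<union> ?E) = Field r" using F1 F2 YX by auto
  have up: "(r \<union> ?E) `` Y \<subseteq> Y" using assms(2) s1 s2 by (auto simp: upset_def)
  have down: "(r \<union> ?E)\<inverse> `` ?Z \<subseteq> ?Z"
  proof
    fix y assume "y \<in> (r \<union> ?E)\<inverse> `` ?Z"
    then obtain x where x: "(y, x) \<in> r \<union> ?E" "x \<in> ?Z" by blast
    then have "y \<in> Field r" using F FieldI1[of y x "r \<union> ?E"] by simp
    moreover have "y \<notin> Y" using up x by blast
    ultimately show "y \<in> ?Z" by blast
  qed
  have Un: "Restr (r \<union> ?E) A = Restr r A \<union> Restr ?E A" for A by blast
  have qY: "quo (Restr r Y) E2 = Restr (quo r ?E) Y"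
    using trancl_Restr_up[OF up] unfolding quo_def Un R2 by (rule sym)
  have qZ: "quo (Restr r ?Z) E1 = Restr (quo r ?E) ?Z"
    using trancl_Restr_down[OF down] unfolding quo_def Un R1 by (rule sym)
  have upq: "quo r ?E `` Y \<subseteq> Y" unfolding quo_def using up by (rule trancl_image_subset)
  have Fq: "Field (quo r ?E) = Field r" unfolding quo_def using F by simp
  show "upset (quo r ?E) Y" using upq Fq YX by (simp add: upset_def)
  \<comment> \<open>A pair related in both directions lies within one part, because \<open>Y\<close>
    is closed under the quotient relation.\<close>
  have "quo r ?E \<inter> (quo r ?E)\<inverse> =
      (Restr (quo r ?E) ?Z \<inter> (Restr (quo r ?E) ?Z)\<inverse>) \<union> (Restr (quo r ?E) Y \<inter> (Restr (quo r ?E) Y)\<inverse>)"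
    using upq Fq unfolding Field_def by blast
  then have sq: "quo r ?E \<inter> (quo r ?E)\<inverse> = ?E"
    unfolding qY[symmetric] qZ[symmetric] adm_D(2)[OF assms(3)] adm_D(2)[OF assms(4)] .
  have rE: "r \<inter> ?E = (Restr r ?Z \<inter> E1) \<union> (Restr r Y \<inter> E2)" using s1 s2 by blast
  have "symcl (r \<inter> ?E) = ((Restr r ?Z \<inter> E1) \<union> (Restr r ?Z \<inter> E1)\<inverse> \<union>
      ((Restr r Y \<inter> E2) \<union> (Restr r Y \<inter> E2)\<inverse>))\<^sup>+"
    unfolding symcl_def rE converse_Un by (simp only: Un_ac)
  also have "\<dots> = symcl (Restr r ?Z \<inter> E1) \<union> symcl (Restr r Y \<inter> E2)"
    unfolding symcl_def by (rule trancl_Un_disjoint) (auto simp: Field_def)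
  also have "\<dots> = ?E"
    using adm_D(1)[OF assms(3)] adm_D(1)[OF assms(4)] by simp
  finally show "adm r ?E" using sq by (simp add: adm_def)
qed

text \<open>The classes of \<open>E\<close> are connected, so none meets both parts of a disjoint
  union. Hence the product is a case of \<open>adm_restrict\<close> and \<open>adm_glue\<close>, cut
  along \<open>Field s\<close>.\<close>

lemma adm_disjoint_upset:
  assumes "qo r" "qo s" "Field r \<inter> Field s = {}" "adm (r \<union> s) E"
  shows "upset (quo (r \<union> s) E) (Field s)"
proof -
  have "(r \<union> s \<union> (r \<union> s)\<inverse>) `` Field s \<subseteq> Field s"
    using assms(3) unfolding Field_def by blast
  then have "symcl (r \<union> s) `` Field s \<subseteq> Field s"
    unfolding symcl_def by (rule trancl_image_subset)
  moreover have "E \<subseteq> symcl (r \<union> s)"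
    using adm_D(1)[OF assms(4)] symcl_mono[of "(r \<union> s) \<inter> E" "r \<union> s"] by blast
  ultimately have "(r \<union> s \<union> E) `` Field s \<subseteq> Field s" using subset_symcl[of "r \<union> s"] by blast
  then have "quo (r \<union> s) E `` Field s \<subseteq> Field s"
    unfolding quo_def by (rule trancl_image_subset)
  then show ?thesis
    using Field_quo_adm[OF assms(4) qo_Un[OF assms(1-3)]] by (simp add: upset_def)
qed

lemma quo_Un_disjoint:
  assumes "Field r \<inter> Field s = {}" "Field E1 \<subseteq> Field r" "Field E2 \<subseteq> Field s"
  shows "quo (r \<union> s) (E1 \<union> E2) = quo r E1 \<union> quo s E2"
proof -
  have "(r \<union> s) \<union> (E1 \<union> E2) = (r \<union> E1) \<union> (s \<union> E2)" by blast
  moreover have "Field (r \<union> E1) \<inter> Field (s \<union> E2) = {}" using assms by auto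
  ultimately show ?thesis by (simp add: quo_def trancl_Un_disjoint)
qed

subsection \<open>Isomorphisms of quasi-orders\<close>

definition rmap :: "('a \<Rightarrow> 'b) \<Rightarrow> 'a rel \<Rightarrow> 'b rel" where
  "rmap f r = map_prod f f ` r"

lemma Field_rmap [simp]: "Field (rmap f r) = f ` Field r"
  by (force simp: rmap_def Field_def)

lemma rmap_cong: "(\<And>x. x \<in> Field r \<Longrightarrow> f x = g x) \<Longrightarrow> rmap f r = rmap g r"
  unfolding rmap_def by (rule image_cong) (auto simp: FieldI1 FieldI2)

lemma rmap_Un: "rmap f (r \<union> s) = rmap f r \<union> rmap f s"
  by (auto simp: rmap_def)

lemma rmap_converse: "rmap f (r\<inverse>) = (rmap f r)\<inverse>"
  by (force simp: rmap_def)

lemma rmap_Int: "inj f \<Longrightarrow> rmap f (r \<inter> s) = rmap f r \<inter> rmap f s"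
  unfolding rmap_def by (rule image_Int) (simp add: prod.inj_map)

lemma rmap_Restr: "inj f \<Longrightarrow> rmap f (Restr r Y) = Restr (rmap f r) (f ` Y)"
  unfolding rmap_def by (auto simp: inj_eq)

lemma rmap_rmap: "rmap f (rmap g r) = rmap (f \<circ> g) r"
  by (force simp: rmap_def)

lemma rmap_id [simp]: "rmap id r = r"
  by (force simp: rmap_def)

lemma rmap_inv:
  assumes "bij f"
  shows "rmap (inv f) (rmap f r) = r" "rmap f (rmap (inv f) s) = s"
  using assms by (simp_all add: rmap_rmap bij_is_inj surj_iff[THEN iffD1] bij_is_surj)

lemma rmap_eq_iff: "bij f \<Longrightarrow> rmap f r = rmap f s \<longleftrightarrow> r = s"
  using rmap_inv(1) by metis

lemma rmap_mono: "r \<subseteq> s \<Longrightarrow> rmap f r \<subseteq> rmap f s"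
  unfolding rmap_def by (rule image_mono)

lemma rmap_trancl:
  assumes "bij f"
  shows "rmap f (r\<^sup>+) = (rmap f r)\<^sup>+"
proof -
  \<comment> \<open>Paths go to paths under any map; the reverse inclusion comes from applying this
    to \<open>inv f\<close>.\<close>
  have *: "rmap g (s\<^sup>+) \<subseteq> (rmap g s)\<^sup>+" for g :: "'c \<Rightarrow> 'd" and s
  proof -
    have "(g x, g y) \<in> (rmap g s)\<^sup>+" if "(x, y) \<in> s\<^sup>+" for x y
      using that
    proof induction
      case (base y)
      then show ?case by (auto simp: rmap_def)
    next
      case (step y z)
      then have "(g y, g z) \<in> rmap g s" by (auto simp: rmap_def)
      with step(3) show ?case by (rule trancl_into_trancl)
    qed
    then show ?thesis by (auto simp: rmap_def)
  qed
  have "rmap f (rmap (inv f) ((rmap f r)\<^sup>+)) \<subseteq> rmap f ((rmap (inv f) (rmap f r))\<^sup>+)"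
    by (intro rmap_mono *)
  then show ?thesis using *[of f r] by (simp add: rmap_inv[OF assms])
qed

lemma rmap_symcl: "bij f \<Longrightarrow> rmap f (symcl r) = symcl (rmap f r)"
  by (simp add: symcl_def rmap_trancl rmap_Un rmap_converse)

lemma rmap_quo: "bij f \<Longrightarrow> rmap f (quo r E) = quo (rmap f r) (rmap f E)"
  by (simp add: quo_def rmap_trancl rmap_Un)

lemma adm_rmap:
  assumes "bij f"
  shows "adm (rmap f r) (rmap f E) \<longleftrightarrow> adm r E"
  unfolding adm_def rmap_Int[OF bij_is_inj[OF assms], symmetric] rmap_symcl[OF assms, symmetric]
    rmap_quo[OF assms, symmetric] rmap_converse[symmetric] rmap_eq_iff[OF assms] ..

lemma bij_betw_adm_rmap:
  assumes "bij f"
  shows "bij_betw (rmap f) {E. adm r E} {E. adm (rmap f r) E}"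
proof (rule bij_betw_byWitness[where f' = "rmap (inv f)"])
  show "rmap (inv f) ` {E. adm (rmap f r) E} \<subseteq> {E. adm r E}"
  proof clarify
    fix E assume "adm (rmap f r) E"
    then have "adm (rmap f r) (rmap f (rmap (inv f) E))" by (simp only: rmap_inv[OF assms])
    then show "adm r (rmap (inv f) E)" by (simp only: adm_rmap[OF assms])
  qed
qed (auto simp: rmap_inv[OF assms] adm_rmap[OF assms])

lemma upset_rmap:
  assumes "bij f"
  shows "upset (rmap f r) (f ` Y) \<longleftrightarrow> upset r Y"
proof -
  have "rmap f r `` (f ` Y) = f ` (r `` Y)"
    using bij_is_inj[OF assms] by (auto simp: rmap_def inj_eq) (force simp: Image_iff)+
  then show ?thesis
    by (simp add: upset_def inj_image_subset_iff[OF bij_is_inj[OF assms]])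
qed

lemma bij_betw_upset_rmap:
  assumes "bij f"
  shows "bij_betw ((`) f) {Y. upset r Y} {Y. upset (rmap f r) Y}"
proof (rule bij_betw_byWitness[where f' = "(`) (inv f)"])
  have "f ` inv f ` Y = Y" for Y using assms by (simp add: bij_is_surj image_f_inv_f)
  then show "\<forall>Y\<in>{Y. upset (rmap f r) Y}. f ` inv f ` Y = Y" "(`) (inv f) ` {Y. upset (rmap f r) Y} \<subseteq> {Y. upset r Y}"
    using upset_rmap[OF assms, of r "inv f ` _"] by auto
qed (use assms upset_rmap[OF assms] in \<open>auto simp: bij_is_inj image_inv_f_f\<close>)

lemma qo_rmap:
  assumes "inj_on f (Field r)" "qo r"
  shows "qo (rmap f r)"
proof -
  have "trans (rmap f r)"
  proof (rule transI)
    fix x y z assume "(x, y) \<in> rmap f r" "(y, z) \<in> rmap f r"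
    then obtain a b b' c where *: "(a, b) \<in> r" "(b', c) \<in> r" "x = f a" "y = f b" "y = f b'" "z = f c"
      by (auto simp: rmap_def)
    then have "b = b'" using assms(1) by (auto simp: inj_on_def FieldI1 FieldI2)
    then have "(a, c) \<in> r" using * qoD(2)[OF assms(2)] by (blast dest: transD)
    then show "(x, z) \<in> rmap f r" using * by (auto simp: rmap_def)
  qed
  then show ?thesis
    using assms(2) unfolding qo_def by (auto simp: rmap_def Field_rmap[unfolded rmap_def])
qed

text \<open>The complements of \<open>X\<close> and of its image are infinite sets of natural
  numbers, so they can be enumerated and matched. Isomorphisms of finite quasi-orders may thus be
  taken to be permutations of \<open>nat\<close>.\<close>

lemma extend_to_bij:
  fixes f :: "nat \<Rightarrow> nat"
  assumes "finite X" "inj_on f X"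
  obtains g where "bij g" "\<And>x. x \<in> X \<Longrightarrow> g x = f x"
proof -
  have "infinite (- X)" "infinite (- f ` X)"
    using assms by (simp_all add: Compl_eq_Diff_UNIV)
  then have "bij_betw (enumerate (- X)) UNIV (- X)" "bij_betw (enumerate (- f ` X)) UNIV (- f ` X)"
    by (auto intro: bij_enumerate)
  then obtain h where h: "bij_betw h (- X) (- f ` X)"
    by (meson bij_betw_inv bij_betw_trans)
  let ?g = "\<lambda>x. if x \<in> X then f x else h x"
  have "bij_betw ?g X (f ` X)" "bij_betw ?g (- X) (- f ` X)"
    using assms(2) h by (auto simp: bij_betw_def inj_on_def)
  then have "bij_betw ?g (X \<union> - X) (f ` X \<union> - f ` X)"
    by (rule bij_betw_combine) auto
  then have "bij ?g" by simp
  then show ?thesis using that[of ?g] by simp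
qed

section \<open>Finite topologies as quasi-orders\<close>

definition rel_of :: "'a topology \<Rightarrow> 'a rel" where
  "rel_of T = {(x, y). spec_le T x y}"

definition top_of :: "'a rel \<Rightarrow> 'a topology" where
  "top_of r = final_topology (Field r) (\<lambda>x y. (x, y) \<in> r)"

lemma rel_of_iff: "(x, y) \<in> rel_of T \<longleftrightarrow> spec_le T x y"
  by (simp add: rel_of_def)

lemma Field_rel_of [simp]: "Field (rel_of T) = topspace T"
  by (auto simp: Field_def rel_of_def spec_le_def)

lemma topspace_top_of [simp]: "topspace (top_of r) = Field r"
  by (simp add: top_of_def)

lemma openin_top_of: "openin (top_of r) U \<longleftrightarrow> upset r U"
  by (auto simp: top_of_def openin_final_topology upset_def FieldI2)

lemma qo_rel_of:
  assumes "finite (topspace T)"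
  shows "qo (rel_of T)"
  unfolding qo_def
proof (intro conjI)
  have "rel_of T \<subseteq> topspace T \<times> topspace T" by (auto simp: rel_of_def spec_le_def)
  then show "finite (rel_of T)" using assms finite_subset by blast
qed (auto simp: rel_of_iff spec_le_def trans_def)

lemma rel_of_top_of:
  assumes "qo r"
  shows "rel_of (top_of r) = r"
proof -
  have "spec_le (top_of r) x y \<longleftrightarrow> x \<in> Field r \<and> y \<in> Field r \<and> (x, y) \<in> r" for x y
    unfolding top_of_def
    by (rule spec_le_final_topology) (use assms in \<open>auto simp: qo_def dest: transD\<close>)
  then show ?thesis by (auto simp: rel_of_def FieldI1 FieldI2)
qed

text \<open>Finiteness enters through minimal neighbourhoods: the intersection of all open sets
  containing \<open>x\<close> is open and consists of the points above \<open>x\<close>.\<close>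

lemma openin_iff_upset:
  assumes "finite (topspace T)"
  shows "openin T U \<longleftrightarrow> upset (rel_of T) U"
proof
  assume "openin T U"
  then show "upset (rel_of T) U"
    by (auto simp: upset_def rel_of_iff spec_le_def dest: openin_subset)
next
  assume U: "upset (rel_of T) U"
  have "\<exists>V. openin T V \<and> x \<in> V \<and> V \<subseteq> U" if x: "x \<in> U" for x
  proof (intro exI conjI)
    let ?F = "{V. openin T V \<and> x \<in> V}"
    have xX: "x \<in> topspace T" using U x by (auto simp: upset_def)
    have "finite ?F"
      by (rule finite_subset[of _ "Pow (topspace T)"]) (use assms in \<open>auto dest: openin_subset\<close>)
    moreover have "?F \<noteq> {}" using xX by (auto intro: openin_topspace)
    ultimately show "openin T (\<Inter>?F)" by (intro openin_Inter) auto
    show "x \<in> \<Inter>?F" by blast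
    show "\<Inter>?F \<subseteq> U"
    proof
      fix y assume y: "y \<in> \<Inter>?F"
      then have "y \<in> topspace T" using xX openin_topspace by blast
      then have "(x, y) \<in> rel_of T" using y xX by (auto simp: rel_of_def spec_le_def)
      then show "y \<in> U" using U x by (auto simp: upset_def)
    qed
  qed
  then show "openin T U" by (subst openin_subopen) blast
qed

lemma top_of_rel_of:
  assumes "finite (topspace T)"
  shows "top_of (rel_of T) = T"
  by (simp add: topology_eq openin_top_of openin_iff_upset[OF assms])

lemma rel_of_subtopology: "rel_of (subtopology T Y) = Restr (rel_of T) Y"
proof -
  have "spec_le (subtopology T Y) x y \<longleftrightarrow> spec_le T x y \<and> x \<in> Y \<and> y \<in> Y" for x y
    by (auto simp: spec_le_def openin_subtopology)
  then show ?thesis by (auto simp: rel_of_def)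
qed

lemma subtopology_top_of:
  assumes "qo r"
  shows "subtopology (top_of r) Y = top_of (Restr r Y)"
proof -
  have "finite (topspace (top_of r))" using qoD(4)[OF assms] by simp
  then show ?thesis
    using top_of_rel_of[of "subtopology (top_of r) Y"] rel_of_subtopology[of "top_of r" Y]
    by (simp add: rel_of_top_of[OF assms] topspace_subtopology)
qed

lemma rel_of_prod_top:
  assumes "topspace T \<inter> topspace U = {}"
  shows "rel_of (prod_top T U) = rel_of T \<union> rel_of U"
proof -
  have ts: "topspace (prod_top T U) = topspace T \<union> topspace U"
    unfolding topspace_def[of "prod_top T U"] openin_prod_top
  proof
    have "openin T ((topspace T \<union> topspace U) \<inter> topspace T)" "openin U ((topspace T \<union> topspace U) \<inter> topspace U)"
      by (simp_all add: Int_absorb1)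
    then show "topspace T \<union> topspace U \<subseteq> \<Union> {Ua. Ua \<subseteq> topspace T \<union> topspace U \<and>
        openin T (Ua \<inter> topspace T) \<and> openin U (Ua \<inter> topspace U)}" by blast
  qed blast
  \<comment> \<open>Each factor, and every open set of it, is open in the product; this rules out
    relations between points of different factors.\<close>
  have oT: "openin (prod_top T U) V" if "openin T V" for V
    using that openin_subset[OF that] assms unfolding openin_prod_top
    by (metis Int_absorb2 disjoint_iff inf.absorb1 inf_commute openin_empty subset_iff sup.coboundedI1 Int_emptyI)
  have oU: "openin (prod_top T U) V" if "openin U V" for V
    using that openin_subset[OF that] assms unfolding openin_prod_top
    by (metis Int_absorb2 disjoint_iff inf.absorb1 inf_commute openin_empty subset_iff sup.coboundedI2 Int_emptyI)
  have "spec_le (prod_top T U) x y \<longleftrightarrow> spec_le T x y \<or> spec_le U x y" for x y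
  proof
    assume a: "spec_le (prod_top T U) x y"
    then consider "x \<in> topspace T" | "x \<in> topspace U" by (auto simp: spec_le_def ts)
    then show "spec_le T x y \<or> spec_le U x y"
    proof cases
      case 1
      have "y \<in> topspace T" using a oT[OF openin_topspace] 1 by (auto simp: spec_le_def)
      then show ?thesis using a oT 1 by (auto simp: spec_le_def)
    next
      case 2
      have "y \<in> topspace U" using a oU[OF openin_topspace] 2 by (auto simp: spec_le_def)
      then show ?thesis using a oU 2 by (auto simp: spec_le_def)
    qed
  qed (auto simp: spec_le_def ts openin_prod_top)
  then show ?thesis by (auto simp: rel_of_def)
qed

section \<open>Quotients, connected components and admissible topologies in terms of
  relations\<close>

lemma finer_top_iff:
  assumes "finite (topspace T)" "topspace T' = topspace T"
  shows "finer_top T' T \<longleftrightarrow> rel_of T' \<subseteq> rel_of T"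
proof
  show "finer_top T' T \<Longrightarrow> rel_of T' \<subseteq> rel_of T"
    by (auto simp: finer_top_def rel_of_def spec_le_def)
  assume "rel_of T' \<subseteq> rel_of T"
  then have "upset (rel_of T) U \<Longrightarrow> upset (rel_of T') U" for U
    using assms(2) unfolding upset_def Field_rel_of by blast
  then show "finer_top T' T"
    using assms by (simp add: finer_top_def openin_iff_upset)
qed

lemma rel_of_quot_top:
  assumes "finer_top T' T"
  shows "rel_of (quot_top T T') = (rel_of T \<union> (rel_of T')\<inverse>)\<^sup>+"
proof -
  have "rel_of T \<union> (rel_of T')\<inverse> = {(x, y). spec_le T x y \<or> spec_le T' y x}"
    by (auto simp: rel_of_def)
  then show ?thesis
    by (simp add: rel_of_def spec_le_quot_top[OF assms] trancl_def)
qed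

text \<open>A class of \<open>symcl r\<close> and its complement are both open, so a connected set
  cannot meet both.\<close>

lemma connectedin_imp_symcl:
  assumes "qo r" "connectedin (top_of r) Y" "x \<in> Y" "y \<in> Y"
  shows "(x, y) \<in> symcl r"
proof (rule ccontr)
  assume n: "(x, y) \<notin> symcl r"
  let ?C = "symcl r `` {x}"
  have YX: "Y \<subseteq> Field r" using assms(2) connectedin_subset_topspace by fastforce
  have rs: "r \<subseteq> symcl r" by (rule subset_symcl)
  have "upset r ?C"
    using symcl_equiv(2)[of r] rs Field_symcl[of r] unfolding upset_def trans_def Field_def by blast
  moreover have "upset r (Field r - ?C)"
    using symcl_equiv[of r] rs unfolding upset_def trans_def sym_def Field_def by blast
  moreover have "x \<in> ?C" using rs qoD(3)[OF assms(1)] YX assms(3) by blast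
  moreover have "y \<in> Field r - ?C" using n YX assms(4) by blast
  ultimately show False
    using assms(2-4) YX unfolding connectedin openin_top_of by blast
qed

text \<open>Walk along a zigzag from \<open>x\<close>, with the class covered by two open sets that
  are disjoint on it. A forward edge stays in \<open>A\<close> because \<open>A\<close> is open; a
  backward edge cannot come from \<open>B\<close>, because \<open>B\<close> is open too. So the
  class lies on one side.\<close>

lemma connectedin_symcl_class:
  assumes "qo r" "x \<in> Field r"
  shows "connectedin (top_of r) (symcl r `` {x})"
proof -
  let ?C = "symcl r `` {x}"
  have xC: "x \<in> ?C" using qoD(3)[OF assms] subset_symcl by blast
  have "?C \<subseteq> A" if up: "upset r A" "upset r B" and C: "?C \<subseteq> A \<union> B" "A \<inter> B \<inter> ?C = {}" and x: "x \<in> A"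
    for A B
  proof
    fix y assume "y \<in> ?C"
    then have "(x, y) \<in> (r \<union> r\<inverse>)\<^sup>+" by (simp add: symcl_def)
    then have "y \<in> A \<and> (x, y) \<in> symcl r"
    proof (induction rule: trancl_induct)
      case (base y)
      then have xy: "(x, y) \<in> symcl r" by (auto simp: symcl_def)
      from base have "(x, y) \<in> r \<or> (y, x) \<in> r" by simp
      then have "y \<in> A" using up C x xy xC unfolding upset_def by blast
      with xy show ?case by simp
    next
      case (step y z)
      then have xz: "(x, z) \<in> symcl r" by (auto simp: symcl_def intro: trancl_into_trancl)
      from step have "(y, z) \<in> r \<or> (z, y) \<in> r" by simp
      then have "z \<in> A" using up C xz step(3) unfolding upset_def by blast
      with xz show ?case by simp
    qed
    then show "y \<in> A" by simp
  qed
  note * = this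
  have "?C \<subseteq> Field r" using Field_symcl[of r] unfolding Field_def by blast
  moreover have False if "upset r A" "upset r B" "?C \<subseteq> A \<union> B" "A \<inter> B \<inter> ?C = {}" "A \<inter> ?C \<noteq> {}" "B \<inter> ?C \<noteq> {}" for A B
  proof -
    from xC that(3) have "x \<in> A \<or> x \<in> B" by blast
    then show False
    proof
      assume "x \<in> A"
      then have "?C \<subseteq> A" using *[of A B] that by blast
      then show False using that by blast
    next
      assume "x \<in> B"
      moreover have "?C \<subseteq> B \<union> A" "B \<inter> A \<inter> ?C = {}" using that by blast+
      ultimately have "?C \<subseteq> B" using *[of B A] that by blast
      then show False using that by blast
    qed
  qed
  ultimately show ?thesis
    unfolding connectedin openin_top_of topspace_top_of by blast
qed

lemma connected_components_of_top_of:
  assumes "qo r"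
  shows "connected_components_of (top_of r) = Field r // symcl r"
proof -
  have "connected_component_of_set (top_of r) x = symcl r `` {x}" if "x \<in> Field r" for x
  proof -
    have "x \<in> symcl r `` {x}" using qoD(3)[OF assms that] subset_symcl by blast
    then have "connected_component_of (top_of r) x y \<longleftrightarrow> (x, y) \<in> symcl r" for y
      unfolding connected_component_of_def
      using connectedin_symcl_class[OF assms that] connectedin_imp_symcl[OF assms, of _ x y]
      by (meson Image_singleton_iff)
    then show ?thesis by auto
  qed
  then show ?thesis by (auto simp: connected_components_of_def quotient_def)
qed

text \<open>The first condition of admissibility makes \<open>T'\<close> agree with \<open>T\<close>
  inside each component of \<open>T'\<close>, which gives \<open>r \<inter> E\<close>; the second
  says that \<open>T / T'\<close> identifies exactly the points of a common component.\<close>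

lemma admissible_top_D:
  assumes fin: "finite (topspace T)" and a: "admissible_top T T'"
  shows "adm (rel_of T) (symcl (rel_of T'))" "T' = top_of (rel_of T \<inter> symcl (rel_of T'))"
proof -
  define r r' E where defs: "r = rel_of T" "r' = rel_of T'" "E = symcl r'"
  have finer: "finer_top T' T" and ts: "topspace T' = topspace T"
    using a by (auto simp: admissible_top_def finer_top_def)
  have qr: "qo r" and qr': "qo r'" using qo_rel_of[of T] qo_rel_of[of T'] fin ts by (simp_all add: defs)
  have T': "T' = top_of r'" using top_of_rel_of fin ts by (metis defs(2))
  have F: "Field r = topspace T" "Field r' = topspace T" by (simp_all add: defs ts)
  have sub: "r' \<subseteq> r" using finer_top_iff[OF fin ts] finer by (simp add: defs)
  have r'E: "r' \<subseteq> E" unfolding defs(3) by (rule subset_symcl)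
  \<comment> \<open>Two points of one class of \<open>E\<close> lie in a \<open>T'\<close>-connected
    set, on which \<open>T'\<close> and \<open>T\<close> have the same relation.\<close>
  have "r \<inter> E \<subseteq> r'"
  proof clarify
    fix x y assume xy: "(x, y) \<in> r" "(x, y) \<in> E"
    let ?C = "E `` {x}"
    have x: "x \<in> Field r'" using xy F by (metis FieldI1)
    have "connectedin T' ?C"
      unfolding T' defs(3) by (rule connectedin_symcl_class[OF qr' x])
    then have "subtopology T' ?C = subtopology T ?C" using a by (simp add: admissible_top_def)
    then have "Restr r' ?C = Restr r ?C"
      using rel_of_subtopology[of T ?C] rel_of_subtopology[of T' ?C] fin ts by (simp add: defs(1,2))
    moreover have "x \<in> ?C" "y \<in> ?C" using r'E qoD(3)[OF qr' x] xy by auto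
    ultimately show "(x, y) \<in> r'" using xy by blast
  qed
  with sub r'E have r': "r \<inter> E = r'" by blast
  show "T' = top_of (rel_of T \<inter> symcl (rel_of T'))"
    unfolding defs(1)[symmetric] defs(2)[symmetric] defs(3)[symmetric] r' by (rule T')
  have "r \<union> E \<subseteq> (r \<union> r'\<inverse>)\<^sup>+"
  proof -
    have "E \<subseteq> (r \<union> r'\<inverse>)\<^sup>+" unfolding defs(3) symcl_def using sub by (intro trancl_mono_subset) blast
    then show ?thesis by auto
  qed
  then have "quo r E \<subseteq> (r \<union> r'\<inverse>)\<^sup>+" unfolding quo_def by (intro trancl_least trans_trancl)
  moreover have "(r \<union> r'\<inverse>)\<^sup>+ \<subseteq> quo r E"
    using r'E symcl_equiv(1)[of r'] unfolding quo_def defs(3)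
    by (intro trancl_mono_subset) (auto dest: symD)
  ultimately have q: "rel_of (quot_top T T') = quo r E"
    using rel_of_quot_top[OF finer] by (simp add: defs)
  \<comment> \<open>The quotient of \<open>T'\<close> by itself closes \<open>r'\<close> together
    with its converse, so its quasi-order is the equivalence \<open>E\<close>.\<close>
  have "finer_top T' T'" by (simp add: finer_top_def)
  then have q': "rel_of (quot_top T' T') = E"
    using rel_of_quot_top by (simp add: defs symcl_def)
  have "rel_of (quot_top T T') \<inter> (rel_of (quot_top T T'))\<inverse> = rel_of (quot_top T' T') \<inter> (rel_of (quot_top T' T'))\<inverse>"
    using a by (auto simp: admissible_top_def spec_eq_def rel_of_def)
  then have "quo r E \<inter> (quo r E)\<inverse> = E"
    unfolding q q' using symcl_equiv(1)[of r'] by (auto simp: defs(3) sym_conv_converse_eq)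
  moreover have "E = symcl (r \<inter> E)" unfolding r' by (simp add: defs(3))
  ultimately show "adm (rel_of T) (symcl (rel_of T'))" by (simp add: adm_def defs)
qed

text \<open>Reversed edges of \<open>r \<inter> E\<close> suffice: with the forward edges already in
  \<open>r\<close> they generate \<open>symcl (r \<inter> E)\<close>, which is
  \<open>E\<close>.\<close>

lemma quo_alt:
  assumes "adm r E"
  shows "(r \<union> (r \<inter> E)\<inverse>)\<^sup>+ = quo r E"
proof
  show "(r \<union> (r \<inter> E)\<inverse>)\<^sup>+ \<subseteq> quo r E"
    unfolding quo_def using adm_equiv(1)[OF assms]
    by (intro trancl_mono_subset) (auto dest: symD)
  have "symcl (r \<inter> E) \<subseteq> (r \<union> (r \<inter> E)\<inverse>)\<^sup>+"
    unfolding symcl_def by (intro trancl_mono_subset) auto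
  then have "E \<subseteq> (r \<union> (r \<inter> E)\<inverse>)\<^sup>+" using adm_D(1)[OF assms] by simp
  then have "r \<union> E \<subseteq> (r \<union> (r \<inter> E)\<inverse>)\<^sup>+" by auto
  then show "quo r E \<subseteq> (r \<union> (r \<inter> E)\<inverse>)\<^sup>+"
    unfolding quo_def by (intro trancl_least trans_trancl)
qed

lemma admissible_top_of:
  assumes qr: "qo r" and a: "adm r E"
  shows "admissible_top (top_of r) (top_of (r \<inter> E))" "quot_top (top_of r) (top_of (r \<inter> E)) = top_of (quo r E)"
proof -
  note q = qo_Int_adm[OF a qr] and F = Field_Int_adm[OF a qr]
  have fin: "finite (topspace (top_of r))" using qoD(4)[OF qr] by simp
  have finer: "finer_top (top_of (r \<inter> E)) (top_of r)"
    by (subst finer_top_iff[OF fin]) (simp_all add: F rel_of_top_of q qr)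
  have R: "rel_of (quot_top (top_of r) (top_of (r \<inter> E))) = quo r E"
    by (simp add: rel_of_quot_top[OF finer] rel_of_top_of q qr quo_alt[OF a])
  have "topspace (quot_top (top_of r) (top_of (r \<inter> E))) = Field r"
    by (simp add: quot_top_def)
  then have "top_of (rel_of (quot_top (top_of r) (top_of (r \<inter> E)))) = quot_top (top_of r) (top_of (r \<inter> E))"
    using qoD(4)[OF qr] by (intro top_of_rel_of) simp
  then show "quot_top (top_of r) (top_of (r \<inter> E)) = top_of (quo r E)" by (simp add: R)
  have R': "rel_of (quot_top (top_of (r \<inter> E)) (top_of (r \<inter> E))) = E"
    using adm_D(1)[OF a] rel_of_quot_top[of "top_of (r \<inter> E)" "top_of (r \<inter> E)"]
    by (simp add: finer_top_def rel_of_top_of q symcl_def)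
  have "subtopology (top_of (r \<inter> E)) Y = subtopology (top_of r) Y" if "connectedin (top_of (r \<inter> E)) Y" for Y
  proof -
    \<comment> \<open>A connected set lies in one class of \<open>E\<close>, where intersecting with
      \<open>E\<close> removes nothing.\<close>
    have "Y \<times> Y \<subseteq> E" using connectedin_imp_symcl[OF q that] adm_D(1)[OF a] by auto
    then have "Restr (r \<inter> E) Y = Restr r Y" by blast
    then show ?thesis by (simp add: subtopology_top_of q qr)
  qed
  moreover have "spec_eq (quot_top (top_of r) (top_of (r \<inter> E))) x y \<longleftrightarrow>
      spec_eq (quot_top (top_of (r \<inter> E)) (top_of (r \<inter> E))) x y" for x y
  proof -
    have "(x, y) \<in> quo r E \<inter> (quo r E)\<inverse> \<longleftrightarrow> (x, y) \<in> E \<inter> E\<inverse>"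
      using adm_D(2)[OF a] adm_equiv(1)[OF a] by (auto dest: symD)
    then show ?thesis unfolding spec_eq_def rel_of_iff[symmetric] R R' by simp
  qed
  ultimately show "admissible_top (top_of r) (top_of (r \<inter> E))"
    using finer by (simp add: admissible_top_def)
qed

lemma bij_betw_adm_admissible_top:
  assumes "qo r"
  shows "bij_betw (\<lambda>E. top_of (r \<inter> E)) {E. adm r E} {T'. admissible_top (top_of r) T'}"
proof (rule bij_betw_byWitness[where f' = "\<lambda>T'. symcl (rel_of T')"])
  have fin: "finite (topspace (top_of r))" using qoD(4)[OF assms] by simp
  note * = admissible_top_D[OF fin, unfolded rel_of_top_of[OF assms]]
  show "\<forall>T'\<in>{T'. admissible_top (top_of r) T'}. top_of (r \<inter> symcl (rel_of T')) = T'"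
    using *(2) by auto
  show "(\<lambda>T'. symcl (rel_of T')) ` {T'. admissible_top (top_of r) T'} \<subseteq> {E. adm r E}"
    using *(1) by auto
  show "\<forall>E\<in>{E. adm r E}. symcl (rel_of (top_of (r \<inter> E))) = E"
    using qo_Int_adm[OF _ assms] adm_D(1) by (auto simp: rel_of_top_of)
  show "(\<lambda>E. top_of (r \<inter> E)) ` {E. adm r E} \<subseteq> {T'. admissible_top (top_of r) T'}"
    using admissible_top_of(1)[OF assms] by auto
qed

section \<open>Structure maps on classes of quasi-orders\<close>

definition cls :: "nat rel \<Rightarrow> htop" where
  "cls r = abs_htop (top_of r)"

text \<open>A permutation of all of \<open>nat\<close> rather than a bijection of carriers;
  \<open>extend_to_bij\<close> makes this equally general on finite carriers.\<close>

definition iso_qo :: "nat rel \<Rightarrow> nat rel \<Rightarrow> bool" where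
  "iso_qo r s \<longleftrightarrow> (\<exists>f. bij f \<and> s = rmap f r)"

lemma homeomorphic_map_rmap:
  assumes "bij f" "qo r"
  shows "homeomorphic_map (top_of r) (top_of (rmap f r)) f"
proof (rule bijective_open_imp_homeomorphic_map)
  have inv: "f ` inv f ` A = A" for A
    using assms(1) by (simp add: bij_is_surj image_f_inv_f)
  have pre: "{x \<in> Field r. f x \<in> U} = inv f ` U" if "U \<subseteq> f ` Field r" for U
    unfolding bij_vimage_eq_inv_image[OF assms(1), symmetric]
    using that bij_is_inj[OF assms(1)] by (auto dest: injD)
  show "continuous_map (top_of r) (top_of (rmap f r)) f"
    unfolding continuous_map_def
  proof (intro conjI allI impI)
    fix U assume U: "openin (top_of (rmap f r)) U"
    then have "U \<subseteq> f ` Field r" using openin_subset by fastforce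
    moreover have "upset (rmap f r) (f ` inv f ` U)" using U unfolding openin_top_of inv .
    ultimately show "openin (top_of r) {x \<in> topspace (top_of r). f x \<in> U}"
      by (simp add: pre openin_top_of upset_rmap[OF assms(1)])
  qed simp
  show "open_map (top_of r) (top_of (rmap f r)) f"
    by (simp add: open_map_def openin_top_of upset_rmap[OF assms(1)])
  show "f ` topspace (top_of r) = topspace (top_of (rmap f r))" by simp
  show "inj_on f (topspace (top_of r))" using assms(1) by (meson bij_is_inj inj_on_subset subset_UNIV)
qed

lemma homeomorphic_imp_iso_qo:
  fixes T U :: "nat topology"
  assumes "finite (topspace T)" "T homeomorphic_space U"
  shows "iso_qo (rel_of T) (rel_of U)"
proof -
  obtain f where f: "homeomorphic_map T U f"
    using assms(2) homeomorphic_space by blast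
  then have inj: "inj_on f (topspace T)" and im: "f ` topspace T = topspace U"
    by (auto simp: homeomorphic_eq_everything_map)
  \<comment> \<open>\<open>rmap\<close> depends only on the values on the carrier, so
    \<open>f\<close> may be exchanged for a permutation.\<close>
  obtain g where g: "bij g" "\<And>x. x \<in> topspace T \<Longrightarrow> g x = f x"
    using extend_to_bij[OF assms(1) inj] by blast
  have op: "openin U (f ` V) \<longleftrightarrow> openin T V" if "V \<subseteq> topspace T" for V
    using homeomorphic_map_openness[OF f that] .
  have le: "spec_le U (f x) (f y) \<longleftrightarrow> spec_le T x y" if "x \<in> topspace T" "y \<in> topspace T" for x y
  proof
    assume a: "spec_le U (f x) (f y)"
    show "spec_le T x y"
      unfolding spec_le_def
    proof (intro conjI that allI impI)
      fix V assume V: "openin T V \<and> x \<in> V"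
      then have VT: "V \<subseteq> topspace T" by (simp add: openin_subset)
      then have "f y \<in> f ` V" using V a op by (auto simp: spec_le_def)
      then show "y \<in> V" using VT inj that by (auto simp: inj_on_def)
    qed
  next
    assume a: "spec_le T x y"
    show "spec_le U (f x) (f y)"
      unfolding spec_le_def
    proof (intro conjI allI impI)
      fix V assume V: "openin U V \<and> f x \<in> V"
      let ?W = "{z \<in> topspace T. f z \<in> V}"
      have "V \<subseteq> topspace U" using V by (simp add: openin_subset)
      then have "f ` ?W = V" using im by auto
      then have "openin T ?W" using V op[of ?W] by auto
      then show "f y \<in> V" using a V that by (auto simp: spec_le_def)
    qed (use im that in auto)
  qed
  have "rel_of U = rmap f (rel_of T)"
  proof (intro set_eqI iffI)
    fix p assume p: "p \<in> rel_of U"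
    obtain a b where ab: "p = (a, b)" by (cases p)
    then have "a \<in> f ` topspace T" "b \<in> f ` topspace T"
      using p im by (auto simp: rel_of_def spec_le_def)
    then obtain x y where "x \<in> topspace T" "y \<in> topspace T" "a = f x" "b = f y" by blast
    then show "p \<in> rmap f (rel_of T)"
      using p ab le by (auto simp: rel_of_def rmap_def)
  next
    fix p assume "p \<in> rmap f (rel_of T)"
    then obtain x y where "p = (f x, f y)" "spec_le T x y" by (auto simp: rmap_def rel_of_def)
    then show "p \<in> rel_of U" using le by (auto simp: rel_of_def spec_le_def)
  qed
  also have "\<dots> = rmap g (rel_of T)" by (rule rmap_cong) (simp add: g)
  finally show ?thesis using g by (auto simp: iso_qo_def)
qed

lemma finite_rep_htop: "finite (topspace (rep_htop c))"
  using Quotient3_rep_reflp[OF Quotient3_htop, of c] by simp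

lemma cls_rel_of_rep: "cls (rel_of (rep_htop c)) = c"
  by (simp add: cls_def top_of_rel_of finite_rep_htop Quotient3_abs_rep[OF Quotient3_htop])

lemma cls_cases:
  obtains r where "qo r" "c = cls r"
  using cls_rel_of_rep qo_rel_of finite_rep_htop by metis

lemma abs_htop_eq_cls: "finite (topspace T) \<Longrightarrow> abs_htop T = cls (rel_of T)"
  by (simp add: cls_def top_of_rel_of)

lemma cls_eq_iff:
  assumes "qo r" "qo s"
  shows "cls r = cls s \<longleftrightarrow> iso_qo r s"
proof -
  have fin: "finite (topspace (top_of r))" "finite (topspace (top_of s))"
    using assms by (simp_all add: qoD)
  have "cls r = cls s \<longleftrightarrow> top_of r homeomorphic_space top_of s"
    using Quotient3_rel[OF Quotient3_htop, of "top_of r" "top_of s"] fin by (simp add: cls_def)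
  also have "\<dots> \<longleftrightarrow> iso_qo r s"
    using homeomorphic_imp_iso_qo[OF fin(1), of "top_of s"] homeomorphic_map_rmap[OF _ assms(1)]
    by (auto simp: rel_of_top_of assms iso_qo_def homeomorphic_space)
  finally show ?thesis .
qed

lemma cls_rmap:
  assumes "qo r" "inj_on f (Field r)"
  shows "cls (rmap f r) = cls r"
proof -
  obtain g where g: "bij g" "\<And>x. x \<in> Field r \<Longrightarrow> g x = f x"
    using extend_to_bij[OF qoD(4)[OF assms(1)] assms(2)] by blast
  then have "rmap f r = rmap g r" by (intro rmap_cong) simp
  then show ?thesis
    using g(1) cls_eq_iff[OF assms(1) qo_rmap[OF assms(2,1)]] by (auto simp: iso_qo_def)
qed

text \<open>The structure maps are defined on \<open>rep_htop\<close>, which is known only up to a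
  permutation. Each is evaluated on \<open>rmap f r\<close> and then carried back to
  \<open>r\<close>.\<close>

lemma rep_cls:
  assumes "qo r"
  obtains f where "bij f" "rep_htop (cls r) = top_of (rmap f r)"
proof -
  have "iso_qo r (rel_of (rep_htop (cls r)))"
    using cls_eq_iff[OF assms qo_rel_of[OF finite_rep_htop, of "cls r"]] by (simp add: cls_rel_of_rep)
  then show ?thesis
    using that by (metis iso_qo_def top_of_rel_of finite_rep_htop)
qed

lemma inj_on_bij: "bij f \<Longrightarrow> inj_on f A"
  by (meson bij_is_inj inj_on_subset subset_UNIV)

lemma cls_Un_cong:
  assumes "qo r" "qo s" "qo r'" "qo s'" "Field r \<inter> Field s = {}" "Field r' \<inter> Field s' = {}"
    and "cls r = cls r'" "cls s = cls s'"
  shows "cls (r \<union> s) = cls (r' \<union> s')"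
proof -
  obtain f g where f: "bij f" "r' = rmap f r" and g: "bij g" "s' = rmap g s"
    using assms cls_eq_iff by (auto simp: iso_qo_def)
  \<comment> \<open>The two isomorphisms need not agree anywhere; disjoint carriers let them be
    glued, and disjoint images keep the result injective.\<close>
  let ?h = "\<lambda>x. if x \<in> Field r then f x else g x"
  have h: "rmap ?h r = r'" "rmap ?h s = s'"
    unfolding f g by (rule rmap_cong; use assms(5) in auto)+
  have "inj_on ?h (Field (r \<union> s))"
    using assms(5,6) inj_on_bij[OF f(1)] inj_on_bij[OF g(1)] unfolding f g Field_rmap
    by (auto simp: inj_on_def)
  then have "cls (rmap ?h (r \<union> s)) = cls (r \<union> s)"
    by (intro cls_rmap qo_Un assms)
  then show ?thesis by (simp add: rmap_Un h)
qed

text \<open>Covers \<open>even_copy\<close> and \<open>odd_copy\<close> together: \<open>g\<close>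
  is halving, a left inverse of doubling and of doubling plus one.\<close>

lemma rel_of_pullback:
  assumes "\<And>x. g (h x) = x"
  shows "rel_of (pullback_topology (h ` topspace T) g T) = rmap h (rel_of T)"
proof -
  let ?P = "pullback_topology (h ` topspace T) g T"
  have ts: "topspace ?P = h ` topspace T"
    using assms by (auto simp: topspace_pullback_topology)
  have "spec_le ?P (h x) (h y) \<longleftrightarrow> spec_le T x y" for x y
  proof -
    have "h z \<in> h ` topspace T \<longleftrightarrow> z \<in> topspace T" for z using assms by (metis image_iff)
    moreover have "(\<forall>U. openin ?P U \<and> h x \<in> U \<longrightarrow> h y \<in> U) \<longleftrightarrow> (\<forall>V. openin T V \<and> x \<in> V \<longrightarrow> y \<in> V)"
      if xy: "x \<in> topspace T" "y \<in> topspace T"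
    proof (intro iffI allI impI)
      fix V assume a: "\<forall>U. openin ?P U \<and> h x \<in> U \<longrightarrow> h y \<in> U" and V: "openin T V \<and> x \<in> V"
      have "openin ?P (g -` V \<inter> h ` topspace T)"
        using V by (auto simp: openin_pullback_topology)
      moreover have "h x \<in> g -` V \<inter> h ` topspace T" using V xy assms by auto
      ultimately have "h y \<in> g -` V \<inter> h ` topspace T" using a by blast
      then show "y \<in> V" using assms by simp
    next
      fix U assume a: "\<forall>V. openin T V \<and> x \<in> V \<longrightarrow> y \<in> V" and U: "openin ?P U \<and> h x \<in> U"
      then obtain V where V: "openin T V" "U = g -` V \<inter> h ` topspace T"
        by (auto simp: openin_pullback_topology)
      then have "x \<in> V" using U assms by auto
      then have "y \<in> V" using a V by blast
      then show "h y \<in> U" using V assms xy by auto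
    qed
    ultimately show ?thesis unfolding spec_le_def ts by blast
  qed
  moreover have "a \<in> h ` topspace T \<and> b \<in> h ` topspace T" if "spec_le ?P a b" for a b
    using that unfolding spec_le_def ts by blast
  ultimately have "spec_le ?P a b \<longleftrightarrow> (\<exists>x y. a = h x \<and> b = h y \<and> spec_le T x y)" for a b
    by blast
  then show ?thesis by (auto simp: rel_of_def rmap_def)
qed

text \<open>Frees the product from the even and odd copies: by \<open>cls_Un_cong\<close> any other
  disjoint representatives give the same class.\<close>

lemma htop_mult_cls:
  assumes "qo r" "qo s" "Field r \<inter> Field s = {}"
  shows "htop_mult (cls r) (cls s) = cls (r \<union> s)"
proof -
  define r0 s0 where rs0: "r0 = rel_of (rep_htop (cls r))" "s0 = rel_of (rep_htop (cls s))"
  have q0: "qo r0" "qo s0" by (simp_all add: rs0 qo_rel_of finite_rep_htop)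
  have c0: "cls r0 = cls r" "cls s0 = cls s" by (simp_all add: rs0 cls_rel_of_rep)
  let ?e = "\<lambda>n::nat. 2 * n" and ?o = "\<lambda>n::nat. 2 * n + 1"
  have inj: "inj_on ?e A" "inj_on ?o A" for A by (auto simp: inj_on_def)
  have e: "rel_of (even_copy (rep_htop (cls r))) = rmap ?e r0"
    unfolding even_copy_def rs0 by (rule rel_of_pullback[where g = "\<lambda>n. n div 2"]) simp
  have o: "rel_of (odd_copy (rep_htop (cls s))) = rmap ?o s0"
    unfolding odd_copy_def rs0 by (rule rel_of_pullback[where g = "\<lambda>n. n div 2"]) simp
  have te: "topspace (even_copy (rep_htop (cls r))) = ?e ` Field r0"
    using arg_cong[OF e, of Field] by simp
  have to: "topspace (odd_copy (rep_htop (cls s))) = ?o ` Field s0"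
    using arg_cong[OF o, of Field] by simp
  have disj: "?e ` Field r0 \<inter> ?o ` Field s0 = {}" by (auto, presburger)
  have rel: "rel_of (prod_top (even_copy (rep_htop (cls r))) (odd_copy (rep_htop (cls s)))) = rmap ?e r0 \<union> rmap ?o s0"
    using rel_of_prod_top[of "even_copy (rep_htop (cls r))" "odd_copy (rep_htop (cls s))"] disj
    unfolding te to e o by blast
  have "topspace (prod_top (even_copy (rep_htop (cls r))) (odd_copy (rep_htop (cls s)))) = ?e ` Field r0 \<union> ?o ` Field s0"
    using arg_cong[OF rel, of Field] by simp
  then have "htop_mult (cls r) (cls s) = cls (rmap ?e r0 \<union> rmap ?o s0)"
    unfolding htop_mult_def rel[symmetric] by (intro abs_htop_eq_cls) (simp add: qoD q0)
  also have "\<dots> = cls (r \<union> s)"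
    by (rule cls_Un_cong) (use assms q0 inj disj c0 in \<open>auto simp: qo_rmap cls_rmap\<close>)
  finally show ?thesis .
qed

section \<open>Coproducts and counits computed on an arbitrary representative\<close>

lemma H_Delta_rmap:
  assumes "bij f" "qo r"
  shows "(\<Sum>Y | upset (rmap f r) Y. bas (cls (Restr (rmap f r) (Field (rmap f r) - Y)), cls (Restr (rmap f r) Y)))
    = (\<Sum>Y | upset r Y. bas (cls (Restr r (Field r - Y)), cls (Restr r Y)) :: 'k::field HT2)"
proof -
  note inj = bij_is_inj[OF assms(1)]
  have "(\<Sum>Y | upset r Y. bas (cls (Restr (rmap f r) (Field (rmap f r) - f ` Y)), cls (Restr (rmap f r) (f ` Y))))
    = (\<Sum>Y | upset (rmap f r) Y. bas (cls (Restr (rmap f r) (Field (rmap f r) - Y)), cls (Restr (rmap f r) Y)) :: 'k HT2)"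
    by (rule sum.reindex_bij_betw[OF bij_betw_upset_rmap[OF assms(1)]])
  moreover have "Restr (rmap f r) (Field (rmap f r) - f ` Y) = rmap f (Restr r (Field r - Y))"
    "Restr (rmap f r) (f ` Y) = rmap f (Restr r Y)" for Y
    by (simp_all add: rmap_Restr[OF inj] image_set_diff[OF inj])
  ultimately show ?thesis
    by (simp add: cls_rmap qo_Restr assms inj_on_bij)
qed

lemma H_Delta_cls:
  assumes "qo r"
  shows "H_Delta (bas (cls r)) = (\<Sum>Y | upset r Y. bas (cls (Restr r (Field r - Y)), cls (Restr r Y)))"
proof -
  obtain f where f: "bij f" "rep_htop (cls r) = top_of (rmap f r)" using rep_cls[OF assms] .
  have q: "qo (rmap f r)" using qo_rmap[OF inj_on_bij[OF f(1)] assms] .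
  show ?thesis
    unfolding H_Delta_rmap[OF f(1) assms, symmetric]
    by (simp add: H_Delta_def Let_def f(2) Collect_cong[OF openin_top_of] openin_top_of subtopology_top_of[OF q] cls_def[symmetric])
qed

lemma H_Gamma_rmap:
  assumes "bij f" "qo r"
  shows "(\<Sum>E | adm (rmap f r) E. bas (cls (rmap f r \<inter> E), cls (quo (rmap f r) E)))
    = (\<Sum>E | adm r E. bas (cls (r \<inter> E), cls (quo r E)) :: 'k::field HT2)"
proof -
  have "(\<Sum>E | adm r E. bas (cls (rmap f r \<inter> rmap f E), cls (quo (rmap f r) (rmap f E))))
    = (\<Sum>E | adm (rmap f r) E. bas (cls (rmap f r \<inter> E), cls (quo (rmap f r) E)) :: 'k HT2)"
    by (rule sum.reindex_bij_betw[OF bij_betw_adm_rmap[OF assms(1)]])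
  moreover have "(\<Sum>E | adm r E. bas (cls (rmap f r \<inter> rmap f E), cls (quo (rmap f r) (rmap f E))))
    = (\<Sum>E | adm r E. bas (cls (r \<inter> E), cls (quo r E)) :: 'k::field HT2)"
    by (rule sum.cong)
       (simp_all add: rmap_Int[OF bij_is_inj[OF assms(1)], symmetric] rmap_quo[OF assms(1), symmetric]
         cls_rmap qo_Int_adm qo_quo_adm assms inj_on_bij)
  ultimately show ?thesis by simp
qed

lemma H_Gamma_cls:
  assumes "qo r"
  shows "H_Gamma (bas (cls r)) = (\<Sum>E | adm r E. bas (cls (r \<inter> E), cls (quo r E)) :: 'k::field HT2)"
proof -
  obtain f where f: "bij f" "rep_htop (cls r) = top_of (rmap f r)" using rep_cls[OF assms] .
  have q: "qo (rmap f r)" using qo_rmap[OF inj_on_bij[OF f(1)] assms] .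
  let ?T = "top_of (rmap f r)"
  have "H_Gamma (bas (cls r)) = (\<Sum>T' | admissible_top ?T T'. bas (abs_htop T', abs_htop (quot_top ?T T')) :: 'k HT2)"
    by (simp add: H_Gamma_def Let_def f(2))
  also have "\<dots> = (\<Sum>E | adm (rmap f r) E. bas (abs_htop (top_of (rmap f r \<inter> E)), abs_htop (quot_top ?T (top_of (rmap f r \<inter> E)))))"
    by (rule sum.reindex_bij_betw[OF bij_betw_adm_admissible_top[OF q], symmetric])
  also have "\<dots> = (\<Sum>E | adm (rmap f r) E. bas (cls (rmap f r \<inter> E), cls (quo (rmap f r) E)))"
    by (rule sum.cong) (simp_all add: admissible_top_of(2)[OF q] cls_def)
  also have "\<dots> = (\<Sum>E | adm r E. bas (cls (r \<inter> E), cls (quo r E)))"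
    by (rule H_Gamma_rmap[OF f(1) assms])
  finally show ?thesis .
qed

lemma H_Delta_counit_cls:
  assumes "qo r"
  shows "H_Delta_counit (bas (cls r)) = (if r = {} then 1 else 0)"
proof -
  obtain f where f: "bij f" "rep_htop (cls r) = top_of (rmap f r)" using rep_cls[OF assms] .
  have "Field r = {} \<longleftrightarrow> r = {}" by (auto simp: Field_def)
  then have "topspace (rep_htop (cls r)) = {} \<longleftrightarrow> r = {}"
    unfolding f(2) topspace_top_of Field_rmap by simp
  then show ?thesis unfolding H_Delta_counit_def form_ext_bas by (simp only:)
qed

lemma H_Gamma_counit_cls:
  assumes "qo r"
  shows "H_Gamma_counit (bas (cls r)) = (if sym r then 1 else 0)"
proof -
  obtain f where f: "bij f" "rep_htop (cls r) = top_of (rmap f r)" using rep_cls[OF assms] .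
  have q: "qo (rmap f r)" using qo_rmap[OF inj_on_bij[OF f(1)] assms] .
  have rel: "{(x, y). spec_le (top_of (rmap f r)) x y} = rmap f r"
    using rel_of_top_of[OF q] by (simp add: rel_of_def)
  have "sym (rmap f r) \<longleftrightarrow> sym r"
    unfolding sym_conv_converse_eq rmap_converse[symmetric] rmap_eq_iff[OF f(1)] ..
  moreover have "equiv (Field (rmap f r)) (rmap f r) \<longleftrightarrow> sym (rmap f r)"
    using q unfolding equiv_def qo_def refl_on_def by (auto simp del: Field_rmap intro: FieldI1 FieldI2)
  ultimately show ?thesis
    by (simp add: H_Gamma_counit_def Let_def f(2) rel del: Field_rmap)
qed

section \<open>Degree, size and unit on classes of quasi-orders\<close>

definition qo_degree :: "nat rel \<Rightarrow> nat" where
  "qo_degree r = card (Field r // (r \<inter> r\<inverse>)) - card (Field r // symcl r)"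

lemma card_quotient_rmap:
  assumes "bij f"
  shows "card (f ` A // rmap f r) = card (A // r)"
proof -
  have "rmap f r `` {f x} = f ` (r `` {x})" for x
    using bij_is_inj[OF assms] by (force simp: rmap_def inj_eq)
  then have "f ` A // rmap f r = (`) f ` (A // r)"
    by (auto simp: quotient_def)
  moreover have "inj_on ((`) f) (A // r)"
    using bij_is_inj[OF assms] by (auto simp: inj_on_def inj_image_eq_iff)
  ultimately show ?thesis by (simp add: card_image)
qed

lemma top_degree_cls:
  assumes "qo r"
  shows "top_degree (rep_htop (cls r)) = qo_degree r"
proof -
  obtain f where f: "bij f" "rep_htop (cls r) = top_of (rmap f r)" using rep_cls[OF assms] .
  have q: "qo (rmap f r)" using qo_rmap[OF inj_on_bij[OF f(1)] assms] .
  have "{(x, y). spec_eq (top_of (rmap f r)) x y} = rmap f r \<inter> (rmap f r)\<inverse>"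
    using rel_of_top_of[OF q] by (auto simp: rel_of_def spec_eq_def)
  also have "\<dots> = rmap f (r \<inter> r\<inverse>)"
    by (simp add: rmap_Int bij_is_inj f(1) rmap_converse)
  finally show ?thesis
    by (simp add: top_degree_def f(2) connected_components_of_top_of[OF q] rmap_symcl[OF f(1), symmetric]
        card_quotient_rmap[OF f(1)] qo_degree_def)
qed

lemma card_topspace_cls:
  assumes "qo r"
  shows "card (topspace (rep_htop (cls r))) = card (Field r)"
proof -
  obtain f where f: "bij f" "rep_htop (cls r) = top_of (rmap f r)" using rep_cls[OF assms] .
  then show ?thesis by (simp add: card_image inj_on_bij)
qed

lemma H_one_cls: "H_one = bas (cls {})"
proof -
  have "top_of {} = (discrete_topology {} :: nat topology)"
    by (auto simp: topology_eq openin_top_of upset_def)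
  then show ?thesis by (simp add: H_one_def cls_def)
qed

subsection \<open>The product\<close>

text \<open>A translation moves the carrier beyond any finite set; this supplies the disjoint
  representatives that \<open>htop_mult_cls\<close> asks for.\<close>

lemma cls_cases_avoiding:
  fixes X :: "nat set"
  assumes "finite X"
  obtains r where "qo r" "c = cls r" "Field r \<inter> X = {}"
proof -
  obtain r where r: "qo r" "c = cls r" by (rule cls_cases)
  obtain N where N: "\<And>x. x \<in> X \<Longrightarrow> x < N" using assms[unfolded finite_nat_set_iff_bounded] by blast
  let ?f = "\<lambda>n. n + N"
  have inj: "inj_on ?f (Field r)" by (auto simp: inj_on_def)
  show ?thesis
  proof
    show "qo (rmap ?f r)" by (rule qo_rmap[OF inj r(1)])
    show "c = cls (rmap ?f r)" using cls_rmap[OF r(1) inj] r(2) by simp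
    show "Field (rmap ?f r) \<inter> X = {}" using N by fastforce
  qed
qed

lemma cls_cases2:
  obtains r s where "qo r" "qo s" "a = cls r" "b = cls s" "Field r \<inter> Field s = {}"
proof -
  obtain r where r: "qo r" "a = cls r" by (rule cls_cases)
  obtain s where "qo s" "b = cls s" "Field s \<inter> Field r = {}" by (rule cls_cases_avoiding[OF qoD(4)[OF r(1)]])
  then show ?thesis using r that by blast
qed

lemma qo_empty: "qo {}"
  by (simp add: qo_def)

lemma htop_mult_commute: "htop_mult a b = htop_mult b a"
proof -
  obtain r s where "qo r" "qo s" "a = cls r" "b = cls s" "Field r \<inter> Field s = {}" by (rule cls_cases2)
  then show ?thesis by (simp add: htop_mult_cls Un_commute Int_commute)
qed

lemma htop_mult_assoc: "htop_mult (htop_mult a b) c = htop_mult a (htop_mult b c)"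
proof -
  obtain r s where rs: "qo r" "qo s" "a = cls r" "b = cls s" "Field r \<inter> Field s = {}" by (rule cls_cases2)
  have "finite (Field r \<union> Field s)" using qoD(4) rs by auto
  then obtain t where t: "qo t" "c = cls t" "Field t \<inter> (Field r \<union> Field s) = {}"
    by (rule cls_cases_avoiding)
  then have "Field (r \<union> s) \<inter> Field t = {}" "Field r \<inter> Field (s \<union> t) = {}" "Field s \<inter> Field t = {}"
    using rs by auto
  then show ?thesis using rs t by (simp add: htop_mult_cls qo_Un Un_assoc del: Field_Un)
qed

lemma htop_mult_empty: "htop_mult (cls {}) a = a" "htop_mult a (cls {}) = a"
proof -
  obtain r where r: "qo r" "a = cls r" by (rule cls_cases)
  then show "htop_mult (cls {}) a = a" using htop_mult_cls[OF qo_empty r(1)] by simp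
  then show "htop_mult a (cls {}) = a" by (simp add: htop_mult_commute)
qed

lemma lin_H_mult: "lin H_mult"
  unfolding H_mult_def by (rule lin_lin_ext)

lemma H_mult_bas [simp]: "H_mult (bas (a, b)) = bas (htop_mult a b)"
  by (simp add: H_mult_def)

lemma is_algebra_H: "is_algebra H_mult (H_one :: 'k::field HT)"
  unfolding is_algebra_def
proof (intro conjI allI lin_H_mult)
  show "H_mult \<circ> tmap H_mult id = H_mult \<circ> tmap id H_mult \<circ> (tassoc :: _ \<Rightarrow> (htop \<times> htop \<times> htop \<Rightarrow>\<^sub>0 'k))"
  proof (rule lin_eqI)
    fix p :: "(htop \<times> htop) \<times> htop"
    obtain a b c where "p = ((a, b), c)" by (metis surj_pair)
    then show "(H_mult \<circ> tmap H_mult id) (bas p) = (H_mult \<circ> tmap id H_mult \<circ> tassoc) (bas p)"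
      by (simp add: htop_mult_assoc)
  qed (intro lin_intros lin_H_mult)+
  have "(\<lambda>x. H_mult (tens H_one x)) = (\<lambda>x. x :: 'k HT)"
    by (rule lin_eqI) (simp_all add: lin_compose lin_H_mult tens_bilinear lin_id H_one_cls htop_mult_empty)
  then show "H_mult (tens H_one x) = x" for x :: "'k HT" by (rule fun_cong)
  have "(\<lambda>x. H_mult (tens x H_one)) = (\<lambda>x. x :: 'k HT)"
    by (rule lin_eqI) (simp_all add: lin_compose[OF lin_H_mult tens_bilinear(1)] lin_id H_one_cls htop_mult_empty)
  then show "H_mult (tens x H_one) = x" for x :: "'k HT" by (rule fun_cong)
qed

lemma is_commutative_H: "is_commutative H_mult"
  unfolding is_commutative_def
proof (rule lin_eqI)
  fix p :: "htop \<times> htop"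
  show "(H_mult \<circ> tswap) (bas p) = H_mult (bas p)"
    by (cases p) (simp add: htop_mult_commute)
qed (intro lin_intros lin_H_mult)+

text \<open>Multiplying the first and third legs is multiplicative because the product is
  commutative: on the basis the claim is that (aa')(cc') equals (ac)(a'c').\<close>

lemma algebra_hom_m13:
  "is_algebra_hom (tmult (tmult H_mult H_mult) (tmult H_mult H_mult)) (tens (tens H_one H_one) (tens H_one H_one))
     (tmult H_mult (tmult H_mult H_mult)) (tens H_one (tens H_one H_one)) (m13 (H_mult :: 'k::field HT2 \<Rightarrow> 'k HT))"
  unfolding is_algebra_hom_def
proof (intro conjI lin_m13)
  show "m13 H_mult \<circ> tmult (tmult H_mult H_mult) (tmult H_mult H_mult) =
    tmult H_mult (tmult H_mult H_mult) \<circ> tmap (m13 H_mult) (m13 (H_mult :: 'k HT2 \<Rightarrow> 'k HT))"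
  proof (rule lin_eqI)
    fix p :: "((htop \<times> htop) \<times> (htop \<times> htop)) \<times> ((htop \<times> htop) \<times> (htop \<times> htop))"
    obtain a b c d a' b' c' d' where p: "p = (((a, b), (c, d)), ((a', b'), (c', d')))" by (metis surj_pair)
    have "htop_mult (htop_mult a a') (htop_mult c c') = htop_mult (htop_mult a c) (htop_mult a' c')"
      by (metis htop_mult_assoc htop_mult_commute)
    then show "(m13 H_mult \<circ> tmult (tmult H_mult H_mult) (tmult H_mult H_mult)) (bas p) =
      (tmult H_mult (tmult H_mult H_mult) \<circ> tmap (m13 H_mult) (m13 (H_mult :: 'k HT2 \<Rightarrow> 'k HT))) (bas p)"
      by (simp add: p)
  qed (intro lin_intros)+
  show "m13 H_mult (tens (tens H_one H_one) (tens H_one H_one)) = tens H_one (tens H_one (H_one :: 'k HT))"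
    by (simp add: H_one_cls htop_mult_empty)
qed

lemma form_ext_mult:
  assumes "\<And>a b. f (htop_mult a b) = f a * f b"
  shows "form_ext f (H_mult (tens x y)) = form_ext f x * (form_ext f y :: 'k::field)"
proof -
  \<comment> \<open>The form is again given values in the free space on one point, so that
    \<open>bilinear_eqI\<close> applies to it.\<close>
  let ?e = "\<lambda>x. smul (form_ext f x) (bas ()) :: unit \<Rightarrow>\<^sub>0 'k"
  have e: "lin ?e" by (rule lin_form_smul[OF lin_form_form_ext])
  have "?e (H_mult (tens x y)) = smul (form_ext f x * form_ext f y) (bas ())"
  proof (rule bilinear_eqI[of "\<lambda>x y. ?e (H_mult (tens x y))" "\<lambda>x y. smul (form_ext f x * form_ext f y) (bas ())"])
    show "lin (\<lambda>x. ?e (H_mult (tens x y)))" "lin (\<lambda>y. ?e (H_mult (tens x y)))" for x y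
      by (rule lin_compose[OF e]; rule lin_compose[OF lin_H_mult]; rule tens_bilinear)+
    have l: "form_ext f (x + y) = form_ext f x + form_ext f y" "form_ext f (smul c x) = c * form_ext f x" for x y c
      using lin_form_form_ext[of f] by (auto simp: Vector_Spaces.linear_iff)
    show "lin (\<lambda>x. smul (form_ext f x * form_ext f y) (bas ()))" "lin (\<lambda>y. smul (form_ext f x * form_ext f y) (bas ()))" for x y
      by (rule linI; simp add: l algebra_simps free_vs.scale_left_distrib)+
  qed (simp add: assms)
  then have "Poly_Mapping.lookup (?e (H_mult (tens x y))) () = Poly_Mapping.lookup (smul (form_ext f x * form_ext f y) (bas () :: unit \<Rightarrow>\<^sub>0 'k)) ()"
    by (rule arg_cong)
  then show ?thesis unfolding lookup_smul by (simp add: bas_def)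
qed

subsection \<open>The external coproduct\<close>

lemma lin_H_Delta: "lin H_Delta"
  unfolding H_Delta_def by (rule lin_lin_ext)

lemma upset_Field: "upset r Y \<Longrightarrow> Y \<subseteq> Field r"
  by (simp add: upset_def)

lemma upset_Restr_subset: "qo r \<Longrightarrow> upset (Restr r A) Z \<Longrightarrow> Z \<subseteq> Field r \<inter> A"
  using upset_Field Field_Restr_qo by blast

lemma upset_iff: "upset r Y \<longleftrightarrow> Y \<subseteq> Field r \<and> (\<forall>x y. x \<in> Y \<longrightarrow> (x, y) \<in> r \<longrightarrow> y \<in> Y)"
  unfolding upset_def by blast

lemma upset_Restr_iff:
  assumes "qo r"
  shows "upset (Restr r A) Z \<longleftrightarrow> Z \<subseteq> Field r \<inter> A \<and> (\<forall>x y. x \<in> Z \<longrightarrow> (x, y) \<in> r \<longrightarrow> y \<in> A \<longrightarrow> y \<in> Z)"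
  unfolding upset_iff Field_Restr_qo[OF assms] by blast

text \<open>With \<open>upset_nested\<close> this matches an open \<open>Y\<close> and an open
  \<open>Z\<close> of its complement with the chain of open sets
  \<open>Y \<subseteq> Y \<union> Z\<close>.\<close>

lemma upset_Un:
  assumes r: "qo r" and Y: "upset r Y" and Z: "upset (Restr r (Field r - Y)) Z"
  shows "upset r (Y \<union> Z)" "upset (Restr r (Y \<union> Z)) Y"
proof -
  note * = Y[unfolded upset_iff] Z[unfolded upset_Restr_iff[OF r]]
  show "upset r (Y \<union> Z)"
    unfolding upset_iff
  proof (intro conjI allI impI)
    fix x y assume x: "x \<in> Y \<union> Z" and xy: "(x, y) \<in> r"
    show "y \<in> Y \<union> Z"
    proof (rule ccontr)
      assume n: "y \<notin> Y \<union> Z"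
      then have "x \<in> Z" using x xy *(1) by auto
      moreover have "y \<in> Field r - Y" using n FieldI2[OF xy] by simp
      ultimately show False using *(2) xy n by auto
    qed
  qed (use * in auto)
  show "upset (Restr r (Y \<union> Z)) Y"
    unfolding upset_Restr_iff[OF r] using *(1) by auto
qed

lemma upset_nested:
  assumes r: "qo r" and W: "upset r W" and V: "upset (Restr r W) V"
  shows "upset r V" "upset (Restr r (Field r - V)) (W - V)"
proof -
  note * = W[unfolded upset_iff] V[unfolded upset_Restr_iff[OF r]]
  show "upset r V"
    unfolding upset_iff
  proof (intro conjI allI impI)
    fix x y assume x: "x \<in> V" and xy: "(x, y) \<in> r"
    then have "x \<in> W" using *(2) by auto
    then have "y \<in> W" using *(1) xy by auto
    then show "y \<in> V" using x xy *(2) by auto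
  qed (use * in auto)
  show "upset (Restr r (Field r - V)) (W - V)"
    unfolding upset_Restr_iff[OF r]
  proof (intro conjI allI impI)
    fix x y assume "x \<in> W - V" "(x, y) \<in> r" "y \<in> Field r - V"
    then show "y \<in> W - V" using *(1) by auto
  qed (use * in auto)
qed

lemma upset_trivial: "upset r (Field r)" "upset r {}" "upset {} Y \<longleftrightarrow> Y = {}"
  by (auto simp: upset_def FieldI2)

lemma Restr_Restr: "Restr (Restr r A) B = Restr r (A \<inter> B)"
  by auto

text \<open>Both sides run over chains of open sets V \<subseteq> W and split the points X into X -
  W, W - V and V. Applying \<Delta> to the left factor presents the chain as Y = V, Z = W - V;
  applying it to the right factor presents it as W, V.\<close>

lemma H_Delta_coassoc: "tassoc \<circ> tmap H_Delta id \<circ> H_Delta = tmap id H_Delta \<circ> (H_Delta :: 'k::field HT \<Rightarrow> _)"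
proof (rule lin_eqI)
  fix c
  obtain r where r: "qo r" "c = cls r" by (rule cls_cases)
  let ?X = "Field r"
  let ?A = "SIGMA Y:{Y. upset r Y}. {Z. upset (Restr r (?X - Y)) Z}"
  let ?B = "SIGMA W:{W. upset r W}. {V. upset (Restr r W) V}"
  note F = Field_Restr_qo[OF r(1)]
  have fin: "finite {Y. upset (Restr r A) Y}" "finite {Y. upset r Y}" for A
    using finite_upset qo_Restr r(1) by blast+
  have "(tassoc \<circ> tmap H_Delta id \<circ> H_Delta) (bas c) = (\<Sum>Y | upset r Y. \<Sum>Z | upset (Restr r (?X - Y)) Z.
      (bas (cls (Restr r (?X - Y - Z)), cls (Restr r Z), cls (Restr r Y)) :: htop \<times> htop \<times> htop \<Rightarrow>\<^sub>0 'k))"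
    unfolding r(2)
  proof (simp add: H_Delta_cls r(1) qo_Restr lin_sum[OF lin_tmap] tens_sum_left lin_sum[OF lin_tassoc], intro sum.cong refl)
    fix Y Z assume "Y \<in> {Y. upset r Y}" "Z \<in> {Z. upset (Restr r (?X - Y)) Z}"
    then have "Y \<subseteq> ?X" "Z \<subseteq> ?X - Y" by (auto dest: upset_Field upset_Restr_subset[OF r(1)])
    then have "(?X - Y) \<inter> (?X \<inter> (?X - Y) - Z) = ?X - Y - Z" "(?X - Y) \<inter> Z = Z" by auto
    then show "bas (cls (Restr (Restr r (?X - Y)) (Field (Restr r (?X - Y)) - Z)), cls (Restr (Restr r (?X - Y)) Z), cls (Restr r Y)) =
       (bas (cls (Restr r (?X - Y - Z)), cls (Restr r Z), cls (Restr r Y)) :: htop \<times> htop \<times> htop \<Rightarrow>\<^sub>0 'k)"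
      by (simp add: F Restr_Restr)
  qed
  also have "\<dots> = (\<Sum>(Y, Z)\<in>?A. bas (cls (Restr r (?X - Y - Z)), cls (Restr r Z), cls (Restr r Y)))"
    by (rule sum.Sigma) (use fin in auto)
  also have "\<dots> = (\<Sum>(W, V)\<in>?B. bas (cls (Restr r (?X - W)), cls (Restr r (W - V)), cls (Restr r V)))"
  proof (rule sum.reindex_bij_witness[where i = "\<lambda>(W, V). (V, W - V)" and j = "\<lambda>(Y, Z). (Y \<union> Z, Y)"])
    fix p assume p: "p \<in> ?A"
    obtain Y Z where YZ: "p = (Y, Z)" by (cases p)
    have up: "upset r Y" "upset (Restr r (?X - Y)) Z" using p YZ by auto
    then have sub: "Y \<subseteq> ?X" "Z \<subseteq> ?X - Y" by (auto dest: upset_Field upset_Restr_subset[OF r(1)])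
    then show "(case case p of (Y, Z) \<Rightarrow> (Y \<union> Z, Y) of (W, V) \<Rightarrow> (V, W - V)) = p" using YZ by auto
    have "upset r (Y \<union> Z)" "upset (Restr r (Y \<union> Z)) Y"
      using upset_Un[OF r(1) up] by auto
    then show "(case p of (Y, Z) \<Rightarrow> (Y \<union> Z, Y)) \<in> ?B" using YZ by auto
    have "?X - (Y \<union> Z) = ?X - Y - Z" "(Y \<union> Z) - Y = Z" using sub by auto
    then show "(case case p of (Y, Z) \<Rightarrow> (Y \<union> Z, Y) of (W, V) \<Rightarrow> bas (cls (Restr r (?X - W)), cls (Restr r (W - V)), cls (Restr r V))) =
      (case p of (Y, Z) \<Rightarrow> bas (cls (Restr r (?X - Y - Z)), cls (Restr r Z), cls (Restr r Y)))"
      by (simp add: YZ)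
  next
    fix p assume p: "p \<in> ?B"
    obtain W V where WV: "p = (W, V)" by (cases p)
    have up: "upset r W" "upset (Restr r W) V" using p WV by auto
    then have sub: "W \<subseteq> ?X" "V \<subseteq> W" by (auto dest: upset_Field upset_Restr_subset[OF r(1)])
    then show "(case case p of (W, V) \<Rightarrow> (V, W - V) of (Y, Z) \<Rightarrow> (Y \<union> Z, Y)) = p" using WV by auto
    have "upset r V" "upset (Restr r (?X - V)) (W - V)"
      using upset_nested[OF r(1) up] by auto
    then show "(case p of (W, V) \<Rightarrow> (V, W - V)) \<in> ?A" using WV by auto
  qed
  also have "\<dots> = (\<Sum>W | upset r W. \<Sum>V | upset (Restr r W) V.
      bas (cls (Restr r (?X - W)), cls (Restr r (W - V)), cls (Restr r V)))"
    by (rule sum.Sigma[symmetric]) (use fin in auto)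
  also have "\<dots> = (tmap id H_Delta \<circ> H_Delta) (bas c)"
    unfolding r(2)
  proof (simp add: H_Delta_cls r(1) qo_Restr lin_sum[OF lin_tmap] tens_sum_right, intro sum.cong refl)
    fix W V assume "W \<in> {W. upset r W}" "V \<in> {V. upset (Restr r W) V}"
    then have "W \<subseteq> ?X" "V \<subseteq> W" by (auto dest: upset_Field upset_Restr_subset[OF r(1)])
    then have "W \<inter> (?X \<inter> W - V) = W - V" "W \<inter> V = V" by auto
    then show "bas (cls (Restr r (?X - W)), cls (Restr r (W - V)), cls (Restr r V)) =
       (bas (cls (Restr r (?X - W)), cls (Restr (Restr r W) (Field (Restr r W) - V)), cls (Restr (Restr r W) V)) :: htop \<times> htop \<times> htop \<Rightarrow>\<^sub>0 'k)"
      by (simp add: F Restr_Restr)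
  qed
  finally show "(tassoc \<circ> tmap H_Delta id \<circ> H_Delta) (bas c) = (tmap id H_Delta \<circ> (H_Delta :: 'k HT \<Rightarrow> _)) (bas c)" .
qed (intro lin_intros lin_H_Delta)+

lemma sum_single:
  assumes "finite A" "a \<in> A" "\<And>x. x \<in> A \<Longrightarrow> x \<noteq> a \<Longrightarrow> f x = 0"
  shows "sum f A = f a"
proof -
  have "sum f A = sum f {a}" by (rule sum.mono_neutral_right) (use assms in auto)
  then show ?thesis by simp
qed

lemma Restr_Field: "Restr r (Field r) = r"
  by (auto intro: FieldI1 FieldI2)

lemma lin_form_H_Delta_counit: "lin_form H_Delta_counit"
  unfolding H_Delta_counit_def by (rule lin_form_form_ext)

lemma Restr_empty_iff: "qo r \<Longrightarrow> Restr r A = {} \<longleftrightarrow> Field r \<inter> A = {}"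
  using Field_Restr_qo[of r A] by (metis Field_empty Restr_Field Int_empty_left Sigma_empty1 Int_empty_right)

lemma is_coalgebra_H_Delta: "is_coalgebra (H_Delta :: 'k::field HT \<Rightarrow> _) H_Delta_counit"
  unfolding is_coalgebra_def
proof (intro conjI lin_H_Delta lin_form_H_Delta_counit H_Delta_coassoc)
  show "form_left H_Delta_counit \<circ> H_Delta = (id :: 'k HT \<Rightarrow> _)"
  proof (rule lin_eqI)
    fix c
    obtain r where r: "qo r" "c = cls r" by (rule cls_cases)
    have "(form_left H_Delta_counit \<circ> H_Delta) (bas c) =
      (\<Sum>Y | upset r Y. smul (if Restr r (Field r - Y) = {} then 1 else 0) (bas (cls (Restr r Y))) :: 'k HT)"
      by (simp add: r H_Delta_cls lin_sum[OF lin_form_left] H_Delta_counit_cls qo_Restr)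
    also have "\<dots> = bas (cls r)"
      by (subst sum_single[where a = "Field r"])
         (use r finite_upset[OF r(1)] in \<open>auto simp: Restr_empty_iff Restr_Field upset_trivial dest: upset_Field\<close>)
    finally show "(form_left H_Delta_counit \<circ> H_Delta) (bas c) = id (bas c :: 'k HT)" using r by simp
  qed (intro lin_intros lin_H_Delta)+
  show "form_right H_Delta_counit \<circ> H_Delta = (id :: 'k HT \<Rightarrow> _)"
  proof (rule lin_eqI)
    fix c
    obtain r where r: "qo r" "c = cls r" by (rule cls_cases)
    have "(form_right H_Delta_counit \<circ> H_Delta) (bas c) =
      (\<Sum>Y | upset r Y. smul (if Restr r Y = {} then 1 else 0) (bas (cls (Restr r (Field r - Y)))) :: 'k HT)"
      by (simp add: r H_Delta_cls lin_sum[OF lin_form_right] H_Delta_counit_cls qo_Restr)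
    also have "\<dots> = bas (cls r)"
      by (subst sum_single[where a = "{}"])
         (use r finite_upset[OF r(1)] in \<open>auto simp: Restr_empty_iff Restr_Field upset_trivial dest: upset_Field\<close>)
    finally show "(form_right H_Delta_counit \<circ> H_Delta) (bas c) = id (bas c :: 'k HT)" using r by simp
  qed (intro lin_intros lin_H_Delta)+
qed

lemma algebra_hom_H_Delta:
  "is_algebra_hom H_mult H_one (tmult H_mult H_mult) (tens H_one H_one) (H_Delta :: 'k::field HT \<Rightarrow> _)"
  unfolding is_algebra_hom_def
proof (intro conjI lin_H_Delta)
  show "H_Delta H_one = tens H_one (H_one :: 'k HT)"
    by (simp add: H_one_cls H_Delta_cls[OF qo_empty] upset_trivial)
  show "H_Delta \<circ> H_mult = tmult H_mult H_mult \<circ> tmap H_Delta (H_Delta :: 'k HT \<Rightarrow> _)"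
  proof (rule lin_eqI)
    fix p :: "htop \<times> htop"
    obtain a b where p: "p = (a, b)" by (cases p)
    obtain r s where rs: "qo r" "qo s" "a = cls r" "b = cls s" and d: "Field r \<inter> Field s = {}" by (rule cls_cases2)
    let ?A = "{Y. upset r Y} \<times> {Z. upset s Z}"
    have F: "Field (r \<union> s) = Field r \<union> Field s" by simp
    have rD: "r \<subseteq> Field r \<times> Field r" "s \<subseteq> Field s \<times> Field s" by (auto intro: FieldI1 FieldI2)
    have "(tmult H_mult H_mult \<circ> tmap H_Delta H_Delta) (bas p) = (\<Sum>Y | upset r Y. \<Sum>Z | upset s Z.
        (bas (htop_mult (cls (Restr r (Field r - Y))) (cls (Restr s (Field s - Z))),
              htop_mult (cls (Restr r Y)) (cls (Restr s Z))) :: 'k HT2))"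
      by (simp add: p rs H_Delta_cls tens_sum_left tens_sum_right lin_sum[OF lin_tmult]) (rule sum.swap)
    also have "\<dots> = (\<Sum>(Y, Z)\<in>?A. bas (htop_mult (cls (Restr r (Field r - Y))) (cls (Restr s (Field s - Z))),
              htop_mult (cls (Restr r Y)) (cls (Restr s Z))))"
      by (rule sum.cartesian_product)
    \<comment> \<open>Open sets of a disjoint union are pairs of open sets, one from each
      part.\<close>
    also have "\<dots> = (\<Sum>Y | upset (r \<union> s) Y. bas (cls (Restr (r \<union> s) (Field (r \<union> s) - Y)), cls (Restr (r \<union> s) Y)))"
    proof (rule sum.reindex_bij_witness[where i = "\<lambda>Y. (Y \<inter> Field r, Y \<inter> Field s)" and j = "\<lambda>(Y, Z). Y \<union> Z"])
      fix p assume p: "p \<in> ?A"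
      obtain Y Z where YZ: "p = (Y, Z)" by (cases p)
      have up: "upset r Y" "upset s Z" using p YZ by auto
      then have sub: "Y \<subseteq> Field r" "Z \<subseteq> Field s" using upset_Field by auto
      then show "((case p of (Y, Z) \<Rightarrow> Y \<union> Z) \<inter> Field r, (case p of (Y, Z) \<Rightarrow> Y \<union> Z) \<inter> Field s) = p"
        using YZ d by auto
      have "upset (r \<union> s) (Y \<union> Z)"
        using up sub d rD unfolding upset_def F by blast
      then show "(case p of (Y, Z) \<Rightarrow> Y \<union> Z) \<in> {Y. upset (r \<union> s) Y}" using YZ by simp
      have 1: "Restr (r \<union> s) (Y \<union> Z) = Restr r Y \<union> Restr s Z"
        "Restr (r \<union> s) (Field (r \<union> s) - (Y \<union> Z)) = Restr r (Field r - Y) \<union> Restr s (Field s - Z)"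
        using sub d rD unfolding F by blast+
      have "Field (Restr r A) \<inter> Field (Restr s B) = {}" for A B
        using d by (auto simp: Field_Restr_qo rs)
      then show "bas (cls (Restr (r \<union> s) (Field (r \<union> s) - (case p of (Y, Z) \<Rightarrow> Y \<union> Z))),
           cls (Restr (r \<union> s) (case p of (Y, Z) \<Rightarrow> Y \<union> Z))) =
         (case p of (Y, Z) \<Rightarrow> (bas (htop_mult (cls (Restr r (Field r - Y))) (cls (Restr s (Field s - Z))),
              htop_mult (cls (Restr r Y)) (cls (Restr s Z))) :: 'k HT2))"
        unfolding YZ prod.case 1 by (simp add: htop_mult_cls qo_Restr rs)
    next
      fix Y assume "Y \<in> {Y. upset (r \<union> s) Y}"
      then have Y: "upset (r \<union> s) Y" by simp
      then show "(case (Y \<inter> Field r, Y \<inter> Field s) of (Y, Z) \<Rightarrow> Y \<union> Z) = Y"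
        by (auto simp: upset_def)
      show "(Y \<inter> Field r, Y \<inter> Field s) \<in> ?A"
        using Y rD unfolding upset_def by blast
    qed
    also have "\<dots> = (H_Delta \<circ> H_mult) (bas p)"
      by (simp add: p rs htop_mult_cls d H_Delta_cls qo_Un del: Field_Un)
    finally show "(H_Delta \<circ> H_mult) (bas p) = (tmult H_mult H_mult \<circ> tmap H_Delta (H_Delta :: 'k HT \<Rightarrow> _)) (bas p)" ..
  qed (intro lin_intros lin_H_Delta lin_H_mult)+
qed

subsection \<open>The internal coproduct\<close>

lemma lin_H_Gamma: "lin H_Gamma"
  unfolding H_Gamma_def by (rule lin_lin_ext)

lemma lin_form_H_Gamma_counit: "lin_form H_Gamma_counit"
  unfolding H_Gamma_counit_def by (rule lin_form_form_ext)

lemma H_Gamma_coassoc: "tassoc \<circ> tmap H_Gamma id \<circ> H_Gamma = tmap id H_Gamma \<circ> (H_Gamma :: 'k::field HT \<Rightarrow> _)"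
proof (rule lin_eqI)
  fix c
  obtain r where r: "qo r" "c = cls r" by (rule cls_cases)
  let ?A = "SIGMA E:{E. adm r E}. {F. adm (r \<inter> E) F}"
  let ?B = "SIGMA F:{F. adm r F}. {E. adm (quo r F) E}"
  have finA: "finite {F. adm (r \<inter> E) F}" and finB: "finite {F. adm (quo r E) F}" if "adm r E" for E
    using finite_adm qo_Int_adm qo_quo_adm that r(1) by blast+
  note fin = finite_adm[OF r(1)]
  have "(tassoc \<circ> tmap H_Gamma id \<circ> H_Gamma) (bas c) = (\<Sum>E | adm r E. \<Sum>F | adm (r \<inter> E) F.
      (bas (cls (r \<inter> E \<inter> F), cls (quo (r \<inter> E) F), cls (quo r E)) :: htop \<times> htop \<times> htop \<Rightarrow>\<^sub>0 'k))"
    by (simp add: r H_Gamma_cls qo_Int_adm lin_sum[OF lin_tmap] tens_sum_left lin_sum[OF lin_tassoc])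
  also have "\<dots> = (\<Sum>(E, F)\<in>?A. bas (cls (r \<inter> E \<inter> F), cls (quo (r \<inter> E) F), cls (quo r E)))"
    by (rule sum.Sigma) (use fin finA in auto)
  \<comment> \<open>The order of choosing the two partitions is exchanged:
    \<open>adm_nested_iff\<close> matches the index sets, and \<open>F \<subseteq> E\<close> makes
    the three tensor factors equal as relations, not merely isomorphic.\<close>
  also have "\<dots> = (\<Sum>(F, E)\<in>?B. bas (cls (r \<inter> F), cls (quo r F \<inter> E), cls (quo (quo r F) E)))"
  proof (rule sum.reindex_bij_witness[where i = prod.swap and j = prod.swap])
    fix p assume p: "p \<in> ?A"
    obtain E F where EF: "p = (E, F)" by (cases p)
    have a: "adm r E" "adm (r \<inter> E) F" using p EF by auto
    then have FE: "F \<subseteq> E" using adm_nested_subset by blast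
    show "prod.swap p \<in> ?B" using EF a adm_nested_iff by auto
    have "r \<inter> E \<inter> F = r \<inter> F" "quo (r \<inter> E) F = quo r F \<inter> E" "quo (quo r F) E = quo r E"
      using FE quo_Int[OF adm_D(2)[OF a(1), symmetric] FE] quo_quo[OF FE] by auto
    then show "(case prod.swap p of (F, E) \<Rightarrow> bas (cls (r \<inter> F), cls (quo r F \<inter> E), cls (quo (quo r F) E))) =
      (case p of (E, F) \<Rightarrow> bas (cls (r \<inter> E \<inter> F), cls (quo (r \<inter> E) F), cls (quo r E)))"
      by (simp add: EF)
  next
    fix p assume p: "p \<in> ?B"
    then show "prod.swap p \<in> ?A" using adm_nested_iff[of r "snd p" "fst p"] by auto
  qed simp_all
  also have "\<dots> = (\<Sum>F | adm r F. \<Sum>E | adm (quo r F) E. bas (cls (r \<inter> F), cls (quo r F \<inter> E), cls (quo (quo r F) E)))"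
    by (rule sum.Sigma[symmetric]) (use fin finB in auto)
  also have "\<dots> = (tmap id H_Gamma \<circ> H_Gamma) (bas c)"
    by (simp add: r H_Gamma_cls qo_quo_adm lin_sum[OF lin_tmap] tens_sum_right)
  finally show "(tassoc \<circ> tmap H_Gamma id \<circ> H_Gamma) (bas c) = (tmap id H_Gamma \<circ> (H_Gamma :: 'k HT \<Rightarrow> _)) (bas c)" .
qed (intro lin_intros lin_H_Gamma)+

text \<open>Isolates the surviving term of the left counit. Symmetry of \<open>r \<inter> E\<close>
  forces \<open>E \<subseteq> r\<close>, since \<open>E\<close> is generated by it; then the
  quotient is \<open>r\<close> and its classes are \<open>E\<close>.\<close>

lemma adm_finest:
  assumes "qo r"
  shows "adm r (r \<inter> r\<inverse>)" "quo r (r \<inter> r\<inverse>) = r" "adm r E \<Longrightarrow> sym (r \<inter> E) \<longleftrightarrow> E = r \<inter> r\<inverse>"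
proof -
  have t: "trans r" using assms by (rule qoD)
  show q: "quo r (r \<inter> r\<inverse>) = r"
    using t by (simp add: quo_def Un_absorb2)
  have st: "sym (r \<inter> r\<inverse>)" "trans (r \<inter> r\<inverse>)"
    using t unfolding sym_def trans_def by blast+
  have "symcl (r \<inter> r\<inverse>) = r \<inter> r\<inverse>"
    by (rule subset_antisym[OF symcl_least[OF subset_refl st] subset_symcl])
  moreover have "r \<inter> (r \<inter> r\<inverse>) = r \<inter> r\<inverse>" by blast
  ultimately show "adm r (r \<inter> r\<inverse>)"
    by (simp add: adm_def q)
  assume a: "adm r E"
  show "sym (r \<inter> E) \<longleftrightarrow> E = r \<inter> r\<inverse>"
  proof
    assume "sym (r \<inter> E)"
    then have "symcl (r \<inter> E) \<subseteq> r \<inter> E"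
      using qoD(2)[OF qo_Int_adm[OF a assms]] by (intro symcl_least) auto
    then have Er: "E \<subseteq> r" using adm_D(1)[OF a] by blast
    then have "quo r E = r" using t by (simp add: quo_def Un_absorb2)
    then show "E = r \<inter> r\<inverse>" using adm_D(2)[OF a] by simp
  next
    assume "E = r \<inter> r\<inverse>"
    moreover have "r \<inter> (r \<inter> r\<inverse>) = r \<inter> r\<inverse>" by blast
    ultimately show "sym (r \<inter> E)" using st by simp
  qed
qed

text \<open>Isolates the surviving term of the right counit. A symmetric quotient equals its own
  classes, that is \<open>E\<close>; so \<open>r \<subseteq> E\<close>, and \<open>E\<close> is
  generated by all of \<open>r\<close>.\<close>

lemma adm_coarsest:
  assumes "qo r"
  shows "adm r (symcl r)" "r \<inter> symcl r = r" "adm r E \<Longrightarrow> sym (quo r E) \<longleftrightarrow> E = symcl r"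
proof -
  show rs: "r \<inter> symcl r = r" using subset_symcl[of r] by blast
  have q: "quo r (symcl r) = symcl r"
    using symcl_equiv(2)[of r] subset_symcl[of r] by (simp add: quo_def Un_absorb1)
  have "symcl r \<inter> (symcl r)\<inverse> = symcl r"
    using symcl_equiv(1)[of r] by (simp add: sym_conv_converse_eq)
  then show "adm r (symcl r)" by (simp add: adm_def q rs)
  assume a: "adm r E"
  show "sym (quo r E) \<longleftrightarrow> E = symcl r"
  proof
    assume "sym (quo r E)"
    then have "quo r E = E" using adm_D(2)[OF a] by (simp add: sym_conv_converse_eq)
    then have "r \<inter> E = r" using subset_quo(1)[of r E] by blast
    then show "E = symcl r" using adm_D(1)[OF a] by simp
  next
    assume "E = symcl r"
    then show "sym (quo r E)" using q symcl_equiv(1)[of r] by simp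
  qed
qed

lemma is_coalgebra_H_Gamma: "is_coalgebra (H_Gamma :: 'k::field HT \<Rightarrow> _) H_Gamma_counit"
  unfolding is_coalgebra_def
proof (intro conjI lin_H_Gamma lin_form_H_Gamma_counit H_Gamma_coassoc)
  show "form_left H_Gamma_counit \<circ> H_Gamma = (id :: 'k HT \<Rightarrow> _)"
  proof (rule lin_eqI)
    fix c
    obtain r where r: "qo r" "c = cls r" by (rule cls_cases)
    have "(form_left H_Gamma_counit \<circ> H_Gamma) (bas c) =
      (\<Sum>E | adm r E. smul (if E = r \<inter> r\<inverse> then 1 else 0) (bas (cls (quo r E))) :: 'k HT)"
      by (simp add: r H_Gamma_cls lin_sum[OF lin_form_left] H_Gamma_counit_cls qo_Int_adm adm_finest)
    also have "\<dots> = bas (cls r)"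
      by (subst sum_single[where a = "r \<inter> r\<inverse>"]) (use r finite_adm in \<open>auto simp: adm_finest\<close>)
    finally show "(form_left H_Gamma_counit \<circ> H_Gamma) (bas c) = id (bas c :: 'k HT)" using r by simp
  qed (intro lin_intros lin_H_Gamma)+
  show "form_right H_Gamma_counit \<circ> H_Gamma = (id :: 'k HT \<Rightarrow> _)"
  proof (rule lin_eqI)
    fix c
    obtain r where r: "qo r" "c = cls r" by (rule cls_cases)
    have "(form_right H_Gamma_counit \<circ> H_Gamma) (bas c) =
      (\<Sum>E | adm r E. smul (if E = symcl r then 1 else 0) (bas (cls (r \<inter> E))) :: 'k HT)"
      by (simp add: r H_Gamma_cls lin_sum[OF lin_form_right] H_Gamma_counit_cls qo_quo_adm adm_coarsest)
    also have "\<dots> = bas (cls r)"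
      by (subst sum_single[where a = "symcl r"]) (use r finite_adm in \<open>auto simp: adm_coarsest\<close>)
    finally show "(form_right H_Gamma_counit \<circ> H_Gamma) (bas c) = id (bas c :: 'k HT)" using r by simp
  qed (intro lin_intros lin_H_Gamma)+
qed

lemma adm_empty_iff: "adm {} E \<longleftrightarrow> E = {}"
  by (auto simp: adm_def symcl_def quo_def)

text \<open>Cutting and gluing along \<open>Field s\<close>, which is open in
  \<open>r \<union> s\<close> and, by \<open>adm_disjoint_upset\<close>, in each of its admissible
  quotients.\<close>

lemma bij_betw_adm_Un:
  assumes rs: "qo r" "qo s" and d: "Field r \<inter> Field s = {}"
  shows "bij_betw (\<lambda>(E, F). E \<union> F) ({E. adm r E} \<times> {F. adm s F}) {E. adm (r \<union> s) E}"
proof -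
  have q: "qo (r \<union> s)" by (rule qo_Un[OF rs d])
  have rD: "r \<subseteq> Field r \<times> Field r" "s \<subseteq> Field s \<times> Field s" by (auto intro: FieldI1 FieldI2)
  have X: "Field (r \<union> s) - Field s = Field r" using d by auto
  have R: "Restr (r \<union> s) (Field r) = r" "Restr (r \<union> s) (Field s) = s"
    using rD d by blast+
  have up: "upset (r \<union> s) (Field s)"
    using d rD unfolding upset_def by auto
  note glue = adm_glue[OF q up, unfolded X R]
  show ?thesis
  proof (rule bij_betw_byWitness[where f' = "\<lambda>E. (Restr E (Field r), Restr E (Field s))"])
    show "\<forall>p\<in>{E. adm r E} \<times> {F. adm s F}.
        (Restr (case p of (E, F) \<Rightarrow> E \<union> F) (Field r), Restr (case p of (E, F) \<Rightarrow> E \<union> F) (Field s)) = p"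
      using glue(3,4) by auto
    show "(\<lambda>(E, F). E \<union> F) ` ({E. adm r E} \<times> {F. adm s F}) \<subseteq> {E. adm (r \<union> s) E}"
      using glue(1) by auto
    have *: "adm r (Restr E (Field r)) \<and> adm s (Restr E (Field s)) \<and> E = Restr E (Field r) \<union> Restr E (Field s)"
      if "adm (r \<union> s) E" for E
      using adm_restrict(2,3,4)[OF q that adm_disjoint_upset[OF rs d that], unfolded X R] by blast
    show "\<forall>E\<in>{E. adm (r \<union> s) E}. (case (Restr E (Field r), Restr E (Field s)) of (E, F) \<Rightarrow> E \<union> F) = E"
      using * by simp
    show "(\<lambda>E. (Restr E (Field r), Restr E (Field s))) ` {E. adm (r \<union> s) E} \<subseteq> {E. adm r E} \<times> {F. adm s F}"
      using * by auto
  qed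
qed

lemma algebra_hom_H_Gamma:
  "is_algebra_hom H_mult H_one (tmult H_mult H_mult) (tens H_one H_one) (H_Gamma :: 'k::field HT \<Rightarrow> _)"
  unfolding is_algebra_hom_def
proof (intro conjI lin_H_Gamma)
  show "H_Gamma H_one = tens H_one (H_one :: 'k HT)"
    by (simp add: H_one_cls H_Gamma_cls[OF qo_empty] adm_empty_iff quo_def)
  show "H_Gamma \<circ> H_mult = tmult H_mult H_mult \<circ> tmap H_Gamma (H_Gamma :: 'k HT \<Rightarrow> _)"
  proof (rule lin_eqI)
    fix p :: "htop \<times> htop"
    obtain a b where p: "p = (a, b)" by (cases p)
    obtain r s where rs: "qo r" "qo s" "a = cls r" "b = cls s" and d: "Field r \<inter> Field s = {}" by (rule cls_cases2)
    let ?A = "{E. adm r E} \<times> {F. adm s F}"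
    let ?g = "\<lambda>E F. bas (htop_mult (cls (r \<inter> E)) (cls (s \<inter> F)), htop_mult (cls (quo r E)) (cls (quo s F))) :: 'k HT2"
    have "(tmult H_mult H_mult \<circ> tmap H_Gamma H_Gamma) (bas p) = (\<Sum>E | adm r E. \<Sum>F | adm s F. ?g E F)"
      by (simp add: p rs H_Gamma_cls tens_sum_left tens_sum_right lin_sum[OF lin_tmult]) (rule sum.swap)
    also have "\<dots> = (\<Sum>(E, F)\<in>?A. ?g E F)"
      by (rule sum.cartesian_product)
    also have "\<dots> = (\<Sum>p\<in>?A. bas (cls ((r \<union> s) \<inter> (case p of (E, F) \<Rightarrow> E \<union> F)), cls (quo (r \<union> s) (case p of (E, F) \<Rightarrow> E \<union> F))))"
    proof (rule sum.cong[OF refl])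
      fix p assume "p \<in> ?A"
      then obtain E F where EF: "p = (E, F)" "adm r E" "adm s F" by auto
      have FE: "Field E \<subseteq> Field r" "Field F \<subseteq> Field s" using adm_Field EF by auto
      have sub: "r \<subseteq> Field r \<times> Field r" "s \<subseteq> Field s \<times> Field s" "E \<subseteq> Field r \<times> Field r" "F \<subseteq> Field s \<times> Field s"
        using FE by (auto intro: FieldI1 FieldI2)
      have eqs: "(r \<union> s) \<inter> (E \<union> F) = (r \<inter> E) \<union> (s \<inter> F)" "quo (r \<union> s) (E \<union> F) = quo r E \<union> quo s F"
        using sub d quo_Un_disjoint[OF d FE] by blast+
      show "(case p of (E, F) \<Rightarrow> ?g E F) =
          bas (cls ((r \<union> s) \<inter> (case p of (E, F) \<Rightarrow> E \<union> F)), cls (quo (r \<union> s) (case p of (E, F) \<Rightarrow> E \<union> F)))"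
        unfolding EF(1) prod.case eqs
        using d by (simp add: htop_mult_cls qo_Int_adm qo_quo_adm rs EF Field_Int_adm Field_quo_adm)
    qed
    also have "\<dots> = (\<Sum>E | adm (r \<union> s) E. bas (cls ((r \<union> s) \<inter> E), cls (quo (r \<union> s) E)))"
      by (rule sum.reindex_bij_betw[OF bij_betw_adm_Un[OF rs(1,2) d]])
    also have "\<dots> = (H_Gamma \<circ> H_mult) (bas p)"
      by (simp add: p rs htop_mult_cls d H_Gamma_cls qo_Un)
    finally show "(H_Gamma \<circ> H_mult) (bas p) = (tmult H_mult H_mult \<circ> tmap H_Gamma (H_Gamma :: 'k HT \<Rightarrow> _)) (bas p)" ..
  qed (intro lin_intros lin_H_Gamma lin_H_mult)+
qed

lemma H_cointeraction:
  "tmap id H_Delta \<circ> H_Gamma = m13 H_mult \<circ> tmap H_Gamma H_Gamma \<circ> (H_Delta :: 'k::field HT \<Rightarrow> _)"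
proof (rule lin_eqI)
  fix c
  obtain r where r: "qo r" "c = cls r" by (rule cls_cases)
  let ?X = "Field r"
  let ?A = "SIGMA E:{E. adm r E}. {Y. upset (quo r E) Y}"
  let ?B = "SIGMA Y:{Y. upset r Y}. {E. adm (Restr r (?X - Y)) E} \<times> {F. adm (Restr r Y) F}"
  let ?f = "\<lambda>E Y. bas (cls (r \<inter> E), cls (Restr (quo r E) (?X - Y)), cls (Restr (quo r E) Y)) :: htop \<times> htop \<times> htop \<Rightarrow>\<^sub>0 'k"
  let ?g = "\<lambda>Y E F. bas (htop_mult (cls (Restr r (?X - Y) \<inter> E)) (cls (Restr r Y \<inter> F)),
      cls (quo (Restr r (?X - Y)) E), cls (quo (Restr r Y) F)) :: htop \<times> htop \<times> htop \<Rightarrow>\<^sub>0 'k"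
  have finA: "finite {Y. upset (quo r E) Y}" if "adm r E" for E
    using finite_upset qo_quo_adm that r(1) by blast
  have finB: "finite {E. adm (Restr r A) E}" for A
    using finite_adm qo_Restr r(1) by blast
  have "(tmap id H_Delta \<circ> H_Gamma) (bas c) = (\<Sum>E | adm r E. \<Sum>Y | upset (quo r E) Y. ?f E Y)"
    by (simp add: r H_Gamma_cls H_Delta_cls qo_quo_adm Field_quo_adm lin_sum[OF lin_tmap] tens_sum_right)
  also have "\<dots> = (\<Sum>(E, Y)\<in>?A. ?f E Y)"
    by (rule sum.Sigma) (use finite_adm[OF r(1)] finA in auto)
  \<comment> \<open>\<open>adm_restrict\<close> gives the map from left to right and
    \<open>adm_glue\<close> its inverse.\<close>
  also have "\<dots> = (\<Sum>(Y, E, F)\<in>?B. ?g Y E F)"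
  proof (rule sum.reindex_bij_witness[where i = "\<lambda>(Y, E, F). (E \<union> F, Y)"
        and j = "\<lambda>(E, Y). (Y, Restr E (?X - Y), Restr E Y)"])
    fix p assume p: "p \<in> ?A"
    obtain E Y where EY: "p = (E, Y)" by (cases p)
    have a: "adm r E" "upset (quo r E) Y" using p EY by auto
    note res = adm_restrict[OF r(1) a]
    show "(case case p of (E, Y) \<Rightarrow> (Y, Restr E (?X - Y), Restr E Y) of (Y, E, F) \<Rightarrow> (E \<union> F, Y)) = p"
      using res(4) EY by simp
    show "(case p of (E, Y) \<Rightarrow> (Y, Restr E (?X - Y), Restr E Y)) \<in> ?B"
      using res(1,2,3) EY by simp
    \<comment> \<open>Edges of \<open>r\<close> across the boundary of \<open>Y\<close> are not in
      \<open>E\<close>, so \<open>T'\<close> is a disjoint union of its two restrictions. This is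
      the product formed by \<open>m13\<close>.\<close>
    have 1: "r \<inter> E = (Restr r (?X - Y) \<inter> Restr E (?X - Y)) \<union> (Restr r Y \<inter> Restr E Y)"
      using res(4) by blast
    have "Field (Restr r (?X - Y) \<inter> Restr E (?X - Y)) \<inter> Field (Restr r Y \<inter> Restr E Y) = {}"
      by (auto simp: Field_Int_adm[OF res(2)] Field_Int_adm[OF res(3)] qo_Restr r Field_Restr_qo)
    then show "(case case p of (E, Y) \<Rightarrow> (Y, Restr E (?X - Y), Restr E Y) of (Y, E, F) \<Rightarrow> ?g Y E F) =
       (case p of (E, Y) \<Rightarrow> ?f E Y)"
      unfolding EY prod.case res(5,6)
      by (subst 1) (simp add: htop_mult_cls qo_Int_adm[OF res(2)] qo_Int_adm[OF res(3)] qo_Restr r)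
  next
    fix p assume p: "p \<in> ?B"
    obtain Y E F where YEF: "p = (Y, E, F)" by (metis surj_pair)
    have a: "upset r Y" "adm (Restr r (?X - Y)) E" "adm (Restr r Y) F" using p YEF by auto
    note glue = adm_glue[OF r(1) a]
    show "(case case p of (Y, E, F) \<Rightarrow> (E \<union> F, Y) of (E, Y) \<Rightarrow> (Y, Restr E (?X - Y), Restr E Y)) = p"
      using glue(3,4) YEF by simp
    show "(case p of (Y, E, F) \<Rightarrow> (E \<union> F, Y)) \<in> ?A"
      using glue(1,2) YEF by simp
  qed
  also have "\<dots> = (\<Sum>Y | upset r Y. \<Sum>(E, F)\<in>{E. adm (Restr r (?X - Y)) E} \<times> {F. adm (Restr r Y) F}. ?g Y E F)"
    by (subst sum.Sigma) (use finite_upset[OF r(1)] finB in auto)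
  also have "\<dots> = (\<Sum>Y | upset r Y. \<Sum>E | adm (Restr r (?X - Y)) E. \<Sum>F | adm (Restr r Y) F. ?g Y E F)"
    by (simp add: sum.cartesian_product)
  also have "\<dots> = (m13 H_mult \<circ> tmap H_Gamma H_Gamma \<circ> H_Delta) (bas c)"
  proof -
    have "m13 H_mult (tens (H_Gamma (bas (cls (Restr r (?X - Y))))) (H_Gamma (bas (cls (Restr r Y))))) =
        (\<Sum>E | adm (Restr r (?X - Y)) E. \<Sum>F | adm (Restr r Y) F. ?g Y E F)" for Y
      by (simp add: H_Gamma_cls qo_Restr r tens_sum_left tens_sum_right lin_sum[OF lin_m13]) (rule sum.swap)
    then show ?thesis
      by (simp add: r H_Delta_cls lin_sum[OF lin_tmap] lin_sum[OF lin_m13])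
  qed
  finally show "(tmap id H_Delta \<circ> H_Gamma) (bas c) = (m13 H_mult \<circ> tmap H_Gamma H_Gamma \<circ> (H_Delta :: 'k HT \<Rightarrow> _)) (bas c)" .
qed (intro lin_intros lin_H_Gamma lin_H_Delta)+

text \<open>A quotient has the same points as \<open>r\<close>, so the counit of \<Delta> gives 0
  throughout unless \<open>r\<close> is empty, when \<open>E = {}\<close> is the only term.\<close>

lemma H_counit_comodule: "form_right H_Delta_counit (H_Gamma x) = smul (H_Delta_counit x) (H_one :: 'k::field HT)"
proof -
  have "form_right H_Delta_counit \<circ> H_Gamma = (\<lambda>x. smul (H_Delta_counit x) (H_one :: 'k HT))"
  proof (rule lin_eqI)
    fix c
    obtain r where r: "qo r" "c = cls r" by (rule cls_cases)
    have q: "quo r E = {} \<longleftrightarrow> r = {}" if "adm r E" for E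
      using Field_quo_adm[OF that r(1)] by (metis Field_empty Restr_Field Int_empty_left Sigma_empty1 Int_empty_right)
    have "(form_right H_Delta_counit \<circ> H_Gamma) (bas c) =
      (\<Sum>E | adm r E. smul (if r = {} then 1 else 0) (bas (cls (r \<inter> E))) :: 'k HT)"
      by (simp add: r H_Gamma_cls lin_sum[OF lin_form_right] H_Delta_counit_cls qo_quo_adm q)
    also have "\<dots> = smul (H_Delta_counit (bas c)) H_one"
      by (cases "r = {}") (simp_all add: r H_Delta_counit_cls adm_empty_iff H_one_cls qo_empty)
    finally show "(form_right H_Delta_counit \<circ> H_Gamma) (bas c) = smul (H_Delta_counit (bas c)) (H_one :: 'k HT)" .
  qed (intro lin_intros lin_H_Gamma lin_form_smul lin_form_H_Delta_counit)+
  then show ?thesis by (metis comp_apply)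
qed

subsection \<open>The two gradings\<close>

lemma H_mult_grade:
  assumes s: "\<And>a b. s (htop_mult a b) = s a + s b"
    and x: "x \<in> basis_grade s i" and y: "y \<in> basis_grade s j"
  shows "H_mult (tens x y) \<in> (basis_grade s (i + j) :: 'k::field HT set)"
proof -
  have sub: "free_vs.subspace (basis_grade s n :: 'k HT set)" for n
    by (simp add: basis_grade_def free_vs.subspace_span)
  have 1: "H_mult (tens (bas a) y) \<in> basis_grade s (i + j)" if a: "s a = i" for a
    by (rule lin_maps_basis_grade[OF lin_compose[OF lin_H_mult tens_bilinear(2)] sub _ y])
       (simp add: bas_in_basis_grade s a)
  show ?thesis
    by (rule lin_maps_basis_grade[OF lin_compose[OF lin_H_mult tens_bilinear(1)] sub 1 x])
qed

lemma lin_maps_tgrade: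
  assumes "lin D" "\<And>c. D (bas c) \<in> tgrade (basis_grade s) (s c)" "x \<in> basis_grade s n"
  shows "D x \<in> tgrade (basis_grade s) n"
  by (rule lin_maps_basis_grade[OF assms(1) _ _ assms(3)])
     (use assms(2) in \<open>auto simp: tgrade_def free_vs.subspace_span\<close>)

lemma sum_bas_in_tgrade:
  assumes "\<And>i. i \<in> I \<Longrightarrow> s (f i) + s (g i) = n"
  shows "(\<Sum>i\<in>I. bas (f i, g i)) \<in> tgrade (basis_grade s) n"
proof -
  have "free_vs.subspace (tgrade (basis_grade s) n)"
    by (simp add: tgrade_def free_vs.subspace_span)
  then show ?thesis
    by (rule free_vs.subspace_sum) (use assms in \<open>auto simp: tgrade_basis_grade_iff bas_def\<close>)
qed

lemma form_ext_grade:
  assumes "\<And>c. 0 < s c \<Longrightarrow> f c = 0" "0 < n" "x \<in> basis_grade s n"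
  shows "form_ext f x = 0"
  using assms by (auto simp: form_ext_def basis_grade_iff intro!: sum.neutral)

definition htop_size :: "htop \<Rightarrow> nat" where
  "htop_size c = card (topspace (rep_htop c))"

definition htop_degree :: "htop \<Rightarrow> nat" where
  "htop_degree c = top_degree (rep_htop c)"

lemma H_size_eq: "H_size = basis_grade htop_size"
  by (simp add: fun_eq_iff H_size_def basis_grade_def htop_size_def)

lemma H_degree_eq: "H_degree = basis_grade htop_degree"
  by (simp add: fun_eq_iff H_degree_def basis_grade_def htop_degree_def)

lemma htop_size_cls: "qo r \<Longrightarrow> htop_size (cls r) = card (Field r)"
  by (simp add: htop_size_def card_topspace_cls)

lemma htop_degree_cls: "qo r \<Longrightarrow> htop_degree (cls r) = qo_degree r"
  by (simp add: htop_degree_def top_degree_cls)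

lemma htop_size_mult: "htop_size (htop_mult a b) = htop_size a + htop_size b"
proof -
  obtain r s where "qo r" "qo s" "a = cls r" "b = cls s" "Field r \<inter> Field s = {}" by (rule cls_cases2)
  then show ?thesis by (simp add: htop_mult_cls htop_size_cls qo_Un card_Un_disjoint qoD)
qed

lemma card_quotient_Un:
  assumes "finite X" "finite Y" "X \<inter> Y = {}" "A \<subseteq> X \<times> X" "B \<subseteq> Y \<times> Y"
    and "\<And>x. x \<in> X \<Longrightarrow> (x, x) \<in> A" "\<And>y. y \<in> Y \<Longrightarrow> (y, y) \<in> B"
  shows "card ((X \<union> Y) // (A \<union> B)) = card (X // A) + card (Y // B)"
proof -
  have "(A \<union> B) `` {x} = A `` {x}" if "x \<in> X" for x using assms that by blast
  moreover have "(A \<union> B) `` {y} = B `` {y}" if "y \<in> Y" for y using assms that by blast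
  ultimately have "(X \<union> Y) // (A \<union> B) = X // A \<union> Y // B" by (auto simp: quotient_def)
  \<comment> \<open>Reflexivity makes the classes of \<open>A\<close> nonempty, so none of them can
    also be a class of \<open>B\<close>.\<close>
  moreover have "X // A \<inter> Y // B = {}"
  proof -
    have "C \<subseteq> X \<and> C \<noteq> {}" if "C \<in> X // A" for C using that assms(4,6) by (auto simp: quotient_def)
    moreover have "C \<subseteq> Y" if "C \<in> Y // B" for C using that assms(5) by (auto simp: quotient_def)
    ultimately show ?thesis using assms(3) by fast
  qed
  moreover have "finite (X // A)" "finite (Y // B)" using assms(1,2) by (simp_all add: quotient_def)
  ultimately show ?thesis by (simp add: card_Un_disjoint)
qed

text \<open>Makes the natural-number subtraction in \<open>qo_degree\<close> exact, so that degrees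
  can be added by linear arithmetic.\<close>

lemma card_components_le_card_classes_qo:
  assumes "qo r"
  shows "card (Field r // symcl r) \<le> card (Field r // (r \<inter> r\<inverse>))"
proof -
  have "{(x, y). spec_eq (top_of r) x y} = r \<inter> r\<inverse>"
    using rel_of_top_of[OF assms] by (auto simp: rel_of_def spec_eq_def)
  then show ?thesis
    using card_components_le_card_classes[of "top_of r"] qoD(4)[OF assms]
    by (simp add: connected_components_of_top_of[OF assms])
qed

lemma qo_degree_Un:
  assumes "qo r" "qo s" and d: "Field r \<inter> Field s = {}"
  shows "qo_degree (r \<union> s) = qo_degree r + qo_degree s"
proof -
  have sub: "r \<subseteq> Field r \<times> Field r" "s \<subseteq> Field s \<times> Field s" "symcl r \<subseteq> Field r \<times> Field r" "symcl s \<subseteq> Field s \<times> Field s"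
    by (auto intro: FieldI1 FieldI2) (metis FieldI1 FieldI2 Field_symcl)+
  have 1: "(r \<union> s) \<inter> (r \<union> s)\<inverse> = (r \<inter> r\<inverse>) \<union> (s \<inter> s\<inverse>)" using sub(1,2) d by blast
  have "(r \<union> s) \<union> (r \<union> s)\<inverse> = (r \<union> r\<inverse>) \<union> (s \<union> s\<inverse>)" by blast
  then have 2: "symcl (r \<union> s) = symcl r \<union> symcl s"
    unfolding symcl_def using d by (simp add: trancl_Un_disjoint)
  have "card (Field (r \<union> s) // ((r \<union> s) \<inter> (r \<union> s)\<inverse>)) = card (Field r // (r \<inter> r\<inverse>)) + card (Field s // (s \<inter> s\<inverse>))"
    unfolding 1 Field_Un by (rule card_quotient_Un) (use assms sub in \<open>auto simp: qoD\<close>)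
  moreover have "card (Field (r \<union> s) // symcl (r \<union> s)) = card (Field r // symcl r) + card (Field s // symcl s)"
    unfolding 2 Field_Un by (rule card_quotient_Un)
      (use assms sub subset_symcl[of r] subset_symcl[of s] in \<open>auto simp: qoD subset_iff\<close>)
  ultimately show ?thesis
    using card_components_le_card_classes_qo[OF assms(1)] card_components_le_card_classes_qo[OF assms(2)]
    unfolding qo_degree_def by linarith
qed

lemma htop_degree_mult: "htop_degree (htop_mult a b) = htop_degree a + htop_degree b"
proof -
  obtain r s where "qo r" "qo s" "a = cls r" "b = cls s" "Field r \<inter> Field s = {}" by (rule cls_cases2)
  then show ?thesis by (simp add: htop_mult_cls htop_degree_cls qo_Un qo_degree_Un)
qed

text \<open>The sum telescopes through \<open>E\<close>: \<open>r \<inter> E\<close> has the classes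
  of \<open>r\<close> and the components \<open>E\<close>, while \<open>quo r E\<close> has the
  classes \<open>E\<close> and the components of \<open>r\<close>.\<close>

lemma qo_degree_adm:
  assumes r: "qo r" and a: "adm r E"
  shows "qo_degree (r \<inter> E) + qo_degree (quo r E) = qo_degree r"
proof -
  have "r \<inter> r\<inverse> \<subseteq> quo r E \<inter> (quo r E)\<inverse>" using subset_quo(1)[of r E] by blast
  then have "r \<inter> r\<inverse> \<subseteq> E" using adm_D(2)[OF a] by simp
  then have 1: "(r \<inter> E) \<inter> (r \<inter> E)\<inverse> = r \<inter> r\<inverse>"
    using adm_equiv(1)[OF a] unfolding sym_def by blast
  have 2: "symcl (r \<inter> E) = E" using adm_D(1)[OF a] by simp
  have "E \<subseteq> symcl r" using symcl_mono[of "r \<inter> E" r] 2 by simp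
  then have "r \<union> E \<subseteq> symcl r" using subset_symcl[of r] by blast
  then have "quo r E \<subseteq> symcl r" unfolding quo_def by (intro trancl_least symcl_equiv)
  then have "symcl (quo r E) \<subseteq> symcl r" by (intro symcl_least symcl_equiv)
  moreover have "symcl r \<subseteq> symcl (quo r E)" by (intro symcl_mono subset_quo)
  ultimately have 3: "symcl (quo r E) = symcl r" by blast
  show ?thesis
    using card_components_le_card_classes_qo[OF qo_Int_adm[OF a r]]
      card_components_le_card_classes_qo[OF qo_quo_adm[OF a r]]
    unfolding qo_degree_def 1 2 3 Field_Int_adm[OF a r] Field_quo_adm[OF a r] adm_D(2)[OF a]
    by linarith
qed

section \<open>Assembly of the bialgebra and grading axioms\<close>

lemma is_bialgebra_H_Delta: "is_bialgebra H_mult (H_one :: 'k::field HT) H_Delta H_Delta_counit"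
  unfolding is_bialgebra_def
proof (intro conjI allI is_algebra_H is_coalgebra_H_Delta algebra_hom_H_Delta)
  show "H_Delta_counit (H_mult (tens x y)) = H_Delta_counit x * (H_Delta_counit y :: 'k)" for x y
    unfolding H_Delta_counit_def
  proof (rule form_ext_mult)
    fix a b :: htop
    obtain r s where rs: "qo r" "qo s" "a = cls r" "b = cls s" "Field r \<inter> Field s = {}" by (rule cls_cases2)
    then have "H_Delta_counit (bas (htop_mult a b)) = H_Delta_counit (bas a) * (H_Delta_counit (bas b) :: 'k)"
      by (simp add: htop_mult_cls H_Delta_counit_cls qo_Un)
    then show "(if topspace (rep_htop (htop_mult a b)) = {} then 1 else 0) =
      (if topspace (rep_htop a) = {} then 1 else 0) * (if topspace (rep_htop b) = {} then 1 else (0 :: 'k))"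
      unfolding H_Delta_counit_def form_ext_bas .
  qed
  show "H_Delta_counit (H_one :: 'k HT) = 1" by (simp add: H_one_cls H_Delta_counit_cls qo_empty)
qed

lemma is_bialgebra_H_Gamma: "is_bialgebra H_mult (H_one :: 'k::field HT) H_Gamma H_Gamma_counit"
  unfolding is_bialgebra_def
proof (intro conjI allI is_algebra_H is_coalgebra_H_Gamma algebra_hom_H_Gamma)
  show "H_Gamma_counit (H_mult (tens x y)) = H_Gamma_counit x * (H_Gamma_counit y :: 'k)" for x y
    unfolding H_Gamma_counit_def
  proof (rule form_ext_mult)
    fix a b :: htop
    obtain r s where rs: "qo r" "qo s" "a = cls r" "b = cls s" and d: "Field r \<inter> Field s = {}" by (rule cls_cases2)
    have "r \<subseteq> Field r \<times> Field r" "s \<subseteq> Field s \<times> Field s" by (auto intro: FieldI1 FieldI2)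
    then have "sym (r \<union> s) \<longleftrightarrow> sym r \<and> sym s" using d unfolding sym_def by blast
    then have "H_Gamma_counit (bas (htop_mult a b)) = H_Gamma_counit (bas a) * (H_Gamma_counit (bas b) :: 'k)"
      using rs d by (simp add: htop_mult_cls H_Gamma_counit_cls qo_Un)
    then show "(let T = rep_htop (htop_mult a b) in if equiv (topspace T) {(x, y). spec_le T x y} then 1 else 0) =
      (let T = rep_htop a in if equiv (topspace T) {(x, y). spec_le T x y} then 1 else 0) *
      (let T = rep_htop b in if equiv (topspace T) {(x, y). spec_le T x y} then 1 else (0 :: 'k))"
      unfolding H_Gamma_counit_def form_ext_bas .
  qed
  show "H_Gamma_counit (H_one :: 'k HT) = 1" by (simp add: H_one_cls H_Gamma_counit_cls qo_empty sym_def)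
qed

lemma is_graded_bialgebra_H_Delta:
  "is_graded_bialgebra (basis_grade htop_size) H_mult (H_one :: 'k::field HT) H_Delta H_Delta_counit"
  unfolding is_graded_bialgebra_def
proof (intro conjI allI ballI impI is_bialgebra_H_Delta is_grading_basis_grade)
  show "H_one \<in> (basis_grade htop_size 0 :: 'k HT set)"
    by (simp add: H_one_cls bas_in_basis_grade htop_size_cls qo_empty)
  show "H_mult (tens x y) \<in> basis_grade htop_size (i + j)"
    if "x \<in> basis_grade htop_size i" "y \<in> basis_grade htop_size j" for i j and x y :: "'k HT"
    using H_mult_grade htop_size_mult that by blast
  show "H_Delta_counit x = 0" if "0 < n" "x \<in> basis_grade htop_size n" for n and x :: "'k HT"
    unfolding H_Delta_counit_def
    by (rule form_ext_grade[OF _ that]) (auto simp: htop_size_def)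
  show "H_Delta x \<in> tgrade (basis_grade htop_size) n" if "x \<in> basis_grade htop_size n" for n and x :: "'k HT"
  proof (rule lin_maps_tgrade[OF lin_H_Delta _ that])
    fix c
    obtain r where r: "qo r" "c = cls r" by (rule cls_cases)
    show "(H_Delta (bas c) :: 'k HT2) \<in> tgrade (basis_grade htop_size) (htop_size c)"
      unfolding r H_Delta_cls[OF r(1)]
    proof (rule sum_bas_in_tgrade)
      fix Y assume "Y \<in> {Y. upset r Y}"
      then have "Y \<subseteq> Field r" using upset_Field by blast
      then have "card (Field r - Y) + card Y = card (Field r)" "Field r \<inter> (Field r - Y) = Field r - Y" "Field r \<inter> Y = Y"
        using qoD(4)[OF r(1)] by (auto simp: card_Diff_subset finite_subset card_mono)
      then show "htop_size (cls (Restr r (Field r - Y))) + htop_size (cls (Restr r Y)) = htop_size (cls r)"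
        by (simp add: htop_size_cls qo_Restr r Field_Restr_qo)
    qed
  qed
qed

lemma is_graded_bialgebra_H_Gamma:
  "is_graded_bialgebra (basis_grade htop_degree) H_mult (H_one :: 'k::field HT) H_Gamma H_Gamma_counit"
  unfolding is_graded_bialgebra_def
proof (intro conjI allI ballI impI is_bialgebra_H_Gamma is_grading_basis_grade)
  show "H_one \<in> (basis_grade htop_degree 0 :: 'k HT set)"
    by (simp add: H_one_cls bas_in_basis_grade htop_degree_cls qo_empty qo_degree_def)
  show "H_mult (tens x y) \<in> basis_grade htop_degree (i + j)"
    if "x \<in> basis_grade htop_degree i" "y \<in> basis_grade htop_degree j" for i j and x y :: "'k HT"
    using H_mult_grade htop_degree_mult that by blast
  show "H_Gamma_counit x = 0" if "0 < n" "x \<in> basis_grade htop_degree n" for n and x :: "'k HT"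
    unfolding H_Gamma_counit_def
  proof (rule form_ext_grade[OF _ that])
    fix c assume pos: "0 < htop_degree c"
    obtain r where r: "qo r" "c = cls r" by (rule cls_cases)
    have "\<not> sym r"
    proof
      \<comment> \<open>For an equivalence relation classes and components coincide, so the degree
        is 0.\<close>
      assume s: "sym r"
      then have "r \<inter> r\<inverse> = r" by (simp add: sym_conv_converse_eq)
      moreover have "symcl r = r"
        by (rule subset_antisym[OF symcl_least[OF subset_refl s qoD(2)[OF r(1)]] subset_symcl])
      ultimately show False using pos by (simp add: r htop_degree_cls qo_degree_def)
    qed
    then have "H_Gamma_counit (bas c) = (0 :: 'k)" by (simp add: r H_Gamma_counit_cls)
    then show "(let T = rep_htop c in if equiv (topspace T) {(x, y). spec_le T x y} then 1 else 0) = (0 :: 'k)"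
      unfolding H_Gamma_counit_def form_ext_bas .
  qed
  show "H_Gamma x \<in> tgrade (basis_grade htop_degree) n" if "x \<in> basis_grade htop_degree n" for n and x :: "'k HT"
  proof (rule lin_maps_tgrade[OF lin_H_Gamma _ that])
    fix c
    obtain r where r: "qo r" "c = cls r" by (rule cls_cases)
    show "(H_Gamma (bas c) :: 'k HT2) \<in> tgrade (basis_grade htop_degree) (htop_degree c)"
      unfolding r H_Gamma_cls[OF r(1)]
      by (rule sum_bas_in_tgrade)
         (simp add: htop_degree_cls qo_Int_adm qo_quo_adm r qo_degree_adm)
  qed
qed

lemma htop_size_0: "htop_size c = 0 \<Longrightarrow> bas c = (H_one :: 'k::field HT)"
proof -
  assume a: "htop_size c = 0"
  obtain r where r: "qo r" "c = cls r" by (rule cls_cases)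
  then have "Field r = {}" using a by (simp add: htop_size_cls qoD)
  then have "r = {}" using Restr_Field[of r] by auto
  then show ?thesis by (simp add: r H_one_cls)
qed

lemma is_connected_grading_H: "is_connected_grading (basis_grade htop_size) (H_one :: 'k::field HT)"
proof -
  have "{c. htop_size c = 0} = {cls {}}"
  proof (intro set_eqI iffI)
    fix c assume "c \<in> {c. htop_size c = 0}"
    then have "(bas c :: 'k HT) = bas (cls {})" using htop_size_0[of c] by (simp add: H_one_cls)
    then have "Poly_Mapping.keys (bas c :: 'k HT) = Poly_Mapping.keys (bas (cls {}) :: 'k HT)" by (rule arg_cong)
    then show "c \<in> {cls {}}" by (simp add: bas_def)
  qed (simp add: htop_size_cls qo_empty)
  moreover have "Poly_Mapping.keys (bas (cls {}) :: 'k HT) \<noteq> {}" by (simp add: bas_def)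
  then have "(bas (cls {}) :: 'k HT) \<noteq> 0" by auto
  ultimately show ?thesis by (simp add: is_connected_grading_def basis_grade_def H_one_cls)
qed

theorem theorem4p1:
  defines "m \<equiv> (H_mult :: 'k::field HT2 \<Rightarrow> 'k HT)"
    and "u \<equiv> (H_one :: 'k HT)"
    and "\<Delta> \<equiv> (H_Delta :: 'k HT \<Rightarrow> 'k HT2)"
    and "\<Gamma> \<equiv> (H_Gamma :: 'k HT \<Rightarrow> 'k HT2)"
  shows
    "(is_commutative m \<and> is_graded_hopf_algebra H_size m u \<Delta> H_Delta_counit \<and>
        is_connected_grading (H_size :: nat \<Rightarrow> 'k HT set) u) \<and>
     (is_commutative m \<and> is_graded_bialgebra H_degree m u \<Gamma> H_Gamma_counit) \<and>
     is_comodule_coalgebra m u \<Gamma> H_Gamma_counit \<Gamma> \<Delta> H_Delta_counit \<and>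
     is_algebra_hom m u (tmult m m) (tens u u) \<Delta> \<and>
     is_algebra_hom m u (tmult m m) (tens u u) \<Gamma> \<and>
     is_algebra_hom (tmult m m) (tens u u)
        (tmult m (tmult m m)) (tens u (tens u u)) (tmap id \<Delta>) \<and>
     is_algebra_hom (tmult m m) (tens u u)
        (tmult (tmult m m) (tmult m m)) (tens (tens u u) (tens u u)) (tmap \<Gamma> \<Gamma>) \<and>
     is_algebra_hom (tmult (tmult m m) (tmult m m)) (tens (tens u u) (tens u u))
        (tmult m (tmult m m)) (tens u (tens u u)) (m13 m) \<and>
     tmap id \<Delta> \<circ> \<Gamma> = m13 m \<circ> tmap \<Gamma> \<Gamma> \<circ> \<Delta>"
proof -
  interpret gcb: graded_connected_bialgebra htop_size m u \<Delta> H_Delta_counit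
    unfolding m_def u_def \<Delta>_def
    by unfold_locales (rule is_graded_bialgebra_H_Delta, rule htop_size_0)
  have "is_graded_hopf_algebra H_size m u \<Delta> H_Delta_counit"
    unfolding is_graded_hopf_algebra_def H_size_eq
    using gcb.graded gcb.antipode_exists by blast
  \<comment> \<open>The coaction is \<Gamma> itself, so the comodule axioms are among the coalgebra
    axioms of \<Gamma>. What remains is that the coproduct and counit of \<Delta> are comodule maps:
    \<open>H_cointeraction\<close> and \<open>H_counit_comodule\<close>.\<close>
  moreover have "is_comodule_coalgebra m u \<Gamma> H_Gamma_counit \<Gamma> \<Delta> H_Delta_counit"
    using is_coalgebra_H_Gamma[where 'k = 'k]
    unfolding is_comodule_coalgebra_def is_comodule_def is_coalgebra_def[of H_Gamma] m_def u_def \<Delta>_def \<Gamma>_def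
    by (simp add: is_bialgebra_H_Gamma is_coalgebra_H_Delta H_cointeraction H_counit_comodule)
  moreover have "is_algebra_hom (tmult m m) (tens u u) (tmult m (tmult m m)) (tens u (tens u u)) (tmap id \<Delta>)"
    unfolding m_def u_def \<Delta>_def
    by (intro algebra_hom_tmap algebra_hom_id algebra_hom_H_Delta lin_H_mult lin_tmult)
  moreover have "is_algebra_hom (tmult m m) (tens u u)
      (tmult (tmult m m) (tmult m m)) (tens (tens u u) (tens u u)) (tmap \<Gamma> \<Gamma>)"
    unfolding m_def u_def \<Gamma>_def
    by (intro algebra_hom_tmap algebra_hom_H_Gamma lin_H_mult lin_tmult)
  ultimately show ?thesis
    unfolding m_def u_def \<Delta>_def \<Gamma>_def H_degree_eq
    by (simp add: H_size_eq is_commutative_H is_connected_grading_H is_graded_bialgebra_H_Gamma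
        algebra_hom_H_Delta algebra_hom_H_Gamma algebra_hom_m13 H_cointeraction)
qed

end
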